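(* Let $d\ge3$ and $r\ge1$ be integers. Assume that $F=\mathcal S_d[f]$ on $[0,1]$ for some $f\colon[0,1]\to\mathbb{R}$ with $f(|\cdot|)\in H^r([-1,1])$. For $K\in\mathbb{N}$, $K\ge1$, let $a=a^{(K)}\in\mathbb{R}^K$ be the minimizer of $$\min_{a\in\mathbb{R}^K}\|\mathcal S_d[f_a]-F\|_{\mathcal H}^2,\qquad f_a=\sum_{k=0}^{K-1}a_kg_k .$$ (i) If $\mathcal H=L^2([0,1])$, there is a constant $C>0$ independent of $K$ such that $\|F-\mathcal S_d[f_a]\|_{L^2([0,1])}\le C\,K^{-\frac{r}{1+2r/(d-1)}}$ for all $K\ge1$. (ii) If $\mathcal H=H^1([0,1])$, there is a constant $C>0$ independent of $K$ such that $\|F-\mathcal S_d[f_a]\|_{H^1([0,1])}\le C\,K^{-\frac{r-1}{1+2r/(d-3)}}$ for all $K\ge1$, where the exponent is read as $-\frac{(r-1)(d-3)}{d-3+2r}$ (so it equals $0$ when $d=3$).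
   Context: For an integer $d\ge 3$ let $\varrho_d(t)=c_d(1-t^2)^{\frac{d-3}{2}}$ with $c_d=\frac{2\Gamma(d/2)}{\sqrt{\pi}\,\Gamma((d-1)/2)}$, and define the slicing operator $\mathcal S_d[f](s)=\int_0^1 f(ts)\varrho_d(t)\,\mathrm{d}t$, $s\in[0,1]$. The cosine system is $g_0(t)=1$ and $g_k(t)=\sqrt2\cos(\pi kt)$ for $k\ge1$. $H^r$ denotes the Sobolev space of functions whose weak derivatives up to order $r$ are in $L^2$, and $\|f\|_{H^1([0,1])}^2=\|f\|_{L^2([0,1])}^2+\|f'\|_{L^2([0,1])}^2$. The constant $C$ may depend on $f$, $d$ and $r$. *)

theory Defs
  imports "HOL-Analysis.Analysis"
begin

definition L2_space :: "real \<Rightarrow> real \<Rightarrow> (real \<Rightarrow> real) set" where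
  "L2_space a b = {f. set_borel_measurable lebesgue {a..b} f \<and>
                      set_integrable lebesgue {a..b} (\<lambda>x. (f x)\<^sup>2)}"

text \<open>The Bochner integral of a non-integrable function is 0, so the following is the
  L2 norm only for members of \<^const>\<open>L2_space\<close>.\<close>

definition L2_norm :: "real \<Rightarrow> real \<Rightarrow> (real \<Rightarrow> real) \<Rightarrow> real" where
  "L2_norm a b f = sqrt (LINT x:{a..b}|lebesgue. (f x)\<^sup>2)"

definition test_fun :: "real \<Rightarrow> real \<Rightarrow> (real \<Rightarrow> real) \<Rightarrow> bool" where
  "test_fun a b \<phi> \<longleftrightarrow> (\<forall>n x. ((deriv ^^ n) \<phi>) field_differentiable (at x)) \<and>
                   closure {x. \<phi> x \<noteq> 0} \<subseteq> {a<..<b}"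

definition locally_integrable :: "real \<Rightarrow> real \<Rightarrow> (real \<Rightarrow> real) \<Rightarrow> bool" where
  "locally_integrable a b f \<longleftrightarrow>
     (\<forall>c e. a < c \<and> e < b \<longrightarrow> set_integrable lebesgue {c..e} f)"

definition has_weak_deriv ::
    "real \<Rightarrow> real \<Rightarrow> nat \<Rightarrow> (real \<Rightarrow> real) \<Rightarrow> (real \<Rightarrow> real) \<Rightarrow> bool" where
  "has_weak_deriv a b k f g \<longleftrightarrow>
     locally_integrable a b f \<and> locally_integrable a b g \<and>
     (\<forall>\<phi>. test_fun a b \<phi> \<longrightarrow>
        (LINT x:{a..b}|lebesgue. f x * (deriv ^^ k) \<phi> x) =
        (-1) ^ k * (LINT x:{a..b}|lebesgue. g x * \<phi> x))"

text \<open>Elements are functions rather than classes modulo null sets; only the values on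
  \<open>{a..b}\<close> matter.\<close>

definition sobolev_space :: "nat \<Rightarrow> real \<Rightarrow> real \<Rightarrow> (real \<Rightarrow> real) set" where
  "sobolev_space r a b =
     {f \<in> L2_space a b. \<forall>k\<le>r. \<exists>g \<in> L2_space a b. has_weak_deriv a b k f g}"

text \<open>Weak derivatives are unique up to null sets, so the choice below does not affect
  the norm of a member of \<open>sobolev_space 1 a b\<close>.\<close>

definition weak_deriv :: "real \<Rightarrow> real \<Rightarrow> (real \<Rightarrow> real) \<Rightarrow> real \<Rightarrow> real" where
  "weak_deriv a b f = (SOME g. has_weak_deriv a b 1 f g)"

definition H1_norm :: "real \<Rightarrow> real \<Rightarrow> (real \<Rightarrow> real) \<Rightarrow> real" where
  "H1_norm a b f = sqrt ((L2_norm a b f)\<^sup>2 + (L2_norm a b (weak_deriv a b f))\<^sup>2)"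

text \<open>For \<open>d = 3\<close> the convention \<open>0 powr 0 = 0\<close> makes \<open>slicing_density 3 1 = 0\<close>; this
  affects a single point only and is invisible to the integral in \<open>slicing\<close>.\<close>

definition slicing_density :: "nat \<Rightarrow> real \<Rightarrow> real" where
  "slicing_density d t =
     2 * Gamma (real d / 2) / (sqrt pi * Gamma ((real d - 1) / 2)) *
     (1 - t\<^sup>2) powr ((real d - 3) / 2)"

definition slicing :: "nat \<Rightarrow> (real \<Rightarrow> real) \<Rightarrow> real \<Rightarrow> real" where
  "slicing d f s = (LINT t:{0..1}|lebesgue. f (t * s) * slicing_density d t)"

definition cos_system :: "nat \<Rightarrow> real \<Rightarrow> real" where
  "cos_system k t = (if k = 0 then 1 else sqrt 2 * cos (pi * real k * t))"

text \<open>A vector in \<open>\<real>\<^sup>K\<close> is a sequence vanishing from index \<open>K\<close> on, so that \<open>K\<close> can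
  vary inside a formula.\<close>

definition coeff_vectors :: "nat \<Rightarrow> (nat \<Rightarrow> real) set" where
  "coeff_vectors K = {a. \<forall>k\<ge>K. a k = 0}"

definition cos_sum :: "nat \<Rightarrow> (nat \<Rightarrow> real) \<Rightarrow> real \<Rightarrow> real" where
  "cos_sum K a t = (\<Sum>k<K. a k * cos_system k t)"

definition is_best_fit ::
    "((real \<Rightarrow> real) \<Rightarrow> real) \<Rightarrow> nat \<Rightarrow> (real \<Rightarrow> real) \<Rightarrow> nat \<Rightarrow> (nat \<Rightarrow> real) \<Rightarrow> bool" where
  "is_best_fit nrm d F K a \<longleftrightarrow>
     is_arg_min (\<lambda>b. (nrm (\<lambda>s. slicing d (cos_sum K b) s - F s))\<^sup>2)
       (\<lambda>b. b \<in> coeff_vectors K) a"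

end

theory Submission
  imports Defs "HOL-Computational_Algebra.Polynomial"
begin

text \<open>The best fit is at least as good as any explicit trial sum, so it suffices to find one good
  cosine sum. Extend \<open>f\<close> to the even function \<open>h(x) = f \<bar>x\<bar>\<close> and cut it off near the end points with a
  smooth even \<open>\<theta>\<close> that is \<open>1\<close> on \<open>[-1+\<epsilon>, 1-\<epsilon>]\<close> and whose \<open>j\<close>-th derivative is of order
  \<open>\<epsilon>\<close> to the power \<open>-j\<close>. As \<open>h \<theta>\<close> has compact support in \<open>(-1,1)\<close>, \<open>r\<close> integrations by parts produce
  no boundary terms, and the Bessel and Parseval relations bound the tail of its cosine series beyond \<open>K\<close>
  by \<open>(K \<epsilon>)\<close> to the power \<open>-r\<close> in \<open>L\<^sup>2\<close>, and that of the derivative by one power of \<open>K\<close> more. The removed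
  part \<open>h (1 - \<theta>)\<close> lives where the density of the slicing operator is of order \<open>\<epsilon>\<close> to the power
  \<open>(d-3)/2\<close>, so slicing maps it to size \<open>\<epsilon>\<close> to the power \<open>(d-1)/2\<close>, or \<open>(d-3)/2\<close> for the derivative.
  Balancing the two errors over \<open>\<epsilon>\<close> gives the rates.\<close>

section \<open>Smooth functions and cutoffs\<close>



text \<open>The 2-periodic extension of \<open>h\<close> generally has jumps in its odd derivatives
  at the odd integers, so for r \<ge> 2 integrating \<open>h\<close> itself r times against cosines
  would leave boundary terms at -1 and 1. The slicing operator forgives the damage done there: a
  function living on [1-eps,1] is met only by t in [1-eps,1], and the width of that range adds a
  factor eps to the smallness of the density. In H1 this factor is spent on the derivative of
  \<theta>, of size 1/eps. Equating eps^((d-1)/2) with (K eps)^(-r), and eps^((d-3)/2) with K^(1-r)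
  eps^(-r), fixes eps as a power of K. A second obstacle is measurability: the statement is about
  Lebesgue measurable functions and an arbitrarily chosen weak derivative, whereas dilations,
  product measures and Fubini want Borel functions. The analysis is therefore done with Borel
  representatives for \<open>lborel\<close> restricted to an interval, and uniqueness of weak
  derivatives carries the result back to \<open>H1_norm\<close>.\<close>

abbreviation borel_funs :: "(real \<Rightarrow> 'a::topological_space) set" where
  "borel_funs \<equiv> borel_measurable borel"

definition smooth :: "(real \<Rightarrow> real) \<Rightarrow> bool" where
  "smooth f \<longleftrightarrow> (\<forall>n x. (deriv ^^ n) f field_differentiable at x)"

text \<open>Smoothness by coinduction: exhibiting a family that contains \<open>f\<close> and, with
  each member, its derivative replaces any formula for the n-th derivative. Most smoothness proofs
  below differ only in the family.\<close>

lemma smooth_coinduct: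
  assumes "f \<in> A" and A: "\<And>f. f \<in> A \<Longrightarrow> \<exists>g\<in>A. \<forall>x. (f has_field_derivative g x) (at x)"
  shows "smooth f"
proof -
  have step: "f field_differentiable at x \<and> deriv f \<in> A" if f: "f \<in> A" for f x
  proof -
    obtain g where g: "g \<in> A" "\<forall>x. (f has_field_derivative g x) (at x)" using A[OF f] by blast
    then have "deriv f = g" by (auto intro!: DERIV_imp_deriv)
    then show ?thesis using g unfolding field_differentiable_def by blast
  qed
  have "(deriv ^^ n) f \<in> A" for n
    by (induction n) (use assms(1) step in auto)
  then show ?thesis unfolding smooth_def using step by blast
qed

lemma smooth_deriv: "smooth f \<Longrightarrow> smooth (deriv f)"
  unfolding smooth_def by (metis funpow_Suc_right comp_apply)

lemma smooth_funpow_deriv: "smooth f \<Longrightarrow> smooth ((deriv ^^ n) f)"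
  by (induction n) (auto intro: smooth_deriv)

lemma smooth_has_deriv: "smooth f \<Longrightarrow> (f has_field_derivative deriv f x) (at x)"
  unfolding smooth_def by (metis DERIV_deriv_iff_field_differentiable funpow_0)

lemma smooth_continuous_on: "smooth f \<Longrightarrow> continuous_on S f"
  by (meson DERIV_continuous_on has_field_derivative_at_within smooth_has_deriv)

lemma smooth_borel_measurable: "smooth f \<Longrightarrow> f \<in> borel_funs"
  by (intro borel_measurable_continuous_onI smooth_continuous_on)

lemma smoothI_deriv:
  assumes "smooth g" and "\<And>x. (f has_field_derivative g x) (at x)"
  shows "smooth f"
  by (rule smooth_coinduct[of f "insert f {g. smooth g}"])
     (use assms smooth_deriv smooth_has_deriv in blast)+

lemma smooth_const: "smooth (\<lambda>x. c)"
  by (rule smooth_coinduct[of _ "range (\<lambda>c x. c)"]) (auto intro!: exI[of _ "0::real"])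

lemma smooth_id: "smooth (\<lambda>x. x)"
  by (rule smoothI_deriv[OF smooth_const[of 1]]) (auto intro!: derivative_eq_intros)

text \<open>Products alone are not closed under differentiation, since the product rule yields a
  sum; finite sums of products of smooth functions are, which makes this a family fit for
  coinduction.\<close>

inductive_set product_span :: "(real \<Rightarrow> real) set" where
  product: "smooth f \<Longrightarrow> smooth g \<Longrightarrow> (\<lambda>x. f x * g x) \<in> product_span"
| sum: "f \<in> product_span \<Longrightarrow> g \<in> product_span \<Longrightarrow> (\<lambda>x. f x + g x) \<in> product_span"

lemma product_span_smooth:
  assumes "f \<in> product_span"
  shows "smooth f"
proof (rule smooth_coinduct[OF assms])
  fix f assume "f \<in> product_span"
  then show "\<exists>g\<in>product_span. \<forall>x. (f has_field_derivative g x) (at x)"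
  proof induction
    case (product f g)
    have "(\<lambda>x. f x * deriv g x + deriv f x * g x) \<in> product_span"
      by (intro product_span.intros product smooth_deriv)
    moreover have "((\<lambda>x. f x * g x) has_field_derivative f x * deriv g x + deriv f x * g x) (at x)" for x
      using DERIV_mult[OF smooth_has_deriv[OF product(1)] smooth_has_deriv[OF product(2)]]
      by (simp add: algebra_simps)
    ultimately show ?case by (metis (no_types, lifting))
  next
    case (sum f g)
    then obtain f' g' where "f' \<in> product_span" "\<forall>x. (f has_field_derivative f' x) (at x)"
      "g' \<in> product_span" "\<forall>x. (g has_field_derivative g' x) (at x)" by blast
    then show ?case
      by (intro bexI[of _ "\<lambda>x. f' x + g' x"]) (auto intro!: derivative_intros product_span.sum)
  qed
qed

lemma smooth_mult: "smooth f \<Longrightarrow> smooth g \<Longrightarrow> smooth (\<lambda>x. f x * g x)"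
  by (rule product_span_smooth[OF product_span.product])

lemma smooth_add: "smooth f \<Longrightarrow> smooth g \<Longrightarrow> smooth (\<lambda>x. f x + g x)"
  using product_span_smooth[OF product_span.sum[OF product_span.product[OF smooth_const[of 1], of f]
    product_span.product[OF smooth_const[of 1], of g]]] by simp

lemma smooth_cmult: "smooth f \<Longrightarrow> smooth (\<lambda>x. c * f x)"
  by (intro smooth_mult smooth_const)

lemma smooth_sum: "(\<And>i. i \<in> A \<Longrightarrow> smooth (f i)) \<Longrightarrow> smooth (\<lambda>x. \<Sum>i\<in>A. f i x)"
  by (induction A rule: infinite_finite_induct) (auto intro: smooth_const smooth_add)

lemma smooth_power: "smooth f \<Longrightarrow> smooth (\<lambda>x. f x ^ n)"
  by (induction n) (auto intro: smooth_const smooth_mult)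

lemma smooth_poly: "smooth (poly p)"
  unfolding poly_altdef by (intro smooth_sum smooth_cmult smooth_power smooth_id)

lemma has_deriv_affine:
  assumes "smooth f"
  shows "((\<lambda>x. f (a * x + b)) has_field_derivative a * deriv f (a * x + b)) (at x)"
proof -
  have "((\<lambda>x. a * x + b) has_field_derivative a) (at x)"
    by (auto intro!: derivative_eq_intros)
  then show ?thesis
    using DERIV_chain'[of "\<lambda>x. a * x + b" a x UNIV f, OF _ smooth_has_deriv[OF assms]]
    by (simp add: mult.commute)
qed

text \<open>The chain rule emits the factor a, so the coinductive family has to contain all constant
  multiples.\<close>

lemma smooth_affine: 
  assumes "smooth f" shows "smooth (\<lambda>x. f (a * x + b))"
proof (rule smooth_coinduct[of _ "{\<lambda>x. c * g (a * x + b) | c g. smooth g}"])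
  show "(\<lambda>x. f (a * x + b)) \<in> {\<lambda>x. c * g (a * x + b) | c g. smooth g}"
    using assms by (auto intro!: exI[of _ 1])
  fix h assume "h \<in> {\<lambda>x. c * g (a * x + b) | c g. smooth g}"
  then obtain c g where h: "h = (\<lambda>x. c * g (a * x + b))" "smooth g" by auto
  show "\<exists>g\<in>{\<lambda>x. c * g (a * x + b) | c g. smooth g}. \<forall>x. (h has_field_derivative g x) (at x)"
    unfolding h
    by (rule bexI[of _ "\<lambda>x. (c * a) * deriv g (a * x + b)"])
       (use h(2) in \<open>auto intro!: derivative_eq_intros has_deriv_affine intro: smooth_deriv\<close>)
qed

lemma funpow_deriv_affine:
  assumes "smooth f"
  shows "(deriv ^^ n) (\<lambda>x. f (a * x + b)) = (\<lambda>x. a ^ n * (deriv ^^ n) f (a * x + b))"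
proof (induction n)
  case (Suc n)
  show ?case
    unfolding funpow.simps comp_apply Suc
    by (intro ext DERIV_imp_deriv)
       (auto intro!: derivative_eq_intros has_deriv_affine smooth_funpow_deriv assms)
qed auto

lemma funpow_deriv_add:
  assumes "smooth f" "smooth g"
  shows "(deriv ^^ n) (\<lambda>x. f x + g x) = (\<lambda>x. (deriv ^^ n) f x + (deriv ^^ n) g x)"
proof (induction n)
  case (Suc n)
  show ?case
    unfolding funpow.simps comp_apply Suc
    by (intro ext DERIV_imp_deriv DERIV_add smooth_has_deriv smooth_funpow_deriv assms)
qed auto

text \<open>Writing the derivative as a cosine with phase advanced by pi/2 keeps a single family,
  with varying amplitude and phase, closed under differentiation.\<close>

lemma smooth_cos: "smooth (\<lambda>x. c * cos (a * x + b))"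
proof (rule smooth_coinduct[of _ "range (\<lambda>(c, b). \<lambda>x. c * cos (a * x + b))"])
  show "(\<lambda>x. c * cos (a * x + b)) \<in> range (\<lambda>(c, b). \<lambda>x. c * cos (a * x + b))"
    by (auto intro!: image_eqI[of _ _ "(c, b)"])
  fix f assume "f \<in> range (\<lambda>(c, b). \<lambda>x. c * cos (a * x + b))"
  then obtain c b where f: "f = (\<lambda>x. c * cos (a * x + b))" by auto
  have "(f has_field_derivative (c * a) * cos (a * x + (b + pi / 2))) (at x)" for x
    unfolding f using cos_add[of "a * x + b" "pi / 2"]
    by (auto intro!: derivative_eq_intros simp: add.assoc)
  moreover have "(\<lambda>x. (c * a) * cos (a * x + (b + pi / 2))) \<in> range (\<lambda>(c, b). \<lambda>x. c * cos (a * x + b))"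
    by (auto intro!: image_eqI[of _ _ "(c * a, b + pi / 2)"])
  ultimately show "\<exists>g\<in>range (\<lambda>(c, b). \<lambda>x. c * cos (a * x + b)). \<forall>x. (f has_field_derivative g x) (at x)"
    by (intro bexI[of _ "\<lambda>x. (c * a) * cos (a * x + (b + pi / 2))"] allI)
qed

lemma funpow_deriv_cos:
  "(deriv ^^ n) (\<lambda>x. cos (a * x + b)) = (\<lambda>x. a ^ n * cos (a * x + b + real n * (pi / 2)))"
proof (induction n)
  case (Suc n)
  have "((\<lambda>x. a ^ n * cos (a * x + b + real n * (pi / 2))) has_field_derivative
     a ^ Suc n * cos (a * x + b + real (Suc n) * (pi / 2))) (at x)" for x
  proof -
    have "cos (a * x + b + real (Suc n) * (pi / 2)) = - sin (a * x + b + real n * (pi / 2))"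
      using cos_add[of "a * x + b + real n * (pi / 2)" "pi / 2"] by (simp add: field_simps)
    then show ?thesis by (auto intro!: derivative_eq_intros)
  qed
  then show ?case
    unfolding funpow.simps comp_apply Suc by (intro ext DERIV_imp_deriv)
qed auto

section \<open>A smooth step built from exp(-1/x)\<close>

definition flat :: "real poly \<Rightarrow> real \<Rightarrow> real" where
  "flat p x = (if x > 0 then poly p (1 / x) * exp (- (1 / x)) else 0)"

lemma tendsto_poly_exp_0: "((\<lambda>x. poly p x * exp (- x)) \<longlongrightarrow> 0) (at_top :: real filter)"
proof -
  have "((\<lambda>x. \<Sum>i\<le>degree p. coeff p i * (x ^ i / exp x)) \<longlongrightarrow> (\<Sum>i\<le>degree p. coeff p i * 0)) (at_top :: real filter)"
    by (intro tendsto_sum tendsto_mult tendsto_const tendsto_power_div_exp_0)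
  then show ?thesis
    by (simp add: poly_altdef sum_distrib_right exp_minus divide_inverse mult.assoc)
qed

text \<open>For x > 0 the derivative of p(1/x) exp(-1/x) is (p - p')(1/x) exp(-1/x) / x^2, and
  \<open>[:0, 0, 1:]\<close> is the square of the variable 1/x. Carrying a whole polynomial as
  parameter keeps the family closed under differentiation; at 0 the exponential decay beats every
  polynomial.\<close>

lemma flat_has_deriv:
  "(flat p has_field_derivative flat ([:0, 0, 1:] * (p - pderiv p)) x) (at x)"
proof -
  consider "x < 0" | "x > 0" | "x = 0" by linarith
  then show ?thesis
  proof cases
    case 1
    have "((\<lambda>x. 0) has_field_derivative 0) (at x)" by simp
    moreover have "eventually (\<lambda>x. flat p x = 0) (nhds x)"
      using eventually_nhds_in_open[of "{..<0}" x] 1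
      by (auto simp: flat_def elim!: eventually_mono)
    ultimately have "(flat p has_field_derivative 0) (at x)"
      by (subst DERIV_cong_ev[OF refl _ refl, of _ "\<lambda>x. 0"]) auto
    then show ?thesis using 1 by (simp add: flat_def)
  next
    case 2
    have "((\<lambda>x. poly p (1 / x) * exp (- (1 / x))) has_field_derivative
      poly ([:0, 0, 1:] * (p - pderiv p)) (1 / x) * exp (- (1 / x))) (at x)"
      using 2 by (auto intro!: derivative_eq_intros DERIV_chain'[OF _ poly_DERIV]
         simp: field_simps power2_eq_square)
    moreover have "eventually (\<lambda>x. flat p x = poly p (1 / x) * exp (- (1 / x))) (nhds x)"
      using eventually_nhds_in_open[of "{0<..}" x] 2
      by (auto simp: flat_def elim!: eventually_mono)
    ultimately show ?thesis using 2
      by (subst DERIV_cong_ev[OF refl _ refl]) (auto simp: flat_def)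
  next
    case 3
    \<comment> \<open>Dividing by h at the origin multiplies p by its variable, whence
      \<open>pCons 0 p\<close>, and the same exponential limit applies.\<close>
    have "((\<lambda>x. poly (pCons 0 p) (inverse x) * exp (- (inverse x))) \<longlongrightarrow> 0) (at_right (0::real))"
      using filterlim_compose[OF tendsto_poly_exp_0 filterlim_inverse_at_top_right] .
    then have "((\<lambda>h. flat p h / h) \<longlongrightarrow> 0) (at_right 0)"
      by (rule Lim_transform_eventually)
         (auto simp: flat_def field_simps eventually_at_right_field intro!: exI[of _ 1])
    moreover have "((\<lambda>h. flat p h / h) \<longlongrightarrow> 0) (at_left 0)"
      by (rule tendsto_eventually) (auto simp: flat_def eventually_at_left_field intro!: exI[of _ "-1"])
    ultimately have "((\<lambda>h. flat p h / h) \<longlongrightarrow> 0) (at 0)"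
      by (simp add: filterlim_split_at)
    then show ?thesis unfolding 3 DERIV_def by (simp add: flat_def)
  qed
qed

lemma smooth_flat: "smooth (flat p)"
  by (rule smooth_coinduct[of _ "range flat"]) (use flat_has_deriv in blast)+

lemma flat_pos: "x > 0 \<Longrightarrow> flat 1 x > 0" and flat_nonpos: "x \<le> 0 \<Longrightarrow> flat p x = 0"
  and flat_nonneg: "flat 1 x \<ge> 0"
  by (auto simp: flat_def)

text \<open>The step is the normalised antiderivative of a bump supported in [0,1]. Its derivatives
  of positive order vanish outside [0,1], so they are bounded by compactness of that
  interval.\<close>

lemma ex_smooth_step:
  obtains \<eta> where "smooth \<eta>" "\<And>x. x \<le> 0 \<Longrightarrow> \<eta> x = 0" "\<And>x. x \<ge> 1 \<Longrightarrow> \<eta> x = 1"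
    "\<And>x. 0 \<le> \<eta> x \<and> \<eta> x \<le> 1" "\<And>j. \<exists>C. \<forall>x. \<bar>(deriv ^^ j) \<eta> x\<bar> \<le> C"
proof -
  define b where "b x = flat 1 x * flat 1 (1 - x)" for x
  have flat1: "smooth (\<lambda>x. flat 1 (1 - x))"
    using smooth_affine[OF smooth_flat, of 1 "-1" 1] by (simp add: algebra_simps)
  have b: "smooth b" unfolding b_def by (intro smooth_mult flat1 smooth_flat)
  have bnn: "b x \<ge> 0" for x by (simp add: b_def flat_nonneg)
  have b0: "b x = 0" if "x \<le> 0 \<or> x \<ge> 1" for x using that by (auto simp: b_def flat_nonpos)
  obtain B where B: "\<And>x. (B has_field_derivative b x) (at x)"
    using einterval_antiderivative[of "-\<infinity>" "\<infinity>" b] DERIV_isCont[OF smooth_has_deriv[OF b]]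
    by (auto simp: has_real_derivative_iff_has_vector_derivative)
  have mono: "B x \<le> B y" if "x \<le> y" for x y
    using DERIV_nonneg_imp_nondecreasing[OF that] B bnn by blast
  have strict: "B 0 < B 1"
  proof -
    obtain z where z: "0 < z" "z < 1" "B 1 - B 0 = (1 - 0) * b z"
      using MVT2[of 0 1 B b] B by auto
    then show ?thesis using mult_pos_pos[OF flat_pos[of z] flat_pos[of "1 - z"]] by (auto simp: b_def)
  qed
  have lo: "B x = B 0" if "x \<le> 0" for x
  proof (cases "x < 0")
    case True
    obtain z where "z < 0" "B 0 - B x = (0 - x) * b z" using MVT2[OF True, of B b] B by auto
    then show ?thesis using b0[of z] by simp
  qed (use that in auto)
  have hi: "B x = B 1" if "x \<ge> 1" for x
  proof (cases "x > 1")
    case True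
    obtain z where "z > 1" "B x - B 1 = (x - 1) * b z" using MVT2[OF True, of B b] B by auto
    then show ?thesis using b0[of z] by simp
  qed (use that in auto)
  define \<eta> where "\<eta> x = (1 / (B 1 - B 0)) * (B x - B 0)" for x
  have eta: "smooth \<eta>"
    by (rule smoothI_deriv[OF smooth_cmult[OF b, of "1 / (B 1 - B 0)"]])
       (use strict in \<open>auto simp: \<eta>_def[abs_def] intro!: derivative_eq_intros B\<close>)
  have r: "0 \<le> \<eta> x \<and> \<eta> x \<le> 1" for x
  proof -
    have "B 0 \<le> B x" using lo[of x] mono[of 0 x] by (cases "x \<le> 0") auto
    moreover have "B x \<le> B 1" using hi[of x] mono[of x 1] by (cases "x \<ge> 1") auto
    ultimately show ?thesis using strict by (auto simp: \<eta>_def)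
  qed
  have bd: "\<exists>C. \<forall>x. \<bar>(deriv ^^ j) \<eta> x\<bar> \<le> C" for j
  proof (cases j)
    case 0
    then show ?thesis using r by (auto intro!: exI[of _ 1])
  next
    case (Suc i)
    have out: "(deriv ^^ Suc i) \<eta> x = 0" if "x < 0 \<or> x > 1" for i x
      using that
    proof (induction i arbitrary: x)
      case 0
      have "deriv \<eta> x = (1 / (B 1 - B 0)) * b x" for x
        by (intro DERIV_imp_deriv) (use strict in \<open>auto simp: \<eta>_def[abs_def] intro!: derivative_eq_intros B\<close>)
      then show ?case using b0 0 by auto
    next
      case (Suc i)
      have "((\<lambda>x. 0) has_field_derivative 0) (at x)" by simp
      moreover have "eventually (\<lambda>x. (deriv ^^ Suc i) \<eta> x = 0) (nhds x)"
        by (rule eventually_mono[OF eventually_nhds_in_open[of "{..<0} \<union> {1<..}" x]])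
           (use Suc in \<open>auto simp del: funpow.simps\<close>)
      ultimately have "((deriv ^^ Suc i) \<eta> has_field_derivative 0) (at x)"
        by (subst DERIV_cong_ev[OF refl _ refl, of _ "\<lambda>x. 0"]) auto
      then have "deriv ((deriv ^^ Suc i) \<eta>) x = 0" by (rule DERIV_imp_deriv)
      then show ?case by simp
    qed
    have "bounded ((deriv ^^ Suc i) \<eta> ` {0..1})"
      by (intro compact_imp_bounded compact_continuous_image smooth_continuous_on smooth_funpow_deriv eta) auto
    then obtain C where C: "\<forall>x\<in>{0..1}. \<bar>(deriv ^^ Suc i) \<eta> x\<bar> \<le> C"
      unfolding bounded_iff by auto
    have "\<bar>(deriv ^^ Suc i) \<eta> x\<bar> \<le> max C 0" for x
      using C out[of x i] by (cases "x \<in> {0..1}") (force simp del: funpow.simps)+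
    then show ?thesis using Suc by blast
  qed
  show ?thesis
  proof (rule that[OF eta _ _ r bd])
    show "\<eta> x = 0" if "x \<le> 0" for x using lo[OF that] by (simp add: \<eta>_def)
    show "\<eta> x = 1" if "x \<ge> 1" for x using hi[OF that] strict by (simp add: \<eta>_def)
  qed
qed


section \<open>Test functions and cutoffs at scale eps\<close>

lemma test_fun_iff:
  assumes "a < b"
  shows "test_fun a b \<phi> \<longleftrightarrow>
    smooth \<phi> \<and> (\<exists>c e. a < c \<and> c \<le> e \<and> e < b \<and> (\<forall>x. x \<notin> {c..e} \<longrightarrow> \<phi> x = 0))" (is "?l \<longleftrightarrow> _ \<and> ?r")
proof -
  define S where "S = closure {x. \<phi> x \<noteq> 0}"
  have "S \<subseteq> {a<..<b} \<longleftrightarrow> ?r"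
  proof
    assume S: "S \<subseteq> {a<..<b}"
    show ?r
    proof (cases "S = {}")
      case True
      then show ?thesis unfolding S_def using assms
        by (intro exI[of _ "(a + b) / 2"]) auto
    next
      case False
      \<comment> \<open>A closed set inside the bounded open interval is compact, so its extreme
        points exist and lie strictly between a and b.\<close>
      have "compact S"
        using bounded_subset[OF bounded_closed_interval[of a b], of S] S unfolding S_def
        by (force simp: compact_eq_bounded_closed)
      then obtain c e where ce: "c \<in> S" "e \<in> S" "\<And>x. x \<in> S \<Longrightarrow> c \<le> x \<and> x \<le> e"
        using compact_attains_inf[of S] compact_attains_sup[of S] False by blast
      have "\<phi> x = 0" if "x \<notin> {c..e}" for x
        using that ce(3)[of x] closure_subset[of "{x. \<phi> x \<noteq> 0}"] unfolding S_def by auto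
      then show ?thesis using ce S by (intro exI[of _ c] exI[of _ e]) auto
    qed
  next
    assume ?r
    then obtain c e where ce: "a < c" "e < b" "\<forall>x. x \<notin> {c..e} \<longrightarrow> \<phi> x = 0" by blast
    then have "S \<subseteq> {c..e}" unfolding S_def by (intro closure_minimal) auto
    then show "S \<subseteq> {a<..<b}" using ce by force
  qed
  then show ?thesis unfolding test_fun_def smooth_def S_def by auto
qed

lemma test_fun_smooth: "test_fun a b \<phi> \<Longrightarrow> smooth \<phi>"
  unfolding test_fun_def smooth_def by auto

lemma test_fun_outside: "test_fun a b \<phi> \<Longrightarrow> x \<notin> {a<..<b} \<Longrightarrow> \<phi> x = 0"
  unfolding test_fun_def using closure_subset[of "{x. \<phi> x \<noteq> 0}"] by blast

lemma test_fun_mult: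
  assumes "test_fun a b \<phi>" "smooth \<psi>" "a < b"
  shows "test_fun a b (\<lambda>x. \<phi> x * \<psi> x)"
  using assms smooth_mult[of \<phi> \<psi>] unfolding test_fun_iff[OF assms(3)] by auto

lemma deriv_zero_outside:
  fixes \<phi> :: "real \<Rightarrow> real"
  assumes "\<And>x. x \<notin> {c..e} \<Longrightarrow> \<phi> x = k" "x \<notin> {c..e}"
  shows "deriv \<phi> x = 0"
proof -
  have "((\<lambda>x. k) has_field_derivative 0) (at x)" by simp
  moreover have "eventually (\<lambda>x. \<phi> x = k) (nhds x)"
    by (rule eventually_mono[OF eventually_nhds_in_open[OF open_Compl[OF closed_atLeastAtMost[of c e]]]])
       (use assms in auto)
  ultimately have "(\<phi> has_field_derivative 0) (at x)"
    by (subst DERIV_cong_ev[OF refl _ refl, of _ "\<lambda>x. k"]) auto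
  then show ?thesis by (rule DERIV_imp_deriv)
qed

lemma test_fun_deriv:
  assumes "test_fun a b \<phi>" "a < b"
  shows "test_fun a b (deriv \<phi>)"
proof -
  obtain c e where *: "a < c" "c \<le> e" "e < b" "\<And>x. x \<notin> {c..e} \<Longrightarrow> \<phi> x = 0" and s: "smooth \<phi>"
    using assms unfolding test_fun_iff[OF assms(2)] by blast
  have "deriv \<phi> x = 0" if "x \<notin> {c..e}" for x
    using deriv_zero_outside[OF *(4) that] .
  then show ?thesis unfolding test_fun_iff[OF assms(2)] using * smooth_deriv[OF s] by blast
qed

text \<open>Used to differentiate a sliced function: the derivative of u(t s) in s is tested with y
  \<mapsto> \<phi>(y/t). For t \<le> 1 the support only moves towards 0.\<close>

lemma test_fun_scale:
  assumes "test_fun 0 1 \<phi>" "0 < t" "t \<le> 1"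
  shows "test_fun 0 1 (\<lambda>y. \<phi> (y / t))"
proof -
  obtain c e where *: "0 < c" "c \<le> e" "e < 1" "\<And>x. x \<notin> {c..e} \<Longrightarrow> \<phi> x = 0" and s: "smooth \<phi>"
    using assms(1) by (subst (asm) test_fun_iff) auto
  have "smooth (\<lambda>y. \<phi> (y / t))" using smooth_affine[OF s, of "1 / t" 0] by simp
  moreover have "0 < t * c" "t * c \<le> t * e" "t * e < 1"
    using * assms mult_le_one[of t e] by (auto simp: mult_less_cancel_right1 intro: le_less_trans[OF mult_right_mono[of t 1 e]])
  moreover have "\<phi> (y / t) = 0" if "y \<notin> {t * c..t * e}" for y
    using that assms(2) by (intro *(4)) (auto simp: field_simps)
  ultimately show ?thesis by (subst test_fun_iff) auto
qed

lemma test_fun_reflect: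
  assumes "test_fun (-1) 1 \<phi>" shows "test_fun (-1) 1 (\<lambda>x. \<phi> (- x))"
proof -
  obtain c e where *: "-1 < c" "c \<le> e" "e < 1" "\<And>x. x \<notin> {c..e} \<Longrightarrow> \<phi> x = 0" and s: "smooth \<phi>"
    using assms(1) by (subst (asm) test_fun_iff) auto
  have "smooth (\<lambda>y. \<phi> (- y))" using smooth_affine[OF s, of "-1" 0] by simp
  moreover have "\<phi> (- y) = 0" if "y \<notin> {- e.. - c}" for y
    using that by (intro *(4)) (auto simp: field_simps)
  ultimately show ?thesis using *(1-3)
    by (subst test_fun_iff) (simp, intro conjI exI[of _ "-e"] exI[of _ "-c"] allI impI, auto)
qed

lemma test_fun_widen: "test_fun a b \<phi> \<Longrightarrow> a' \<le> a \<Longrightarrow> b \<le> b' \<Longrightarrow> test_fun a' b' \<phi>"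
  unfolding test_fun_def by force

lemma ex_cutoffs:
  obtains \<theta> :: "real \<Rightarrow> real \<Rightarrow> real" where
    "\<And>eps. 0 < eps \<Longrightarrow> eps \<le> 1 \<Longrightarrow> test_fun (-1) 1 (\<theta> eps)"
    "\<And>eps x. \<theta> eps (- x) = \<theta> eps x"
    "\<And>eps x. 0 < eps \<Longrightarrow> \<bar>x\<bar> \<le> 1 - eps \<Longrightarrow> \<theta> eps x = 1"
    "\<And>eps x. 0 < eps \<Longrightarrow> eps \<le> 1 \<Longrightarrow> 0 \<le> \<theta> eps x \<and> \<theta> eps x \<le> 1"
    "\<And>j. \<exists>C. \<forall>eps x. 0 < eps \<longrightarrow> eps \<le> 1 \<longrightarrow> \<bar>(deriv ^^ j) (\<theta> eps) x\<bar> \<le> C * (1 / eps) ^ j"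
proof -
  obtain \<eta> where eta: "smooth \<eta>" "\<And>x. x \<le> 0 \<Longrightarrow> \<eta> x = 0" "\<And>x. x \<ge> 1 \<Longrightarrow> \<eta> x = 1"
    "\<And>x. 0 \<le> \<eta> x \<and> \<eta> x \<le> 1" "\<And>j. \<exists>C. \<forall>x. \<bar>(deriv ^^ j) \<eta> x\<bar> \<le> C"
    using ex_smooth_step by blast
  \<comment> \<open>For b = 2/eps the argument equals (2/eps)(1 + x) - 1, which runs from 0 to 1
    while the distance 1 + x runs from eps/2 to eps; b = -2/eps is the mirror image at 1. Vanishing
    already at distance eps/2 leaves room for compact support in the open interval.\<close>
  define E where "E eps b x = \<eta> (b * x + (2 / eps - 1))" for eps b x :: real
  \<comment> \<open>On each half line one of the two steps is already 1, so the sum minus 1 is the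
    other step, which keeps the values in [0,1].\<close>
  define \<theta> where "\<theta> eps x = (E eps (- (2 / eps)) x + E eps (2 / eps) x) + (-1)" for eps x :: real
  have E_smooth: "smooth (E eps b)" for eps b
    unfolding E_def by (rule smooth_affine[OF eta(1)])
  have smooth: "smooth (\<theta> eps)" for eps
    unfolding \<theta>_def by (intro smooth_add E_smooth smooth_const)
  have E1: "E eps (2 / eps) x = 1" if "0 < eps" "eps \<le> 1" "x \<ge> 0" for eps x
    unfolding E_def using that mult_nonneg_nonneg[of "2 / eps" x]
    by (intro eta(3)) (auto simp: divide_simps)
  have E2: "E eps (- (2 / eps)) x = 1" if "0 < eps" "eps \<le> 1" "x \<le> 0" for eps x
    unfolding E_def using that mult_nonneg_nonneg[of "2 / eps" "- x"]
    by (intro eta(3)) (auto simp: divide_simps)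
  have range: "0 \<le> \<theta> eps x \<and> \<theta> eps x \<le> 1" if "0 < eps" "eps \<le> 1" for eps x
    using E1[OF that, of x] E2[OF that, of x] eta(4) by (cases "x \<ge> 0") (auto simp: \<theta>_def E_def)
  have sup: "\<theta> eps x = 0" if "0 < eps" "eps \<le> 1" "x \<notin> {-(1 - eps / 2)..1 - eps / 2}" for eps x
  proof (cases "x \<ge> 0")
    case True
    have "2 / eps * (1 - x) \<le> 1" using that True by (simp add: divide_simps)
    then have "- (2 / eps) * x + (2 / eps - 1) \<le> 0" by (simp only: ring_distribs)
    then have "E eps (- (2 / eps)) x = 0" unfolding E_def by (rule eta(2))
    then show ?thesis using E1[OF that(1,2) True] by (simp add: \<theta>_def)
  next
    case False
    have "2 / eps * (1 + x) \<le> 1" using that False by (simp add: divide_simps)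
    then have "2 / eps * x + (2 / eps - 1) \<le> 0" by (simp only: ring_distribs)
    then have "E eps (2 / eps) x = 0" unfolding E_def by (rule eta(2))
    then show ?thesis using E2[OF that(1,2)] False by (simp add: \<theta>_def)
  qed
  show ?thesis
  proof
    show "test_fun (-1) 1 (\<theta> eps)" if "0 < eps" "eps \<le> 1" for eps
      using that by (subst test_fun_iff)
        (simp, intro conjI smooth exI[of _ "-(1 - eps / 2)"] exI[of _ "1 - eps / 2"] allI impI sup, auto)
    show "\<theta> eps (- x) = \<theta> eps x" for eps x by (simp add: \<theta>_def E_def)
    show "\<theta> eps x = 1" if "0 < eps" "\<bar>x\<bar> \<le> 1 - eps" for eps x
    proof -
      have "2 / eps * (1 - x) \<ge> 2" "2 / eps * (1 + x) \<ge> 2" using that by (auto simp: divide_simps)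
      then have "2 / eps * x + (2 / eps - 1) \<ge> 1" "- (2 / eps) * x + (2 / eps - 1) \<ge> 1"
        by (simp_all add: right_diff_distrib distrib_left)
      then have "E eps (2 / eps) x = 1" "E eps (- (2 / eps)) x = 1"
        unfolding E_def by (auto intro: eta(3))
      then show ?thesis by (simp add: \<theta>_def)
    qed
    show "0 \<le> \<theta> eps x \<and> \<theta> eps x \<le> 1" if "0 < eps" "eps \<le> 1" for eps x using range[OF that] .
    show "\<exists>C. \<forall>eps x. 0 < eps \<longrightarrow> eps \<le> 1 \<longrightarrow> \<bar>(deriv ^^ j) (\<theta> eps) x\<bar> \<le> C * (1 / eps) ^ j" for j
    proof (cases j)
      case 0
      then show ?thesis using range by (intro exI[of _ 1]) (auto simp: abs_le_iff intro: order_trans[of _ 0])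
    next
      case (Suc i)
      obtain C where C: "\<And>x. \<bar>(deriv ^^ j) \<eta> x\<bar> \<le> C" using eta(5) by blast
      have E: "\<bar>(deriv ^^ j) (E eps b) x\<bar> \<le> C * (2 / eps) ^ j" if "\<bar>b\<bar> = 2 / eps" for eps b x
      proof -
        have "\<bar>(deriv ^^ j) (E eps b) x\<bar> = \<bar>b\<bar> ^ j * \<bar>(deriv ^^ j) \<eta> (b * x + (2 / eps - 1))\<bar>"
          unfolding E_def funpow_deriv_affine[OF eta(1)] by (simp add: abs_mult power_abs)
        also have "\<dots> \<le> \<bar>b\<bar> ^ j * C" by (intro mult_left_mono C) auto
        finally show ?thesis using that by (simp add: mult.commute)
      qed
      have c: "(deriv ^^ j) (\<lambda>x. -1 :: real) = (\<lambda>x. 0)"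
        unfolding Suc
      proof (induction i)
        case 0
        show ?case by (simp add: fun_eq_iff)
      next
        case (Suc i)
        have "(deriv ^^ Suc (Suc i)) (\<lambda>x. -1 :: real) = deriv ((deriv ^^ Suc i) (\<lambda>x. -1))" by simp
        also have "\<dots> = (\<lambda>x. 0)" unfolding Suc by (simp add: fun_eq_iff)
        finally show ?case .
      qed
      have "\<bar>(deriv ^^ j) (\<theta> eps) x\<bar> \<le> (2 * C * 2 ^ j) * (1 / eps) ^ j" if "0 < eps" for eps x
      proof -
        have "(deriv ^^ j) (\<theta> eps) x = (deriv ^^ j) (E eps (- (2 / eps))) x + (deriv ^^ j) (E eps (2 / eps)) x"
          unfolding \<theta>_def
          by (subst funpow_deriv_add[OF smooth_add[OF E_smooth E_smooth] smooth_const],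
              subst funpow_deriv_add[OF E_smooth E_smooth], subst c) simp
        then have "\<bar>(deriv ^^ j) (\<theta> eps) x\<bar> \<le> C * (2 / eps) ^ j + C * (2 / eps) ^ j"
          using E[of "- (2 / eps)" eps x] E[of "2 / eps" eps x] that by auto
        then show ?thesis by (simp add: power_divide)
      qed
      then show ?thesis by blast
    qed
  qed
qed


section \<open>Square-integrable functions and orthonormal systems\<close>

definition sq_integrable :: "'a measure \<Rightarrow> ('a \<Rightarrow> real) \<Rightarrow> bool" where
  "sq_integrable M u \<longleftrightarrow> u \<in> borel_measurable M \<and> integrable M (\<lambda>x. (u x)^2)"

abbreviation sqnorm :: "'a measure \<Rightarrow> ('a \<Rightarrow> real) \<Rightarrow> real" where
  "sqnorm M u \<equiv> \<integral>x. (u x)^2 \<partial>M"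

lemma sq_integrableD:
  assumes "sq_integrable M u"
  shows "u \<in> borel_measurable M" "integrable M (\<lambda>x. (u x)^2)"
  using assms unfolding sq_integrable_def by auto

lemma sq_integrable_mult_integrable:
  assumes u: "sq_integrable M u" and v: "sq_integrable M v"
  shows "integrable M (\<lambda>x. u x * v x)"
proof (rule Bochner_Integration.integrable_bound)
  show "integrable M (\<lambda>x. (u x)^2 + (v x)^2)"
    using sq_integrableD[OF u] sq_integrableD[OF v] by auto
  show "(\<lambda>x. u x * v x) \<in> borel_measurable M"
    using sq_integrableD(1)[OF u] sq_integrableD(1)[OF v] by measurable
  have "norm (u x * v x) \<le> norm ((u x)^2 + (v x)^2)" for x
  proof -
    have "0 \<le> \<bar>u x\<bar> * \<bar>v x\<bar>" by simp
    moreover have "2 * (\<bar>u x\<bar> * \<bar>v x\<bar>) \<le> (u x)^2 + (v x)^2"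
      using sum_squares_bound[of "\<bar>u x\<bar>" "\<bar>v x\<bar>"] by simp
    ultimately have "\<bar>u x * v x\<bar> \<le> (u x)^2 + (v x)^2" unfolding abs_mult by linarith
    then show ?thesis by simp
  qed
  then show "AE x in M. norm (u x * v x) \<le> norm ((u x)^2 + (v x)^2)" by auto
qed

lemma sq_integrable_add:
  assumes u: "sq_integrable M u" and v: "sq_integrable M v"
  shows "sq_integrable M (\<lambda>x. u x + v x)"
  using sq_integrableD[OF u] sq_integrableD[OF v] sq_integrable_mult_integrable[OF u v]
  unfolding sq_integrable_def by (auto simp: power2_sum mult.assoc)

lemma sq_integrable_bounded_mult:
  assumes u: "sq_integrable M u" and w: "w \<in> borel_measurable M" "\<And>x. x \<in> space M \<Longrightarrow> \<bar>w x\<bar> \<le> c"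
  shows "sq_integrable M (\<lambda>x. w x * u x)"
  unfolding sq_integrable_def
proof
  show m: "(\<lambda>x. w x * u x) \<in> borel_measurable M" using sq_integrableD(1)[OF u] w(1) by measurable
  show "integrable M (\<lambda>x. (w x * u x)^2)"
  proof (rule Bochner_Integration.integrable_bound)
    show "integrable M (\<lambda>x. c^2 * (u x)^2)" using sq_integrableD[OF u] by auto
    show "(\<lambda>x. (w x * u x)^2) \<in> borel_measurable M" using m by measurable
    have "norm ((w x * u x)^2) \<le> norm (c^2 * (u x)^2)" if "x \<in> space M" for x
      using power_mono[OF w(2)[OF that], of 2] by (auto simp: power_mult_distrib intro!: mult_right_mono)
    then show "AE x in M. norm ((w x * u x)^2) \<le> norm (c^2 * (u x)^2)" by auto
  qed
qed

lemma sq_integrable_cmult: "sq_integrable M u \<Longrightarrow> sq_integrable M (\<lambda>x. c * u x)"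
  by (rule sq_integrable_bounded_mult[of M u "\<lambda>x. c" "\<bar>c\<bar>"]) auto

lemma sq_integrable_diff:
  "sq_integrable M u \<Longrightarrow> sq_integrable M v \<Longrightarrow> sq_integrable M (\<lambda>x. u x - v x)"
  using sq_integrable_add[OF _ sq_integrable_cmult[of M v "-1"], of u] by simp

lemma sq_integrable_zero: "sq_integrable M (\<lambda>x. 0)"
  unfolding sq_integrable_def by auto

lemma sq_integrable_sum:
  "(\<And>i. i \<in> S \<Longrightarrow> sq_integrable M (f i)) \<Longrightarrow> sq_integrable M (\<lambda>x. \<Sum>i\<in>S. f i x)"
  by (induction S rule: infinite_finite_induct) (auto intro: sq_integrable_zero sq_integrable_add)

lemma integral_square_add_le:
  assumes u: "sq_integrable M u" and v: "sq_integrable M v"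
  shows "(\<integral>x. (u x + v x)^2 \<partial>M) \<le> 2 * sqnorm M u + 2 * sqnorm M v"
proof -
  have "(u x + v x)^2 \<le> 2 * (u x)^2 + 2 * (v x)^2" for x
    using sum_squares_bound[of "u x" "v x"] by (simp add: power2_sum)
  then have "(\<integral>x. (u x + v x)^2 \<partial>M) \<le> (\<integral>x. 2 * (u x)^2 + 2 * (v x)^2 \<partial>M)"
    using sq_integrableD[OF u] sq_integrableD[OF v] sq_integrableD[OF sq_integrable_add[OF u v]]
    by (intro integral_mono) auto
  also have "\<dots> = 2 * sqnorm M u + 2 * sqnorm M v"
    using sq_integrableD[OF u] sq_integrableD[OF v] by simp
  finally show ?thesis .
qed

text \<open>Completing the square in the coefficients. Taking \<open>a\<close> to be the Fourier
  coefficients yields Bessel's inequality; for other \<open>a\<close> the last sum is the price of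
  deviating from them.\<close>

lemma orthonormal_expansion:
  assumes "finite S" and u: "sq_integrable M u" and e: "\<And>k. k \<in> S \<Longrightarrow> sq_integrable M (e k)"
    and on: "\<And>j k. j \<in> S \<Longrightarrow> k \<in> S \<Longrightarrow> (\<integral>x. e j x * e k x \<partial>M) = (if j = k then 1 else 0)"
  shows "(\<integral>x. (u x - (\<Sum>k\<in>S. a k * e k x))^2 \<partial>M) =
    sqnorm M u - (\<Sum>k\<in>S. (\<integral>x. u x * e k x \<partial>M)^2) + (\<Sum>k\<in>S. (a k - (\<integral>x. u x * e k x \<partial>M))^2)"
proof -
  define p where "p x = (\<Sum>k\<in>S. a k * e k x)" for x
  have p: "sq_integrable M p"
    unfolding p_def using e by (intro sq_integrable_sum sq_integrable_cmult)
  have up: "(\<integral>x. u x * p x \<partial>M) = (\<Sum>k\<in>S. a k * (\<integral>x. u x * e k x \<partial>M))"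
  proof -
    have "(\<integral>x. u x * p x \<partial>M) = (\<integral>x. (\<Sum>k\<in>S. a k * (u x * e k x)) \<partial>M)"
      by (simp add: p_def sum_distrib_left mult_ac)
    also have "\<dots> = (\<Sum>k\<in>S. \<integral>x. a k * (u x * e k x) \<partial>M)"
      using e u by (intro Bochner_Integration.integral_sum) (auto intro: sq_integrable_mult_integrable)
    finally show ?thesis by simp
  qed
  have pe: "(\<integral>x. e k x * p x \<partial>M) = a k" if "k \<in> S" for k
  proof -
    have "(\<integral>x. e k x * p x \<partial>M) = (\<integral>x. (\<Sum>j\<in>S. a j * (e k x * e j x)) \<partial>M)"
      by (simp add: p_def sum_distrib_left mult_ac)
    also have "\<dots> = (\<Sum>j\<in>S. \<integral>x. a j * (e k x * e j x) \<partial>M)"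
      using e that by (intro Bochner_Integration.integral_sum) (auto intro: sq_integrable_mult_integrable)
    also have "\<dots> = (\<Sum>j\<in>S. if k = j then a j else 0)"
      using on[OF that] by (intro sum.cong) auto
    finally show ?thesis using \<open>finite S\<close> that by simp
  qed
  have pp: "sqnorm M p = (\<Sum>k\<in>S. (a k)^2)"
  proof -
    have "sqnorm M p = (\<integral>x. (\<Sum>k\<in>S. a k * (e k x * p x)) \<partial>M)"
      by (simp add: power2_eq_square p_def sum_distrib_right mult_ac)
    also have "\<dots> = (\<Sum>k\<in>S. \<integral>x. a k * (e k x * p x) \<partial>M)"
      using e p by (intro Bochner_Integration.integral_sum) (auto intro: sq_integrable_mult_integrable)
    finally show ?thesis using pe by (simp add: power2_eq_square)
  qed
  have "(\<integral>x. (u x - p x)^2 \<partial>M) = (\<integral>x. (u x)^2 - 2 * (u x * p x) + (p x)^2 \<partial>M)"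
    by (simp add: power2_diff mult.assoc algebra_simps)
  also have "\<dots> = sqnorm M u - 2 * (\<integral>x. u x * p x \<partial>M) + sqnorm M p"
    using sq_integrableD(2)[OF u] sq_integrableD(2)[OF p] sq_integrable_mult_integrable[OF u p]
    by simp
  finally show ?thesis
    unfolding up pp unfolding p_def
    by (simp add: power2_diff sum.distrib sum_subtractf sum_distrib_left mult.assoc)
qed

lemma bessel:
  assumes "finite S" "sq_integrable M u" "\<And>k. k \<in> S \<Longrightarrow> sq_integrable M (e k)"
    "\<And>j k. j \<in> S \<Longrightarrow> k \<in> S \<Longrightarrow> (\<integral>x. e j x * e k x \<partial>M) = (if j = k then 1 else 0)"
  shows "(\<Sum>k\<in>S. (\<integral>x. u x * e k x \<partial>M)^2) \<le> sqnorm M u"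
proof -
  have "0 \<le> (\<integral>x. (u x - (\<Sum>k\<in>S. (\<integral>x. u x * e k x \<partial>M) * e k x))^2 \<partial>M)" by simp
  then show ?thesis
    using orthonormal_expansion[OF assms, of "\<lambda>k. \<integral>x. u x * e k x \<partial>M"] by simp
qed

text \<open>Parseval without infinite series. A good finite approximation over some S shows that the
  coefficients in S capture the energy of \<open>u\<close> up to \<delta>; those outside S0
  contribute at most B, and the partial sum over S0 misses exactly the energy not captured by
  S0.\<close>

lemma fourier_remainder_le:
  assumes u: "sq_integrable M u" and e: "\<And>k. k \<in> A \<Longrightarrow> sq_integrable M (e k)"
    and on: "\<And>j k. j \<in> A \<Longrightarrow> k \<in> A \<Longrightarrow> (\<integral>x. e j x * e k x \<partial>M) = (if j = k then 1 else 0)"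
    and total: "\<And>\<delta>. \<delta> > 0 \<Longrightarrow> \<exists>S a. finite S \<and> S \<subseteq> A \<and> (\<integral>x. (u x - (\<Sum>k\<in>S. a k * e k x))^2 \<partial>M) < \<delta>"
    and S0: "finite S0" "S0 \<subseteq> A"
    and tail: "\<And>T. finite T \<Longrightarrow> T \<subseteq> A - S0 \<Longrightarrow> (\<Sum>k\<in>T. (\<integral>x. u x * e k x \<partial>M)^2) \<le> B"
  shows "(\<integral>x. (u x - (\<Sum>k\<in>S0. (\<integral>x. u x * e k x \<partial>M) * e k x))^2 \<partial>M) \<le> B"
proof (rule field_le_epsilon)
  fix \<delta> :: real assume "\<delta> > 0"
  define c where "c k = (\<integral>x. u x * e k x \<partial>M)" for k
  obtain S a where S: "finite S" "S \<subseteq> A" "(\<integral>x. (u x - (\<Sum>k\<in>S. a k * e k x))^2 \<partial>M) < \<delta>"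
    using total[OF \<open>\<delta> > 0\<close>] by blast
  have exp: "(\<integral>x. (u x - (\<Sum>k\<in>S. a k * e k x))^2 \<partial>M) =
    sqnorm M u - (\<Sum>k\<in>S. (c k)^2) + (\<Sum>k\<in>S. (a k - c k)^2)" if "finite S" "S \<subseteq> A" for S a
    unfolding c_def using that e on by (intro orthonormal_expansion u) (blast dest: subsetD)+
  have "(\<Sum>k\<in>S. (c k)^2) \<le> (\<Sum>k\<in>S0 \<union> (S - S0). (c k)^2)"
    using S S0 by (intro sum_mono2) auto
  also have "\<dots> = (\<Sum>k\<in>S0. (c k)^2) + (\<Sum>k\<in>S - S0. (c k)^2)"
    using S S0 by (intro sum.union_disjoint) auto
  also have "(\<Sum>k\<in>S - S0. (c k)^2) \<le> B"
    unfolding c_def using S by (intro tail) auto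
  finally have "sqnorm M u - (\<Sum>k\<in>S0. (c k)^2) \<le> \<delta> + B"
    using S(3) exp[OF S(1,2), of a] sum_nonneg[of S "\<lambda>k. (a k - c k)^2"] by simp
  then show "(\<integral>x. (u x - (\<Sum>k\<in>S0. (\<integral>x. u x * e k x \<partial>M) * e k x))^2 \<partial>M) \<le> B + \<delta>"
    using exp[OF S0, of c] by (simp add: c_def)
qed

section \<open>Lebesgue measure on an interval and density of continuous functions\<close>

abbreviation leb_on :: "real \<Rightarrow> real \<Rightarrow> real measure" where
  "leb_on a b \<equiv> restrict_space lborel {a..b}"
abbreviation "L01 \<equiv> leb_on 0 1"
abbreviation "L11 \<equiv> leb_on (-1) 1"

lemma leb_on_finite_measure: "finite_measure (leb_on a b)"
  by (intro finite_measureI)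
     (auto simp: emeasure_restrict_space space_restrict_space emeasure_lborel_Icc_eq)

lemma measurable_leb_on: "f \<in> borel_funs \<Longrightarrow> f \<in> borel_measurable (leb_on a b)"
  by (intro measurable_restrict_space1) auto

lemma space_leb_on: "space (leb_on a b) = {a..b}"
  by (simp add: space_restrict_space)

lemma integrable_leb_on: "integrable (leb_on a b) f \<longleftrightarrow> set_integrable lborel {a..b} f"
  for f :: "real \<Rightarrow> real"
  unfolding set_integrable_def by (rule integrable_restrict_space) auto

lemma integral_leb_on: "integral\<^sup>L (leb_on a b) f = (LINT x:{a..b}|lborel. f x)"
  for f :: "real \<Rightarrow> real"
  unfolding set_lebesgue_integral_def by (rule integral_restrict_space) auto

lemma continuous_integrable_leb_on:
  "continuous_on {a..b} f \<Longrightarrow> integrable (leb_on a b) f" for f :: "real \<Rightarrow> real"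
  unfolding integrable_leb_on by (rule borel_integrable_atLeastAtMost')

lemma continuous_sq_integrable:
  fixes f :: "real \<Rightarrow> real"
  assumes "continuous_on {a..b} f" shows "sq_integrable (leb_on a b) f"
proof -
  have "integrable (leb_on a b) (\<lambda>x. (f x)^2)"
    using assms by (intro continuous_integrable_leb_on continuous_intros)
  then show ?thesis
    using borel_measurable_integrable[OF continuous_integrable_leb_on[OF assms]]
    unfolding sq_integrable_def by simp
qed

lemma integral_FTC_leb_on:
  fixes f :: "real \<Rightarrow> real"
  assumes "a \<le> b" "\<And>x. (F has_field_derivative f x) (at x)" "continuous_on {a..b} f"
  shows "integral\<^sup>L (leb_on a b) f = F b - F a"
  unfolding integral_leb_on set_lebesgue_integral_def
  using assms
  by (intro integral_FTC_atLeastAtMost)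
     (auto simp: has_real_derivative_iff_has_vector_derivative intro: has_vector_derivative_at_within)

lemma AE_leb_on: "(AE x in leb_on a b. P x) \<longleftrightarrow> (AE x in lborel. x \<in> {a..b} \<longrightarrow> P x)"
  by (rule AE_restrict_space_iff) auto

text \<open>\<open>measurable_on\<close> unfolds to pointwise limits of continuous functions off a
  negligible set, and Lebesgue measurable functions satisfy it.\<close>

lemma continuous_approx_AE:
  fixes u :: "real \<Rightarrow> real"
  assumes "u \<in> borel_funs"
  obtains g :: "nat \<Rightarrow> real \<Rightarrow> real" where "\<And>n. continuous_on UNIV (g n)"
    "AE x in lborel. (\<lambda>n. g n x) \<longlonglongrightarrow> u x"
proof -
  have "u measurable_on UNIV"
    using assms by (intro lebesgue_measurable_imp_measurable_on measurable_completion) auto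
  then obtain N g where g: "negligible N" "\<And>n. continuous_on UNIV (g n)"
    "\<And>x. x \<notin> N \<Longrightarrow> (\<lambda>n. g n x) \<longlonglongrightarrow> u x"
    unfolding measurable_on_def by auto
  have "AE x in lebesgue. x \<notin> N" using g(1) by (simp add: negligible_iff_null_sets AE_not_in)
  then have "AE x in lborel. x \<notin> N" by (simp add: AE_completion_iff)
  then have "AE x in lborel. (\<lambda>n. g n x) \<longlonglongrightarrow> u x" by (rule AE_mp) (auto intro: g)
  then show ?thesis using that g(2) by blast
qed

text \<open>Truncation to [-c,c]. It preserves continuity and supplies a constant majorant, so that
  convergence almost everywhere turns into convergence of integrals.\<close>

definition clip :: "real \<Rightarrow> real \<Rightarrow> real" where "clip c x = max (- c) (min c x)"

lemma clip_bound: "c \<ge> 0 \<Longrightarrow> \<bar>clip c x\<bar> \<le> c" and clip_diff: "c \<ge> 0 \<Longrightarrow> \<bar>x - clip c x\<bar> \<le> \<bar>x\<bar>"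
  and clip_eq: "\<bar>x\<bar> \<le> c \<Longrightarrow> clip c x = x"
  by (auto simp: clip_def)

lemma clip_continuous: "continuous_on S g \<Longrightarrow> continuous_on S (\<lambda>x. clip c (g x))"
  unfolding clip_def by (intro continuous_intros)

lemma clip_measurable [measurable]: "clip c \<in> borel_funs"
  unfolding clip_def by measurable

text \<open>Two dominated convergences: the truncations of \<open>u\<close> tend to \<open>u\<close>
  with the square of \<open>u\<close> as majorant, and on the finite measure space truncated
  continuous functions tend to a truncation of \<open>u\<close>. Each error is below \<delta>/4,
  since the square of a sum costs a factor 2.\<close>

lemma L2_dense_continuous:
  assumes u: "sq_integrable (leb_on a b) u" "u \<in> borel_funs" and "\<delta> > 0"
  shows "\<exists>g. continuous_on UNIV g \<and> (\<integral>x. (u x - g x)^2 \<partial>leb_on a b) < \<delta>"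
proof -
  interpret finite_measure "leb_on a b" by (rule leb_on_finite_measure)
  note [measurable] = u(2)
  have "(\<lambda>m. \<integral>x. (u x - clip (real m) (u x))^2 \<partial>leb_on a b) \<longlonglongrightarrow> (\<integral>x. 0 \<partial>leb_on a b)"
  proof (rule integral_dominated_convergence)
    show "integrable (leb_on a b) (\<lambda>x. (u x)^2)" using sq_integrableD[OF u(1)] by auto
    have "eventually (\<lambda>m. (u x - clip (real m) (u x))^2 = 0) sequentially" for x
      using eventually_ge_at_top[of "nat \<lceil>\<bar>u x\<bar>\<rceil>"] by eventually_elim (simp add: clip_eq nat_ceiling_le_eq)
    then show "AE x in leb_on a b. (\<lambda>m. (u x - clip (real m) (u x))^2) \<longlonglongrightarrow> 0"
      by (intro AE_I2 tendsto_eventually)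
    show "AE x in leb_on a b. norm ((u x - clip (real m) (u x))^2) \<le> (u x)^2" for m
      using clip_diff[of "real m"] by (auto simp: abs_le_square_iff)
  qed (simp_all add: measurable_leb_on)
  from LIMSEQ_D[OF this, of "\<delta> / 4"] obtain m :: nat
    where m: "(\<integral>x. (u x - clip (real m) (u x))^2 \<partial>leb_on a b) < \<delta> / 4"
    using \<open>\<delta> > 0\<close> by (auto simp: abs_less_iff)
  obtain g where g: "\<And>n. continuous_on UNIV (g n)" "AE x in lborel. (\<lambda>n. g n x) \<longlonglongrightarrow> u x"
    using continuous_approx_AE[OF u(2)] by metis
  have [measurable]: "g n \<in> borel_funs" for n
    by (intro borel_measurable_continuous_onI g)
  have gae: "AE x in leb_on a b. (\<lambda>n. g n x) \<longlonglongrightarrow> u x" unfolding AE_leb_on using g(2) by auto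
  have "(\<lambda>n. \<integral>x. (clip (real m) (u x) - clip (real m) (g n x))^2 \<partial>leb_on a b) \<longlonglongrightarrow> (\<integral>x. 0 \<partial>leb_on a b)"
  proof (rule integral_dominated_convergence)
    show "integrable (leb_on a b) (\<lambda>x. (2 * real m)^2)" by simp
    show "AE x in leb_on a b. (\<lambda>n. (clip (real m) (u x) - clip (real m) (g n x))^2) \<longlonglongrightarrow> 0"
      using gae
    proof eventually_elim
      case (elim x)
      have "isCont (clip (real m)) (u x)"
        using clip_continuous[OF continuous_on_id, of UNIV "real m"] by (simp add: continuous_on_eq_continuous_at)
      from isCont_tendsto_compose[OF this elim]
      have "(\<lambda>n. (clip (real m) (u x) - clip (real m) (g n x))^2) \<longlonglongrightarrow> (clip (real m) (u x) - clip (real m) (u x))^2"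
        by (intro tendsto_intros)
      then show ?case by simp
    qed
    have "norm ((clip (real m) (u x) - clip (real m) (g n x))^2) \<le> (2 * real m)^2" for x n
      using clip_bound[of "real m" "u x"] clip_bound[of "real m" "g n x"]
      by (simp only: real_norm_def abs_power2 abs_le_square_iff[symmetric]) auto
    then show "AE x in leb_on a b. norm ((clip (real m) (u x) - clip (real m) (g n x))^2) \<le> (2 * real m)^2" for n
      by auto
  qed (simp_all add: measurable_leb_on)
  from LIMSEQ_D[OF this, of "\<delta> / 4"] obtain n
    where n: "(\<integral>x. (clip (real m) (u x) - clip (real m) (g n x))^2 \<partial>leb_on a b) < \<delta> / 4"
    using \<open>\<delta> > 0\<close> by (auto simp: abs_less_iff)
  have c: "sq_integrable (leb_on a b) (\<lambda>x. clip (real m) (u x))"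
    unfolding sq_integrable_def
  proof
    show "integrable (leb_on a b) (\<lambda>x. (clip (real m) (u x))^2)"
      using clip_bound[of "real m"]
      by (intro integrable_const_bound[of _ "(real m)^2"]) (auto simp: abs_le_square_iff[symmetric] measurable_leb_on)
  qed (simp add: measurable_leb_on)
  have gc: "continuous_on UNIV (\<lambda>x. clip (real m) (g n x))" by (intro clip_continuous g)
  have gs: "sq_integrable (leb_on a b) (\<lambda>x. clip (real m) (g n x))"
    using continuous_on_subset[OF gc] by (intro continuous_sq_integrable) auto
  have "(\<integral>x. (u x - clip (real m) (g n x))^2 \<partial>leb_on a b) < \<delta>"
    using integral_square_add_le[OF sq_integrable_diff[OF u(1) c] sq_integrable_diff[OF c gs]] m n
    by simp
  then show ?thesis using gc by blast
qed


section \<open>Totality of the cosine and sine systems\<close>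

definition finite_span :: "(nat \<Rightarrow> real \<Rightarrow> real) \<Rightarrow> (real \<Rightarrow> real) \<Rightarrow> bool" where
  "finite_span e f \<longleftrightarrow> (\<exists>a n. \<forall>x. f x = (\<Sum>j<n. a j * e j x))"

lemma finite_span_basis: "finite_span e (\<lambda>x. c * e k x)"
proof -
  have "c * e k x = (\<Sum>j<Suc k. (if j = k then c else 0) * e j x)" for x
    by (subst sum.mono_neutral_right[of _ "{k}"]) auto
  then show ?thesis unfolding finite_span_def
    by (intro exI[of _ "\<lambda>j. if j = k then c else 0"] exI[of _ "Suc k"]) blast
qed

lemma finite_span_zero: "finite_span e (\<lambda>x. 0)"
  unfolding finite_span_def by (intro exI[of _ "\<lambda>j. 0"] exI[of _ 0]) simp

lemma finite_span_add:
  assumes "finite_span e f" "finite_span e g"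
  shows "finite_span e (\<lambda>x. f x + g x)"
proof -
  obtain a n b m where *: "\<And>x. f x = (\<Sum>j<n. a j * e j x)" "\<And>x. g x = (\<Sum>j<m. b j * e j x)"
    using assms unfolding finite_span_def by metis
  let ?N = "max n m"
  have "(\<Sum>j<n. a j * e j x) = (\<Sum>j<?N. (if j < n then a j else 0) * e j x)" for x
    by (intro sum.mono_neutral_cong_left) auto
  moreover have "(\<Sum>j<m. b j * e j x) = (\<Sum>j<?N. (if j < m then b j else 0) * e j x)" for x
    by (intro sum.mono_neutral_cong_left) auto
  ultimately have "f x + g x = (\<Sum>j<?N. ((if j < n then a j else 0) + (if j < m then b j else 0)) * e j x)" for x
    unfolding * by (simp only: sum.distrib[symmetric] ring_distribs)
  then show ?thesis unfolding finite_span_def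
    by (intro exI[of _ "\<lambda>j. (if j < n then a j else 0) + (if j < m then b j else 0)"] exI[of _ ?N]) blast
qed

lemma finite_span_cmult:
  assumes "finite_span e f" shows "finite_span e (\<lambda>x. c * f x)"
proof -
  obtain a n where "\<And>x. f x = (\<Sum>j<n. a j * e j x)"
    using assms unfolding finite_span_def by metis
  then have "c * f x = (\<Sum>j<n. (c * a j) * e j x)" for x by (simp add: sum_distrib_left mult.assoc)
  then show ?thesis unfolding finite_span_def by (intro exI[of _ "\<lambda>j. c * a j"] exI[of _ n]) blast
qed

lemma finite_span_sum:
  "(\<And>i. i \<in> S \<Longrightarrow> finite_span e (f i)) \<Longrightarrow> finite_span e (\<lambda>x. \<Sum>i\<in>S. f i x)"
  by (induction S rule: infinite_finite_induct) (auto intro: finite_span_zero finite_span_add)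

lemma finite_span_mult:
  assumes c: "\<And>j. finite_span e (\<lambda>x. c x * e j x)" and f: "finite_span e f"
  shows "finite_span e (\<lambda>x. c x * f x)"
proof -
  obtain a n where f: "\<And>x. f x = (\<Sum>j<n. a j * e j x)"
    using f unfolding finite_span_def by metis
  have "finite_span e (\<lambda>x. \<Sum>j<n. a j * (c x * e j x))"
    by (intro finite_span_sum finite_span_cmult c)
  then show ?thesis by (simp add: f sum_distrib_left mult_ac)
qed

text \<open>If multiplication by \<open>c\<close> maps every basis function into the span, then so
  does every polynomial in \<open>c\<close>. With cos(pi x) for \<open>c\<close>, starting from
  \<open>e k\<close> = 1 gives the cosine system and starting from sin(pi x) the sine
  system.\<close>

lemma finite_span_poly:
  assumes c: "\<And>j. finite_span e (\<lambda>x. c x * e j x)"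
  shows "finite_span e (\<lambda>x. e k x * (\<Sum>i\<le>n. a i * c x ^ i))"
proof -
  have "finite_span e (\<lambda>x. c x ^ i * e k x)" for i
  proof (induction i)
    case 0 show ?case using finite_span_basis[of e 1 k] by simp
  next
    case (Suc i) then show ?case using finite_span_mult[OF c Suc] by (simp add: mult.assoc)
  qed
  then have "finite_span e (\<lambda>x. \<Sum>i\<le>n. a i * (c x ^ i * e k x))"
    by (intro finite_span_sum finite_span_cmult)
  then show ?thesis by (simp add: sum_distrib_left mult_ac)
qed

text \<open>The substitution \<open>y = cos (\<pi> x)\<close> turns Weierstrass' theorem into density of
  \<open>w(x) p(cos (\<pi> x))\<close>; the weights \<open>1\<close> and \<open>sin (\<pi> x)\<close> give the cosine and the sine system.\<close>

lemma weighted_cos_poly_dense: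
  assumes u: "sq_integrable (L01) u" "u \<in> borel_funs" and "\<delta> > 0"
    and w: "continuous_on UNIV w" "\<And>x. 0 < x \<Longrightarrow> x < 1 \<Longrightarrow> w x > 0" "\<And>x. \<bar>w x\<bar> \<le> 1"
  shows "\<exists>a n. (\<integral>x. (u x - w x * (\<Sum>i\<le>(n::nat). a i * cos (pi * x) ^ i))^2 \<partial>L01) < \<delta>"
proof -
  interpret finite_measure "L01" by (rule leb_on_finite_measure)
  \<comment> \<open>The three approximations have errors \<delta>/8, \<delta>/16 and \<delta>/16.
    Each splitting of a square doubles, so the total is 2/8 + 2 (2/16 + 2/16) = 3/4 of
    \<delta>.\<close>
  obtain g where g: "continuous_on UNIV g" and gu: "(\<integral>x. (u x - g x)^2 \<partial>L01) < \<delta> / 8"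
    using L2_dense_continuous[OF u, of "\<delta> / 8"] \<open>\<delta> > 0\<close> by auto
  have gs: "sq_integrable (L01) g"
    using g continuous_on_subset by (intro continuous_sq_integrable) blast
  \<comment> \<open>The quotient of \<open>g\<close> by \<open>w\<close> may blow up at the end
    points, where \<open>w\<close> may vanish. Bounding the denominator below by 1/(n+1) makes
    \<open>q n\<close> continuous, while on [0,1] the product of \<open>w\<close> and
    \<open>q n\<close> stays below \<open>g\<close> in modulus and at each inner point equals
    \<open>g\<close> eventually.\<close>
  define q where "q n x = g x / max (w x) (1 / real (Suc n))" for n x
  have pos: "max (w x) (1 / real (Suc n)) > 0" for x n by (simp add: less_max_iff_disj)
  have q: "continuous_on UNIV (q n)" for n
    unfolding q_def using pos[of _ n] by (intro continuous_intros g w) (metis less_irrefl)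
  have qc: "continuous_on S (q n)" "continuous_on S w" "continuous_on S g" for S n
    using q[of n] w(1) g continuous_on_subset by blast+
  have "(\<lambda>n. \<integral>x. (g x - w x * q n x)^2 \<partial>L01) \<longlonglongrightarrow> (\<integral>x. 0 \<partial>L01)"
  proof (rule integral_dominated_convergence)
    show "integrable (L01) (\<lambda>x. (2 * g x)^2)"
      by (intro continuous_integrable_leb_on continuous_intros qc)
    show "(\<lambda>x. (g x - w x * q n x)^2) \<in> borel_measurable (L01)" for n
      by (intro measurable_leb_on borel_measurable_continuous_onI continuous_intros qc)
    show "AE x in L01. norm ((g x - w x * q n x)^2) \<le> (2 * g x)^2" for n
    proof (rule AE_I2)
      fix x assume "x \<in> space (L01)"
      have x: "0 \<le> w x" if "0 < x" "x < 1" using w(2)[OF that] by simp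
      have "\<bar>w x / max (w x) (1 / real (Suc n))\<bar> \<le> 1" if "w x \<ge> 0"
        using pos[of x n] that by (simp add: abs_of_nonneg)
      have wx: "w x \<ge> 0"
      proof -
        have "x \<in> closure {0<..<1}" using \<open>x \<in> space _\<close> by (simp add: space_leb_on)
        then show ?thesis
          by (rule continuous_ge_on_closure[OF qc(2)]) (use w(2) in force)
      qed
      then have "\<bar>w x / max (w x) (1 / real (Suc n))\<bar> \<le> 1"
        using pos[of x n] by (simp add: abs_of_nonneg)
      then have "\<bar>g x * (w x / max (w x) (1 / real (Suc n)))\<bar> \<le> \<bar>g x\<bar>"
        unfolding abs_mult by (intro mult_left_le) auto
      moreover have "w x * q n x = g x * (w x / max (w x) (1 / real (Suc n)))"
        unfolding q_def by (simp add: mult.commute)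
      ultimately have "\<bar>w x * q n x\<bar> \<le> \<bar>g x\<bar>" by (simp only:)
      moreover have "\<bar>2 * g x\<bar> = 2 * \<bar>g x\<bar>" by (simp add: abs_mult)
      ultimately have "\<bar>g x - w x * q n x\<bar> \<le> \<bar>2 * g x\<bar>"
        using abs_triangle_ineq4[of "g x" "w x * q n x"] by linarith
      then show "norm ((g x - w x * q n x)^2) \<le> (2 * g x)^2"
        by (simp only: real_norm_def abs_power2 abs_le_square_iff)
    qed
    have "AE x in lborel. x \<noteq> (0::real) \<and> x \<noteq> 1"
      using AE_lborel_singleton[of "0::real"] AE_lborel_singleton[of "1::real"] by eventually_elim auto
    then show "AE x in L01. (\<lambda>n. (g x - w x * q n x)^2) \<longlonglongrightarrow> 0"
      unfolding AE_leb_on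
    proof eventually_elim
      case (elim x)
      show ?case
      proof
        assume "x \<in> {0..1}"
        then have wx: "w x > 0" using elim w(2)[of x] by auto
        have "eventually (\<lambda>n. 1 / real (Suc n) < w x) sequentially"
          using order_tendstoD(2)[OF LIMSEQ_inverse_real_of_nat wx] by (simp add: inverse_eq_divide)
        then have "eventually (\<lambda>n. (g x - w x * q n x)^2 = 0) sequentially"
          by eventually_elim (use wx in \<open>auto simp: q_def max_def\<close>)
        then show "(\<lambda>n. (g x - w x * q n x)^2) \<longlonglongrightarrow> 0" by (rule tendsto_eventually)
      qed
    qed
  qed auto
  from LIMSEQ_D[OF this, of "\<delta> / 16"] obtain n
    where n: "(\<integral>x. (g x - w x * q n x)^2 \<partial>L01) < \<delta> / 16"
    using \<open>\<delta> > 0\<close> by (auto simp: abs_less_iff)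
  have "continuous_on {-1..1} (\<lambda>y. q n (arccos y / pi))"
    by (intro continuous_on_compose2[OF q[of n]] continuous_intros continuous_on_arccos') auto
  then obtain p where p: "real_polynomial_function p"
      "\<And>y. y \<in> {-1..1} \<Longrightarrow> \<bar>q n (arccos y / pi) - p y\<bar> < sqrt (\<delta> / 16)"
    using Stone_Weierstrass_real_polynomial_function[of "{-1..1::real}" "\<lambda>y. q n (arccos y / pi)" "sqrt (\<delta> / 16)"]
      \<open>\<delta> > 0\<close> by auto
  obtain a m where am: "p = (\<lambda>x. \<Sum>i\<le>m. a i * x ^ i)"
    using p(1) unfolding real_polynomial_function_iff_sum by blast
  have pc: "continuous_on S (\<lambda>x. p (cos (pi * x)))" for S
    unfolding am by (intro continuous_intros)
  have "(\<integral>x. (w x * q n x - w x * p (cos (pi * x)))^2 \<partial>L01) \<le> (\<integral>x. \<delta> / 16 \<partial>L01)"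
  proof (rule integral_mono)
    show "integrable (L01) (\<lambda>x. (w x * q n x - w x * p (cos (pi * x)))^2)"
      by (intro continuous_integrable_leb_on continuous_intros qc pc)
    fix x assume "x \<in> space (L01)"
    then have x: "0 \<le> x" "x \<le> 1" by (auto simp: space_leb_on)
    have "arccos (cos (pi * x)) = pi * x" using x by (intro arccos_cos) auto
    then have "\<bar>q n x - p (cos (pi * x))\<bar> < sqrt (\<delta> / 16)" using p(2)[of "cos (pi * x)"] by simp
    then have "\<bar>w x\<bar> * \<bar>q n x - p (cos (pi * x))\<bar> \<le> 1 * sqrt (\<delta> / 16)"
      using w(3)[of x] by (intro mult_mono) auto
    then have "\<bar>w x * q n x - w x * p (cos (pi * x))\<bar> \<le> sqrt (\<delta> / 16)"
      by (simp add: abs_mult[symmetric] right_diff_distrib)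
    then have "\<bar>w x * q n x - w x * p (cos (pi * x))\<bar>^2 \<le> (sqrt (\<delta> / 16))^2" by (intro power_mono) auto
    then show "(w x * q n x - w x * p (cos (pi * x)))^2 \<le> \<delta> / 16" using \<open>\<delta> > 0\<close> by simp
  qed auto
  also have "\<dots> \<le> \<delta> / 16"
    by (simp add: measure_restrict_space space_leb_on)
  finally have 3: "(\<integral>x. (w x * q n x - w x * p (cos (pi * x)))^2 \<partial>L01) \<le> \<delta> / 16" .
  have s1: "sq_integrable (L01) (\<lambda>x. u x - g x)" by (intro sq_integrable_diff u gs)
  have s2: "sq_integrable (L01) (\<lambda>x. g x - w x * q n x)"
    "sq_integrable (L01) (\<lambda>x. w x * q n x - w x * p (cos (pi * x)))"
    by (intro continuous_sq_integrable continuous_intros qc pc)+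
  have "(\<integral>x. (u x - w x * p (cos (pi * x)))^2 \<partial>L01) < \<delta>"
    using integral_square_add_le[OF s1 sq_integrable_add[OF s2]] integral_square_add_le[OF s2] gu n 3
      \<open>\<delta> > 0\<close> by simp
  then show ?thesis unfolding am by blast
qed

lemma cos_mult_cos_nat: "finite_span (\<lambda>j x. cos (pi * real j * x)) (\<lambda>x. cos (pi * x) * cos (pi * real k * x))"
proof (cases k)
  case 0
  then show ?thesis using finite_span_basis[of "\<lambda>j x. cos (pi * real j * x)" 1 1] by simp
next
  case (Suc i)
  have "cos (pi * x) * cos (pi * real k * x) =
      (1 / 2) * cos (pi * real i * x) + (1 / 2) * cos (pi * real (Suc k) * x)" for x
    using cos_times_cos[of "pi * real k * x" "pi * x"] Suc by (simp add: algebra_simps)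
  then show ?thesis
    using finite_span_add[OF finite_span_basis[of "\<lambda>j x. cos (pi * real j * x)" "1/2" i]
       finite_span_basis[of "\<lambda>j x. cos (pi * real j * x)" "1/2" "Suc k"]] by simp
qed

lemma cos_mult_sin_nat: "finite_span (\<lambda>j x. sin (pi * real j * x)) (\<lambda>x. cos (pi * x) * sin (pi * real k * x))"
proof (cases k)
  case 0
  then show ?thesis using finite_span_zero by simp
next
  case (Suc i)
  have "cos (pi * x) * sin (pi * real k * x) =
      (1 / 2) * sin (pi * real i * x) + (1 / 2) * sin (pi * real (Suc k) * x)" for x
    using sin_times_cos[of "pi * real k * x" "pi * x"] Suc by (simp add: algebra_simps)
  then show ?thesis
    using finite_span_add[OF finite_span_basis[of "\<lambda>j x. sin (pi * real j * x)" "1/2" i]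
       finite_span_basis[of "\<lambda>j x. sin (pi * real j * x)" "1/2" "Suc k"]] by simp
qed

text \<open>The derivative of \<open>cos_system k\<close> is -pi k times
  \<open>sin_system k\<close>. Index 0 gives the zero function, so orthonormality and totality are
  stated over k \<ge> 1.\<close>

definition sin_system :: "nat \<Rightarrow> real \<Rightarrow> real" where
  "sin_system k x = sqrt 2 * sin (pi * real k * x)"

lemma cos_system_total:
  assumes u: "sq_integrable (L01) u" "u \<in> borel_funs" and "\<delta> > 0"
  shows "\<exists>S a. finite S \<and> S \<subseteq> UNIV \<and> (\<integral>x. (u x - (\<Sum>k\<in>S. a k * cos_system k x))^2 \<partial>L01) < \<delta>"
proof -
  obtain a n where an: "(\<integral>x. (u x - 1 * (\<Sum>i\<le>(n::nat). a i * cos (pi * x) ^ i))^2 \<partial>L01) < \<delta>"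
    using weighted_cos_poly_dense[OF assms, of "\<lambda>x. 1"] by auto
  have "finite_span (\<lambda>j x. cos (pi * real j * x)) (\<lambda>x. \<Sum>i\<le>n. a i * cos (pi * x) ^ i)"
    using finite_span_poly[of "\<lambda>j x. cos (pi * real j * x)" "\<lambda>x. cos (pi * x)" 0, OF cos_mult_cos_nat] by simp
  then obtain b m where b: "\<And>x. (\<Sum>i\<le>n. a i * cos (pi * x) ^ i) = (\<Sum>j<m. b j * cos (pi * real j * x))"
    unfolding finite_span_def by blast
  have "(\<Sum>j<m. b j * cos (pi * real j * x)) = (\<Sum>j<m. (if j = 0 then b j else b j / sqrt 2) * cos_system j x)" for x
    by (intro sum.cong) (auto simp: cos_system_def)
  then show ?thesis using an unfolding b
    by (intro exI[of _ "{..<m}"] exI[of _ "\<lambda>j. if j = 0 then b j else b j / sqrt 2"]) simp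
qed

lemma sin_system_total:
  assumes u: "sq_integrable (L01) u" "u \<in> borel_funs" and "\<delta> > 0"
  shows "\<exists>S a. finite S \<and> S \<subseteq> {1..} \<and> (\<integral>x. (u x - (\<Sum>k\<in>S. a k * sin_system k x))^2 \<partial>L01) < \<delta>"
proof -
  have c: "continuous_on UNIV (\<lambda>x. sin (pi * x))" by (intro continuous_intros)
  have "sin (pi * x) > 0" if "0 < x" "x < 1" for x using that by (intro sin_gt_zero) auto
  then obtain a n where an: "(\<integral>x. (u x - sin (pi * x) * (\<Sum>i\<le>(n::nat). a i * cos (pi * x) ^ i))^2 \<partial>L01) < \<delta>"
    using weighted_cos_poly_dense[OF assms, of "\<lambda>x. sin (pi * x)"] c by auto
  have "finite_span (\<lambda>j x. sin (pi * real j * x)) (\<lambda>x. sin (pi * x) * (\<Sum>i\<le>n. a i * cos (pi * x) ^ i))"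
    using finite_span_poly[of "\<lambda>j x. sin (pi * real j * x)" "\<lambda>x. cos (pi * x)" 1, OF cos_mult_sin_nat] by simp
  then obtain b m where b: "\<And>x. sin (pi * x) * (\<Sum>i\<le>n. a i * cos (pi * x) ^ i) = (\<Sum>j<m. b j * sin (pi * real j * x))"
    unfolding finite_span_def by blast
  have "(\<Sum>j<m. b j * sin (pi * real j * x)) = (\<Sum>j\<in>{1..<m}. (b j / sqrt 2) * sin_system j x)" for x
    by (intro sum.mono_neutral_cong_right) (auto simp: sin_system_def Suc_le_eq)
  then show ?thesis using an unfolding b
    by (intro exI[of _ "{1..<m}"] exI[of _ "\<lambda>j. b j / sqrt 2"]) auto
qed

section \<open>Orthonormality of the trigonometric systems\<close>

lemma integral_cos_int:
  assumes "m \<noteq> 0" "a \<le> b"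
  shows "(\<integral>x. cos (pi * real_of_int m * x - c) \<partial>leb_on a b) =
    (sin (pi * real_of_int m * b - c) - sin (pi * real_of_int m * a - c)) / (pi * real_of_int m)"
proof -
  have "((\<lambda>x. sin (pi * real_of_int m * x - c) / (pi * real_of_int m)) has_field_derivative
     cos (pi * real_of_int m * x - c)) (at x)" for x
    using assms by (auto intro!: derivative_eq_intros)
  from integral_FTC_leb_on[OF assms(2) this] show ?thesis
    by (simp add: diff_divide_distrib continuous_intros)
qed

lemma integral_cos_int_01:
  assumes "m \<noteq> 0" shows "(\<integral>x. cos (pi * real_of_int m * x) \<partial>L01) = 0"
  using integral_cos_int[OF assms, of 0 1 0] sin_int_times_real[of m pi]
  by (simp add: mult.commute[of pi] sin_times_pi_eq_0)

text \<open>The frequencies pi m run through whole periods on [-1,1], so a phase is harmless there;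
  on [0,1] half periods occur, and the preceding lemma is confined to phase 0.\<close>

lemma integral_cos_int_11:
  assumes "m \<noteq> 0" shows "(\<integral>x. cos (pi * real_of_int m * x - c) \<partial>L11) = 0"
proof -
  have "sin (pi * real_of_int m - c) = sin (- (pi * real_of_int m) - c)"
    using sin_times_pi_eq_0[of "real_of_int m"] by (simp add: sin_diff mult.commute[of pi])
  then show ?thesis using integral_cos_int[OF assms, of "-1" 1 c] by simp
qed

lemma integral_const_leb_on: "a \<le> b \<Longrightarrow> (\<integral>x. c \<partial>leb_on a b) = (b - a) * c" for c :: real
  by (simp add: measure_restrict_space space_leb_on)

lemma integrable_cos_leb_on: "integrable (leb_on a b) (\<lambda>x. cos (p * x - q))"
  by (intro continuous_integrable_leb_on continuous_intros)

lemma cos_system_orthonormal: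
  "(\<integral>x. cos_system j x * cos_system k x \<partial>L01) = (if j = k then 1 else 0)"
proof -
  define m where "m = int j - int k"
  define n where "n = int j + int k"
  define cj ck where "cj = (if j = 0 then 1 else sqrt 2)" and "ck = (if k = 0 then 1 else sqrt 2)"
  have e: "cos_system j x * cos_system k x =
     cj * ck / 2 * (cos (pi * real_of_int m * x) + cos (pi * real_of_int n * x))" for x
  proof -
    have "cos_system j x = cj * cos (pi * real j * x)" "cos_system k x = ck * cos (pi * real k * x)"
      by (auto simp: cos_system_def cj_def ck_def)
    moreover have "cos (pi * real j * x) * cos (pi * real k * x) =
      (cos (pi * real_of_int m * x) + cos (pi * real_of_int n * x)) / 2"
      using cos_times_cos[of "pi * real j * x" "pi * real k * x"]
      by (simp add: m_def n_def algebra_simps)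
    ultimately show ?thesis by simp
  qed
  have "(\<integral>x. cos_system j x * cos_system k x \<partial>L01) =
    cj * ck / 2 * ((\<integral>x. cos (pi * real_of_int m * x) \<partial>L01) + (\<integral>x. cos (pi * real_of_int n * x) \<partial>L01))"
    unfolding e using integrable_cos_leb_on[of 0 1 _ 0] by simp
  also have "\<dots> = (if j = k then 1 else 0)"
    using integral_cos_int_01[of m] integral_cos_int_01[of n] integral_const_leb_on[of 0 1 1]
    by (cases "j = k"; cases "j = 0") (auto simp: m_def n_def cj_def ck_def)
  finally show ?thesis .
qed

lemma sin_system_orthonormal:
  assumes "j \<ge> 1" "k \<ge> 1"
  shows "(\<integral>x. sin_system j x * sin_system k x \<partial>L01) = (if j = k then 1 else 0)"
proof -
  define m where "m = int j - int k"
  define n where "n = int j + int k"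
  have e: "sin_system j x * sin_system k x =
     cos (pi * real_of_int m * x) - cos (pi * real_of_int n * x)" for x
  proof -
    have "sin_system j x * sin_system k x = (sqrt 2 * sqrt 2) * (sin (pi * real j * x) * sin (pi * real k * x))"
      by (simp only: sin_system_def mult_ac)
    then show ?thesis
      using sin_times_sin[of "pi * real j * x" "pi * real k * x"]
      by (simp add: m_def n_def algebra_simps)
  qed
  have "(\<integral>x. sin_system j x * sin_system k x \<partial>L01) =
    (\<integral>x. cos (pi * real_of_int m * x) \<partial>L01) - (\<integral>x. cos (pi * real_of_int n * x) \<partial>L01)"
    unfolding e using integrable_cos_leb_on[of 0 1 _ 0] by simp
  also have "\<dots> = (if j = k then 1 else 0)"
    using integral_cos_int_01[of m] integral_cos_int_01[of n] integral_const_leb_on[of 0 1 1] assms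
    by (cases "j = k") (auto simp: m_def n_def)
  finally show ?thesis .
qed

text \<open>The phase \<open>c\<close> is meant to be r (pi/2): cosines integrated r times are
  cosines and sines in turn, and one shifted system handles all r at once. On [-1,1] these functions
  have norm 1 without the factor sqrt 2.\<close>

lemma shifted_cos_orthonormal:
  assumes "j \<ge> 1" "k \<ge> 1"
  shows "(\<integral>x. cos (pi * real j * x - c) * cos (pi * real k * x - c) \<partial>L11) = (if j = k then 1 else 0)"
proof -
  define m where "m = int j - int k"
  define n where "n = int j + int k"
  have e: "cos (pi * real j * x - c) * cos (pi * real k * x - c) =
     1 / 2 * (cos (pi * real_of_int m * x - 0) + cos (pi * real_of_int n * x - 2 * c))" for x
    using cos_times_cos[of "pi * real j * x - c" "pi * real k * x - c"]
    by (simp add: m_def n_def algebra_simps)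
  have "(\<integral>x. cos (pi * real j * x - c) * cos (pi * real k * x - c) \<partial>L11) =
    1 / 2 * ((\<integral>x. cos (pi * real_of_int m * x - 0) \<partial>L11) + (\<integral>x. cos (pi * real_of_int n * x - 2 * c) \<partial>L11))"
    unfolding e
    by (subst integral_mult_right_zero, subst Bochner_Integration.integral_add)
       (rule integrable_cos_leb_on refl)+
  also have "\<dots> = (if j = k then 1 else 0)"
    using integral_cos_int_11[of m 0] integral_cos_int_11[of n "2 * c"] integral_const_leb_on[of "-1" 1 1] assms
    by (cases "j = k") (auto simp: m_def n_def)
  finally show ?thesis .
qed


section \<open>Weak derivatives\<close>

lemma AE_lborel_affine:
  fixes c :: real
  assumes "c \<noteq> 0" "AE x in lborel. P x"
  shows "AE x in lborel. P (t + c * x)"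
proof -
  obtain N where N: "N \<in> null_sets lborel" "{x. \<not> P x} \<subseteq> N"
    using assms(2) unfolding eventually_ae_filter by auto
  have "Measurable.pred borel (\<lambda>x. x \<notin> N)" using N(1) by auto
  from AE_borel_affine[OF assms(1) this AE_not_in[OF N(1)], of t] N(2)
  show ?thesis by (auto elim!: eventually_mono)
qed

lemma borel_representative:
  fixes f :: "real \<Rightarrow> real"
  assumes "set_borel_measurable lebesgue {a..b} f"
  obtains g where "g \<in> borel_funs" "AE x in leb_on a b. f x = g x"
proof -
  obtain g where g: "g \<in> borel_measurable lborel" "AE x in lborel. indicator {a..b} x *\<^sub>R f x = g x"
    using completion_ex_borel_measurable_real[OF assms[unfolded set_borel_measurable_def]] by auto
  have "AE x in leb_on a b. f x = g x"
    unfolding AE_leb_on using g(2) by (auto elim!: eventually_mono)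
  then show ?thesis using that g(1) by simp
qed

text \<open>The bridge from set integrals over \<open>lebesgue\<close> to integrals over
  \<open>leb_on\<close>: \<open>f\<close> may be any function that agrees almost everywhere with a
  Borel function, and its own measurability comes from completeness of
  \<open>lebesgue\<close>.\<close>

lemma
  fixes f g :: "real \<Rightarrow> real"
  assumes g: "g \<in> borel_funs" and fg: "AE x in leb_on a b. f x = g x"
  shows set_borel_measurable_representative: "set_borel_measurable lebesgue {a..b} f"
    and set_integrable_representative: "set_integrable lebesgue {a..b} f \<longleftrightarrow> integrable (leb_on a b) g"
    and set_integral_representative: "(LINT x:{a..b}|lebesgue. f x) = integral\<^sup>L (leb_on a b) g"
proof -
  have gi: "(\<lambda>x. indicator {a..b} x *\<^sub>R g x) \<in> borel_measurable lborel" using g by auto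
  have gl: "(\<lambda>x. indicator {a..b} x *\<^sub>R g x) \<in> borel_measurable lebesgue"
    using gi by (rule measurable_completion)
  have ae: "AE x in lebesgue. indicator {a..b} x *\<^sub>R g x = indicator {a..b} x *\<^sub>R f x"
    using fg unfolding AE_leb_on by (intro AE_completion) (auto simp: indicator_def elim!: eventually_mono)
  have fl: "(\<lambda>x. indicator {a..b} x *\<^sub>R f x) \<in> borel_measurable lebesgue"
    using borel_measurable_AE[OF gl ae] .
  then show "set_borel_measurable lebesgue {a..b} f" unfolding set_borel_measurable_def .
  show "set_integrable lebesgue {a..b} f \<longleftrightarrow> integrable (leb_on a b) g"
    unfolding integrable_leb_on set_integrable_def integrable_completion[OF gi, symmetric]
    using integrable_cong_AE[OF gl fl ae] by simp
  show "(LINT x:{a..b}|lebesgue. f x) = integral\<^sup>L (leb_on a b) g"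
    unfolding integral_leb_on set_lebesgue_integral_def integral_completion[OF gi, symmetric]
    using integral_cong_AE[OF gl fl ae] by simp
qed

lemma L2_space_iff_representative:
  assumes g: "g \<in> borel_funs" and fg: "AE x in leb_on a b. f x = g x"
  shows "f \<in> L2_space a b \<longleftrightarrow> sq_integrable (leb_on a b) g"
proof -
  have "AE x in leb_on a b. (f x)^2 = (g x)^2" using fg by (auto elim!: eventually_mono)
  from set_integrable_representative[OF _ this] set_borel_measurable_representative[OF g fg]
  show ?thesis using g unfolding L2_space_def sq_integrable_def by (auto intro: measurable_leb_on)
qed

lemma L2_norm_representative:
  assumes g: "g \<in> borel_funs" and fg: "AE x in leb_on a b. f x = g x"
  shows "L2_norm a b f = sqrt (sqnorm (leb_on a b) g)"
proof -
  have "AE x in leb_on a b. (f x)^2 = (g x)^2" using fg by (auto elim!: eventually_mono)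
  from set_integral_representative[OF _ this] g show ?thesis unfolding L2_norm_def by simp
qed

lemma L2_space_representative:
  assumes "f \<in> L2_space a b"
  obtains g where "g \<in> borel_funs" "AE x in leb_on a b. f x = g x"
    "sq_integrable (leb_on a b) g"
proof -
  have "set_borel_measurable lebesgue {a..b} f" using assms unfolding L2_space_def by simp
  then obtain g where "g \<in> borel_funs" "AE x in leb_on a b. f x = g x"
    using borel_representative by blast
  then show ?thesis using that L2_space_iff_representative[where f = f and g = g] assms by blast
qed

lemma sq_integrable_imp_integrable:
  assumes "sq_integrable (leb_on a b) g" shows "integrable (leb_on a b) g"
proof -
  have "sq_integrable (leb_on a b) (\<lambda>x. 1)"
    by (intro continuous_sq_integrable continuous_intros)
  from sq_integrable_mult_integrable[OF assms this] show ?thesis by simp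
qed

lemma L2_space_locally_integrable:
  assumes "f \<in> L2_space a b" shows "locally_integrable a b f"
proof -
  obtain g where g: "g \<in> borel_funs" "AE x in leb_on a b. f x = g x"
    "sq_integrable (leb_on a b) g" using L2_space_representative[OF assms] .
  have "set_integrable lebesgue {a..b} f"
    using set_integrable_representative[OF g(1,2)] sq_integrable_imp_integrable[OF g(3)] by simp
  then show ?thesis unfolding locally_integrable_def
    by (auto intro: set_integrable_subset)
qed

text \<open>Weierstrass' theorem carries orthogonality over to bounded continuous functions. These
  approximate the sign of \<open>w\<close> almost everywhere, and after clipping to [-1,1] dominated
  convergence with majorant |w| shows that the integral of |w| is 0. As \<open>w\<close> is merely
  integrable, orthogonality in L2 would not do.\<close>

lemma zero_if_orthogonal_to_polynomials:
  assumes w: "w \<in> borel_funs" "integrable (leb_on a b) w"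
    and p: "\<And>p. (\<integral>x. w x * poly p x \<partial>leb_on a b) = 0"
  shows "AE x in leb_on a b. w x = 0"
proof -
  have orth: "(\<integral>x. w x * g x \<partial>leb_on a b) = 0" if g: "continuous_on UNIV g" "\<And>x. \<bar>g x\<bar> \<le> 1" for g
  proof -
    have [measurable]: "g \<in> borel_funs" "w \<in> borel_funs"
      using g(1) w(1) by (auto intro: borel_measurable_continuous_onI)
    have int_mult: "integrable (leb_on a b) (\<lambda>x. w x * h x)"
      if h: "h \<in> borel_funs" "\<And>x. x \<in> {a..b} \<Longrightarrow> \<bar>h x\<bar> \<le> C" for h C
    proof (rule Bochner_Integration.integrable_bound)
      show "integrable (leb_on a b) (\<lambda>x. C * w x)" using w by simp
      show "(\<lambda>x. w x * h x) \<in> borel_measurable (leb_on a b)" using h(1) by (intro measurable_leb_on) measurable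
      have "norm (w x * h x) \<le> norm (C * w x)" if "x \<in> {a..b}" for x
        using mult_right_mono[OF order_trans[OF h(2)[OF that] abs_ge_self], of "\<bar>w x\<bar>"] by (simp add: abs_mult mult.commute)
      then show "AE x in leb_on a b. norm (w x * h x) \<le> norm (C * w x)"
        by (intro AE_I2) (simp add: space_leb_on)
    qed
    have le: "\<bar>\<integral>x. w x * g x \<partial>leb_on a b\<bar> \<le> e * (\<integral>x. \<bar>w x\<bar> \<partial>leb_on a b)" if "e > 0" for e
    proof -
      have "continuous_on {a..b} g" using g(1) continuous_on_subset by blast
      then have "\<exists>q. real_polynomial_function q \<and> (\<forall>x\<in>{a..b}. \<bar>g x - q x\<bar> < e)"
        by (rule Stone_Weierstrass_real_polynomial_function[OF compact_Icc _ \<open>e > 0\<close>]) blast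
      then obtain q where q: "real_polynomial_function q" "\<And>x. x \<in> {a..b} \<Longrightarrow> \<bar>g x - q x\<bar> < e"
        by blast
      obtain c n where "q = (\<lambda>x. \<Sum>i\<le>(n::nat). c i * x ^ i)"
        using q(1) unfolding real_polynomial_function_iff_sum by blast
      then have qp: "q = poly (\<Sum>i\<le>n. monom (c i) i)"
        by (simp add: fun_eq_iff poly_sum poly_monom)
      have m: "poly P \<in> borel_funs" for P :: "real poly"
        by (intro borel_measurable_continuous_onI continuous_intros)
      have "\<bar>q x\<bar> \<le> 1 + e" if "x \<in> {a..b}" for x using q(2)[OF that] g(2)[of x] by linarith
      then have iq: "integrable (leb_on a b) (\<lambda>x. w x * q x)"
        using m by (intro int_mult[of q "1 + e"]) (auto simp: qp)
      have ig: "integrable (leb_on a b) (\<lambda>x. w x * g x)" using g(2) by (intro int_mult[of g 1]) auto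
      have "(\<integral>x. w x * g x \<partial>leb_on a b) = (\<integral>x. w x * g x - w x * q x \<partial>leb_on a b)"
        using p iq ig by (simp add: qp)
      also have "\<bar>\<dots>\<bar> \<le> (\<integral>x. \<bar>w x * g x - w x * q x\<bar> \<partial>leb_on a b)" by simp
      also have "\<dots> \<le> (\<integral>x. e * \<bar>w x\<bar> \<partial>leb_on a b)"
      proof (rule integral_mono)
        show "integrable (leb_on a b) (\<lambda>x. \<bar>w x * g x - w x * q x\<bar>)" using iq ig by simp
        show "integrable (leb_on a b) (\<lambda>x. e * \<bar>w x\<bar>)" using w by simp
        fix x assume "x \<in> space (leb_on a b)"
        then have "\<bar>g x - q x\<bar> * \<bar>w x\<bar> \<le> e * \<bar>w x\<bar>"
          using q(2)[of x] by (intro mult_right_mono) (auto simp: space_leb_on intro: less_imp_le)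
        then show "\<bar>w x * g x - w x * q x\<bar> \<le> e * \<bar>w x\<bar>"
          by (simp add: abs_mult[symmetric] algebra_simps)
      qed
      finally show ?thesis by simp
    qed
    define I where "I = (\<integral>x. \<bar>w x\<bar> \<partial>leb_on a b)"
    have I: "I \<ge> 0" unfolding I_def by simp
    have "\<bar>\<integral>x. w x * g x \<partial>leb_on a b\<bar> \<le> 0 + eps" if "eps > 0" for eps
    proof -
      \<comment> \<open>Adding 1 to \<open>I\<close> covers the case that \<open>I\<close> is
        0.\<close>
      have "eps / (I + 1) * I \<le> eps" using that I by (simp add: field_simps)
      then show ?thesis using le[of "eps / (I + 1)"] that I unfolding I_def[symmetric] by simp
    qed
    then have "\<bar>\<integral>x. w x * g x \<partial>leb_on a b\<bar> \<le> 0" by (rule field_le_epsilon)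
    then show ?thesis by simp
  qed
  obtain g where g: "\<And>n. continuous_on UNIV (g n)" "AE x in lborel. (\<lambda>n. g n x) \<longlonglongrightarrow> sgn (w x)"
    using continuous_approx_AE[of "\<lambda>x. sgn (w x)"] w(1) by auto
  have gm: "g n \<in> borel_funs" for n by (intro borel_measurable_continuous_onI g)
  have "(\<lambda>n. \<integral>x. w x * clip 1 (g n x) \<partial>leb_on a b) \<longlonglongrightarrow> (\<integral>x. \<bar>w x\<bar> \<partial>leb_on a b)"
  proof (rule integral_dominated_convergence)
    show "integrable (leb_on a b) (\<lambda>x. \<bar>w x\<bar>)" using w by simp
    show "(\<lambda>x. \<bar>w x\<bar>) \<in> borel_measurable (leb_on a b)" using w(1) by (intro measurable_leb_on) auto
    show "(\<lambda>x. w x * clip 1 (g n x)) \<in> borel_measurable (leb_on a b)" for n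
      using w(1) gm[of n] by (intro measurable_leb_on) auto
    show "AE x in leb_on a b. (\<lambda>n. w x * clip 1 (g n x)) \<longlonglongrightarrow> \<bar>w x\<bar>"
      unfolding AE_leb_on using g(2)
    proof eventually_elim
      case (elim x)
      have "isCont (clip 1) (sgn (w x))"
        using clip_continuous[OF continuous_on_id, of UNIV 1] by (simp add: continuous_on_eq_continuous_at)
      from isCont_tendsto_compose[OF this elim]
      have "(\<lambda>n. w x * clip 1 (g n x)) \<longlonglongrightarrow> w x * clip 1 (sgn (w x))" by (intro tendsto_intros)
      moreover have "w x * clip 1 (sgn (w x)) = \<bar>w x\<bar>" by (auto simp: sgn_if clip_def)
      ultimately show ?case by simp
    qed
    have "\<bar>w x\<bar> * \<bar>clip 1 (g n x)\<bar> \<le> \<bar>w x\<bar>" for n x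
      using clip_bound[of 1] by (intro mult_left_le) auto
    then show "AE x in leb_on a b. norm (w x * clip 1 (g n x)) \<le> \<bar>w x\<bar>" for n
      by (simp add: abs_mult)
  qed
  moreover have "(\<integral>x. w x * clip 1 (g n x) \<partial>leb_on a b) = 0" for n
    using clip_bound[of 1] by (intro orth clip_continuous g) auto
  ultimately have "(\<lambda>n::nat. 0) \<longlonglongrightarrow> (\<integral>x. \<bar>w x\<bar> \<partial>leb_on a b)" by simp
  from LIMSEQ_unique[OF this tendsto_const] have "(\<integral>x. \<bar>w x\<bar> \<partial>leb_on a b) = 0" by simp
  then have "AE x in leb_on a b. \<bar>w x\<bar> = 0"
    using w by (subst integral_nonneg_eq_0_iff_AE[symmetric]) auto
  then show ?thesis by simp
qed

text \<open>\<open>w\<close> may fail to be integrable up to the end points, but \<phi> vanishes off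
  some [c,e] inside the open interval, where \<open>w\<close> is integrable and \<phi>
  bounded.\<close>

lemma locally_integrable_mult_test_fun:
  assumes w: "locally_integrable a b w" and \<phi>: "test_fun a b \<phi>" and "a < b"
  shows "set_integrable lebesgue {a..b} (\<lambda>x. w x * \<phi> x)"
proof -
  obtain c e where *: "a < c" "c \<le> e" "e < b" "\<And>x. x \<notin> {c..e} \<Longrightarrow> \<phi> x = 0" and s: "smooth \<phi>"
    using \<phi> unfolding test_fun_iff[OF assms(3)] by blast
  have "bounded (\<phi> ` {c..e})"
    by (intro compact_imp_bounded compact_continuous_image smooth_continuous_on s) auto
  then obtain C where C: "\<forall>x\<in>{c..e}. \<bar>\<phi> x\<bar> \<le> C" by (auto simp: bounded_iff)
  have i: "integrable lebesgue (\<lambda>x. indicator {c..e} x *\<^sub>R w x)"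
    using w * unfolding locally_integrable_def set_integrable_def by blast
  have eq: "indicator {a..b} x *\<^sub>R (w x * \<phi> x) = (indicator {c..e} x *\<^sub>R w x) * \<phi> x" for x
    using *(1,3) *(4)[of x] by (auto simp: indicator_def)
  have "integrable lebesgue (\<lambda>x. (indicator {c..e} x *\<^sub>R w x) * \<phi> x)"
  proof (rule Bochner_Integration.integrable_bound)
    show "integrable lebesgue (\<lambda>x. C * (indicator {c..e} x *\<^sub>R w x))" using i by simp
    have "\<phi> \<in> borel_measurable lebesgue"
      using smooth_borel_measurable[OF s] by (intro measurable_completion) simp
    then show "(\<lambda>x. (indicator {c..e} x *\<^sub>R w x) * \<phi> x) \<in> borel_measurable lebesgue"
      using borel_measurable_integrable[OF i] by (rule borel_measurable_times[rotated])
    have "\<bar>w x\<bar> * \<bar>\<phi> x\<bar> \<le> \<bar>C\<bar> * \<bar>w x\<bar>" if "x \<in> {c..e}" for x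
      using mult_right_mono[OF order_trans[OF bspec[OF C that] abs_ge_self], of "\<bar>w x\<bar>"] by (simp add: mult.commute)
    then show "AE x in lebesgue. norm ((indicator {c..e} x *\<^sub>R w x) * \<phi> x) \<le> norm (C * (indicator {c..e} x *\<^sub>R w x))"
      by (auto simp: abs_mult indicator_def)
  qed
  then show ?thesis unfolding set_integrable_def eq .
qed

text \<open>A bump that is positive exactly on (1/n, 1 - 1/n) makes its product with
  \<open>w\<close> integrable and turns every polynomial into a test function, so the polynomial
  case applies to that product. Countably many n exhaust (0,1).\<close>

lemma zero_if_orthogonal_to_test_funs:
  assumes w: "locally_integrable 0 1 w"
    and orth: "\<And>\<phi>. test_fun 0 1 \<phi> \<Longrightarrow> (LINT x:{0..1}|lebesgue. w x * \<phi> x) = 0"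
  shows "AE x in L01. w x = 0"
proof -
  define \<phi> where "\<phi> n x = flat 1 (x - 1 / real n) * flat 1 ((1 - 1 / real n) - x)" for n x
  have test: "test_fun 0 1 (\<phi> n)" if n: "n \<ge> 2" for n :: nat
  proof -
    have "smooth (\<phi> n)"
      unfolding \<phi>_def using smooth_affine[OF smooth_flat, of 1 1 "- (1 / real n)"]
        smooth_affine[OF smooth_flat, of 1 "-1" "1 - 1 / real n"]
      by (intro smooth_mult) (auto simp: algebra_simps)
    moreover have "0 < 1 / real n" "1 / real n \<le> 1 - 1 / real n" "1 - 1 / real n < 1"
      using n by (auto simp: field_simps)
    moreover have "\<phi> n x = 0" if "x \<notin> {1 / real n..1 - 1 / real n}" for x
      using that by (auto simp: \<phi>_def flat_nonpos)
    ultimately show ?thesis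
      by (subst test_fun_iff) (simp, intro conjI exI[of _ "1 / real n"] exI[of _ "1 - 1 / real n"], auto)
  qed
  have zero: "AE x in L01. w x * \<phi> n x = 0" if n: "n \<ge> 2" for n :: nat
  proof -
    have i: "set_integrable lebesgue {0..1} (\<lambda>x. w x * \<phi> n x)"
      by (intro locally_integrable_mult_test_fun w test n) auto
    then have "set_borel_measurable lebesgue {0..1} (\<lambda>x. w x * \<phi> n x)"
      unfolding set_integrable_def set_borel_measurable_def by (rule borel_measurable_integrable)
    then obtain g where g: "g \<in> borel_funs" "AE x in L01. w x * \<phi> n x = g x"
      using borel_representative by blast
    have "(\<integral>x. g x * poly p x \<partial>L01) = 0" for p
    proof -
      have "(\<integral>x. g x * poly p x \<partial>L01) = (LINT x:{0..1}|lebesgue. w x * (\<phi> n x * poly p x))"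
      proof (rule set_integral_representative[symmetric])
        show "AE x in L01. w x * (\<phi> n x * poly p x) = g x * poly p x"
          using g(2) by eventually_elim (simp add: mult.assoc[symmetric])
        have "poly p \<in> borel_funs"
          by (intro borel_measurable_continuous_onI continuous_intros)
        then show "(\<lambda>x. g x * poly p x) \<in> borel_funs" using g(1) by simp
      qed
      also have "\<dots> = 0" by (intro orth test_fun_mult test n smooth_poly) auto
      finally show ?thesis .
    qed
    then have "AE x in L01. g x = 0"
      using set_integrable_representative[OF g] i by (intro zero_if_orthogonal_to_polynomials g) auto
    then show ?thesis using g(2) by eventually_elim simp
  qed
  have "AE x in L01. \<forall>n\<ge>2. w x * \<phi> n x = 0"
    using zero by (subst AE_all_countable) auto
  moreover have "AE x in L01. x \<noteq> 0 \<and> x \<noteq> 1"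
    unfolding AE_leb_on using AE_lborel_singleton[of "0::real"] AE_lborel_singleton[of "1::real"]
    by eventually_elim auto
  ultimately show ?thesis using AE_space
  proof eventually_elim
    case (elim x)
    then have x: "0 < x" "x < 1" by (auto simp: space_leb_on)
    obtain n0 where "inverse (real (Suc n0)) < min x (1 - x)"
      using reals_Archimedean[of "min x (1 - x)"] x by auto
    then have n0: "1 / real (Suc n0) < x" "1 / real (Suc n0) < 1 - x" by (auto simp: inverse_eq_divide)
    \<comment> \<open>One more than the Archimedean index, so that n \<ge> 2, where \<phi> n is
      known to be a test function.\<close>
    define n where "n = Suc (Suc n0)"
    have "1 / real n < 1 / real (Suc n0)" unfolding n_def by (intro divide_strict_left_mono) auto
    then have "1 / real n < x" "x < 1 - 1 / real n" using n0 by auto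
    then have "\<phi> n x > 0" unfolding \<phi>_def by (intro mult_pos_pos flat_pos) auto
    moreover have "w x * \<phi> n x = 0" using elim(1) by (auto simp: n_def)
    ultimately show ?case by simp
  qed
qed

text \<open>\<open>weak_deriv\<close> is a choice, so \<open>H1_norm\<close> can be computed from a
  known weak derivative only after uniqueness up to null sets.\<close>

lemma weak_deriv_unique:
  assumes 1: "has_weak_deriv 0 1 1 u g1" and 2: "has_weak_deriv 0 1 1 u g2"
  shows "AE x in L01. g1 x = g2 x"
proof -
  have l: "locally_integrable 0 1 g1" "locally_integrable 0 1 g2"
    using 1 2 unfolding has_weak_deriv_def by auto
  have "locally_integrable 0 1 (\<lambda>x. g1 x - g2 x)"
    using l unfolding locally_integrable_def by (auto intro: set_integral_diff)
  moreover have "(LINT x:{0..1}|lebesgue. (g1 x - g2 x) * \<phi> x) = 0" if \<phi>: "test_fun 0 1 \<phi>" for \<phi>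
  proof -
    have "(LINT x:{0..1}|lebesgue. (g1 x - g2 x) * \<phi> x) =
        (LINT x:{0..1}|lebesgue. g1 x * \<phi> x) - (LINT x:{0..1}|lebesgue. g2 x * \<phi> x)"
      unfolding left_diff_distrib
      by (intro set_integral_diff locally_integrable_mult_test_fun l \<phi>) auto
    also have "\<dots> = 0" using 1 2 \<phi> unfolding has_weak_deriv_def by auto
    finally show ?thesis .
  qed
  ultimately have "AE x in L01. g1 x - g2 x = 0" by (rule zero_if_orthogonal_to_test_funs)
  then show ?thesis by simp
qed

text \<open>The working form of a first-order weak derivative. Both functions are Borel on the whole
  line, so that u(t s) is jointly measurable in t and s; square integrability is built in because it
  has to be carried along through slicing anyway.\<close>

definition borel_weak_deriv :: "real \<Rightarrow> real \<Rightarrow> (real \<Rightarrow> real) \<Rightarrow> (real \<Rightarrow> real) \<Rightarrow> bool" where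
  "borel_weak_deriv a b u v \<longleftrightarrow>
     u \<in> borel_funs \<and> v \<in> borel_funs \<and>
     sq_integrable (leb_on a b) u \<and> sq_integrable (leb_on a b) v \<and>
     (\<forall>\<phi>. test_fun a b \<phi> \<longrightarrow> (\<integral>x. u x * deriv \<phi> x \<partial>leb_on a b) = - (\<integral>x. v x * \<phi> x \<partial>leb_on a b))"

lemma
  assumes d: "borel_weak_deriv 0 1 u v" and f: "AE x in L01. f x = u x"
  shows sobolev_space_1I: "f \<in> sobolev_space 1 0 1"
    and H1_norm_representative:
      "H1_norm 0 1 f = sqrt (sqnorm L01 u + sqnorm L01 v)"
proof -
  have u: "u \<in> borel_funs" "sq_integrable (L01) u"
    and v: "v \<in> borel_funs" "sq_integrable (L01) v"
    and uv: "\<And>\<phi>. test_fun 0 1 \<phi> \<Longrightarrow> (\<integral>x. u x * deriv \<phi> x \<partial>L01) = - (\<integral>x. v x * \<phi> x \<partial>L01)"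
    using d unfolding borel_weak_deriv_def by auto
  have f2: "f \<in> L2_space 0 1" using L2_space_iff_representative[OF u(1) f] u(2) by simp
  have v2: "v \<in> L2_space 0 1" using L2_space_iff_representative[OF v(1), where f = v and a = 0 and b = 1] v(2) by simp
  have wd: "has_weak_deriv 0 1 1 f v"
    unfolding has_weak_deriv_def
  proof (intro conjI allI impI L2_space_locally_integrable f2 v2)
    fix \<phi> assume \<phi>: "test_fun 0 1 \<phi>"
    note [measurable] = u(1) v(1) smooth_borel_measurable[OF test_fun_smooth[OF \<phi>]]
      smooth_borel_measurable[OF smooth_deriv[OF test_fun_smooth[OF \<phi>]]]
    have "(LINT x:{0..1}|lebesgue. f x * deriv \<phi> x) = (\<integral>x. u x * deriv \<phi> x \<partial>L01)"
      using f by (intro set_integral_representative) (auto elim!: eventually_mono)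
    moreover have "(LINT x:{0..1}|lebesgue. v x * \<phi> x) = (\<integral>x. v x * \<phi> x \<partial>L01)"
      by (intro set_integral_representative) auto
    ultimately show "(LINT x:{0..1}|lebesgue. f x * (deriv ^^ 1) \<phi> x) =
        (-1) ^ 1 * (LINT x:{0..1}|lebesgue. v x * \<phi> x)" using uv[OF \<phi>] by simp
  qed
  have "has_weak_deriv 0 1 0 f f"
    unfolding has_weak_deriv_def using L2_space_locally_integrable[OF f2] by simp
  then have "\<exists>g\<in>L2_space 0 1. has_weak_deriv 0 1 k f g" if "k \<le> 1" for k
    using wd f2 v2 that by (cases "k = 0") (auto simp: le_Suc_eq)
  then show "f \<in> sobolev_space 1 0 1" unfolding sobolev_space_def using f2 by blast
  have "has_weak_deriv 0 1 1 f (weak_deriv 0 1 f)"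
    unfolding weak_deriv_def by (rule someI[where P = "has_weak_deriv 0 1 1 f", OF wd])
  from weak_deriv_unique[OF this wd]
  have "L2_norm 0 1 (weak_deriv 0 1 f) = sqrt (sqnorm L01 v)"
    by (rule L2_norm_representative[OF v(1)])
  moreover have "L2_norm 0 1 f = sqrt (sqnorm L01 u)"
    by (rule L2_norm_representative[OF u(1) f])
  ultimately show "H1_norm 0 1 f = sqrt (sqnorm L01 u + sqnorm L01 v)"
    unfolding H1_norm_def by simp
qed


section \<open>Cosine approximation of even Sobolev functions\<close>

lemma integral_leb_on_reflect:
  fixes g :: "real \<Rightarrow> real"
  shows "(\<integral>x. g (- x) \<partial>L11) = (\<integral>x. g x \<partial>L11)"
proof -
  have "(\<integral>x. indicator {-1..1} x *\<^sub>R g x \<partial>lborel) = (\<integral>x. indicator {-1..1} (- x) *\<^sub>R g (- x) \<partial>lborel)"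
    using lborel_integral_real_affine[of "-1" "\<lambda>x. indicator {-1..1} x *\<^sub>R g x" 0] by simp
  also have "(\<lambda>x. indicator {-1..1} (- x) *\<^sub>R g (- x)) = (\<lambda>x. indicator {-1..1::real} x *\<^sub>R g (- x))"
    by (auto simp: indicator_def)
  finally show ?thesis unfolding integral_leb_on set_lebesgue_integral_def by simp
qed

lemma integral_leb_on_even:
  fixes g :: "real \<Rightarrow> real"
  assumes g: "g \<in> borel_funs" "integrable (L11) g" and even: "\<And>x. g (- x) = g x"
  shows "(\<integral>x. g x \<partial>L11) = 2 * (\<integral>x. g x \<partial>L01)"
proof -
  have gi: "integrable lborel (\<lambda>x. indicator {0..1} x *\<^sub>R g x)"
    using set_integrable_subset[OF g(2)[unfolded integrable_leb_on], of "{0..1}"]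
    unfolding set_integrable_def by auto
  have gi': "integrable lborel (\<lambda>x. indicator {0..1} (- x) *\<^sub>R g (- x))"
    using lborel_integrable_real_affine[OF gi, of "-1" 0] by simp
  have "AE x in lborel. indicator {-1..1} x *\<^sub>R g x =
      indicator {0..1} x *\<^sub>R g x + indicator {0..1} (- x) *\<^sub>R g (- x)"
    using AE_lborel_singleton[of "0::real"]
    by eventually_elim (auto simp: indicator_def even)
  then have "(\<integral>x. indicator {-1..1} x *\<^sub>R g x \<partial>lborel) =
      (\<integral>x. indicator {0..1} x *\<^sub>R g x + indicator {0..1} (- x) *\<^sub>R g (- x) \<partial>lborel)"
    using g(1) gi' by (intro integral_cong_AE) auto
  also have "\<dots> = 2 * (\<integral>x. indicator {0..1} x *\<^sub>R g x \<partial>lborel)"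
    using gi gi' lborel_integral_real_affine[of "-1" "\<lambda>x. indicator {0..1} x *\<^sub>R g x" 0] by simp
  finally show ?thesis unfolding integral_leb_on set_lebesgue_integral_def .
qed

lemma sq_integrable_reflect:
  assumes g: "g \<in> borel_funs" "sq_integrable (L11) g"
  shows "sq_integrable (L11) (\<lambda>x. g (- x))"
proof -
  have m: "(\<lambda>x. g (- x)) \<in> borel_funs" using g(1) by measurable
  have "integrable lborel (\<lambda>x. indicator {-1..1} x *\<^sub>R (g x)^2)"
    using g(2) unfolding sq_integrable_def integrable_leb_on set_integrable_def by auto
  from lborel_integrable_real_affine[OF this, of "-1" 0]
  have "integrable lborel (\<lambda>x. indicator {-1..1} (- x) *\<^sub>R (g (- x))^2)" by simp
  also have "(\<lambda>x. indicator {-1..1} (- x) *\<^sub>R (g (- x))^2) = (\<lambda>x. indicator {-1..1::real} x *\<^sub>R (g (- x))^2)"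
    by (auto simp: indicator_def)
  finally show ?thesis
    using m unfolding sq_integrable_def integrable_leb_on set_integrable_def by (auto intro: measurable_leb_on)
qed

lemma AE_leb_on_reflect:
  assumes "AE x in L11. P x" shows "AE x in L11. P (- x)"
  using AE_lborel_affine[of "-1" "\<lambda>x. x \<in> {-1..1} \<longrightarrow> P x" 0] assms unfolding AE_leb_on by auto

lemma AE_leb_on_subset:
  assumes "AE x in leb_on a b. P x" "a \<le> c" "d \<le> b" shows "AE x in leb_on c d. P x"
  using assms(1) unfolding AE_leb_on by eventually_elim (use assms(2,3) in auto)

lemma sq_integrable_leb_on_subset:
  assumes "sq_integrable (leb_on a b) u" "u \<in> borel_funs" "a \<le> c" "d \<le> b"
  shows "sq_integrable (leb_on c d) u"
  using assms set_integrable_subset[of lborel "{a..b}" _ "{c..d}"]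
  unfolding sq_integrable_def integrable_leb_on by (auto intro: measurable_leb_on)

lemma deriv_reflect: "smooth \<phi> \<Longrightarrow> deriv (\<lambda>x. \<phi> (- x)) = (\<lambda>x. - deriv \<phi> (- x))"
  using funpow_deriv_affine[of \<phi> 1 "-1" 0] by simp

text \<open>Borel representatives of the weak derivatives of the even function \<open>h(x) = f \<bar>x\<bar>\<close>;
  the first two inherit the parity of \<open>h\<close> and \<open>h'\<close> at every point.\<close>

lemma even_sobolev_jet:
  fixes f :: "real \<Rightarrow> real"
  assumes h: "(\<lambda>x. f \<bar>x\<bar>) \<in> sobolev_space r (-1) 1" and r: "r \<ge> 1"
  obtains H :: "nat \<Rightarrow> real \<Rightarrow> real" where
    "\<And>i. i \<le> r \<Longrightarrow> H i \<in> borel_funs"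
    "\<And>i. i \<le> r \<Longrightarrow> sq_integrable (L11) (H i)"
    "\<And>i \<phi>. i \<le> r \<Longrightarrow> test_fun (-1) 1 \<phi> \<Longrightarrow>
       (\<integral>x. H 0 x * (deriv ^^ i) \<phi> x \<partial>L11) = (-1) ^ i * (\<integral>x. H i x * \<phi> x \<partial>L11)"
    "\<And>x. H 0 (- x) = H 0 x" "\<And>x. H 1 (- x) = - H 1 x" "AE x in L01. f x = H 0 x"
proof -
  have "\<exists>g. g \<in> borel_funs \<and> sq_integrable (L11) g \<and>
      (\<exists>g'. has_weak_deriv (-1) 1 i (\<lambda>x. f \<bar>x\<bar>) g' \<and> (AE x in L11. g' x = g x))" if "i \<le> r" for i
  proof -
    obtain g' where g': "g' \<in> L2_space (-1) 1" "has_weak_deriv (-1) 1 i (\<lambda>x. f \<bar>x\<bar>) g'"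
      using h \<open>i \<le> r\<close> unfolding sobolev_space_def by auto
    then show ?thesis using L2_space_representative[OF g'(1)] by metis
  qed
  then obtain g where g: "\<And>i. i \<le> r \<Longrightarrow> g i \<in> borel_funs"
     "\<And>i. i \<le> r \<Longrightarrow> sq_integrable (L11) (g i)"
     and wd: "\<And>i. i \<le> r \<Longrightarrow> \<exists>g'. has_weak_deriv (-1) 1 i (\<lambda>x. f \<bar>x\<bar>) g' \<and> (AE x in L11. g' x = g i x)"
    by metis
  have "(\<lambda>x. f \<bar>x\<bar>) \<in> L2_space (-1) 1" using h unfolding sobolev_space_def by auto
  then obtain h0 where h0: "h0 \<in> borel_funs" "AE x in L11. f \<bar>x\<bar> = h0 x"
    "sq_integrable (L11) h0" using L2_space_representative by metis
  \<comment> \<open>Averaging with the reflection yields evenness at every point; since f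
    \<bar>x\<bar> is even, the agreement almost everywhere survives.\<close>
  define he where "he x = (1 / 2) * h0 x + (1 / 2) * h0 (- x)" for x
  define go where "go x = (1 / 2) * g 1 x - (1 / 2) * g 1 (- x)" for x
  define H where "H i = (if i = 0 then he else if i = 1 then go else g i)" for i
  note [measurable] = h0(1) g(1)[OF r]
  have he: "he \<in> borel_funs" "sq_integrable (L11) he"
    unfolding he_def by measurable
      (intro sq_integrable_add sq_integrable_cmult h0 sq_integrable_reflect)
  have go: "go \<in> borel_funs" "sq_integrable (L11) go"
    unfolding go_def by measurable
      (intro sq_integrable_diff sq_integrable_cmult g r sq_integrable_reflect)
  have hae: "AE x in L11. f \<bar>x\<bar> = he x"
    using h0(2) AE_leb_on_reflect[OF h0(2)] by eventually_elim (simp add: he_def)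
  have base: "(\<integral>x. he x * (deriv ^^ i) \<phi> x \<partial>L11) = (-1) ^ i * (\<integral>x. g i x * \<phi> x \<partial>L11)"
    if i: "i \<le> r" and \<phi>: "test_fun (-1) 1 \<phi>" for i \<phi>
  proof -
    obtain g' where g': "has_weak_deriv (-1) 1 i (\<lambda>x. f \<bar>x\<bar>) g'" "AE x in L11. g' x = g i x"
      using wd[OF i] by blast
    note [measurable] = he(1) g(1)[OF i] smooth_borel_measurable[OF test_fun_smooth[OF \<phi>]]
      smooth_borel_measurable[OF smooth_funpow_deriv[OF test_fun_smooth[OF \<phi>]]]
    have "(LINT x:{-1..1}|lebesgue. f \<bar>x\<bar> * (deriv ^^ i) \<phi> x) = (\<integral>x. he x * (deriv ^^ i) \<phi> x \<partial>L11)"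
      using hae by (intro set_integral_representative) (auto elim!: eventually_mono)
    moreover have "(LINT x:{-1..1}|lebesgue. g' x * \<phi> x) = (\<integral>x. g i x * \<phi> x \<partial>L11)"
      using g'(2) by (intro set_integral_representative) (auto elim!: eventually_mono)
    ultimately show ?thesis using g'(1) \<phi> unfolding has_weak_deriv_def by metis
  qed
  have even: "he (- x) = he x" for x by (simp add: he_def)
  \<comment> \<open>Testing with the reflected \<phi> shows that x \<mapsto> - g 1 (- x) is also a
    weak derivative of the even function \<open>he\<close>; \<open>go\<close> is the mean of the
    two.\<close>
  have base1: "(\<integral>x. he x * deriv \<phi> x \<partial>L11) = - (\<integral>x. go x * \<phi> x \<partial>L11)"
    if \<phi>: "test_fun (-1) 1 \<phi>" for \<phi>
  proof -
    have sq: "sq_integrable (L11) \<phi>" "sq_integrable (L11) (\<lambda>x. \<phi> (- x))"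
      using smooth_continuous_on test_fun_smooth[OF \<phi>] test_fun_smooth[OF test_fun_reflect[OF \<phi>]]
      by (auto intro: continuous_sq_integrable)
    have gsq: "sq_integrable (L11) (g 1)" "sq_integrable (L11) (\<lambda>x. g 1 (- x))"
      by (intro g r sq_integrable_reflect)+
    have "(\<integral>x. g 1 (- x) * \<phi> x \<partial>L11) = (\<integral>x. g 1 x * \<phi> (- x) \<partial>L11)"
      using integral_leb_on_reflect[of "\<lambda>x. g 1 x * \<phi> (- x)"] by simp
    also have "\<dots> = - (\<integral>x. he x * deriv (\<lambda>x. \<phi> (- x)) x \<partial>L11)"
      using base[OF r test_fun_reflect[OF \<phi>]] by simp
    also have "\<dots> = (\<integral>x. he (- x) * deriv \<phi> (- x) \<partial>L11)"
      by (simp add: deriv_reflect[OF test_fun_smooth[OF \<phi>]] even)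
    also have "\<dots> = (\<integral>x. he x * deriv \<phi> x \<partial>L11)"
      by (rule integral_leb_on_reflect[of "\<lambda>x. he x * deriv \<phi> x"])
    finally have 1: "(\<integral>x. g 1 (- x) * \<phi> x \<partial>L11) = (\<integral>x. he x * deriv \<phi> x \<partial>L11)" .
    have "(\<integral>x. go x * \<phi> x \<partial>L11) =
      (\<integral>x. (1 / 2) * (g 1 x * \<phi> x) - (1 / 2) * (g 1 (- x) * \<phi> x) \<partial>L11)"
      by (simp add: go_def left_diff_distrib)
    also have "\<dots> = (1 / 2) * (\<integral>x. g 1 x * \<phi> x \<partial>L11) - (1 / 2) * (\<integral>x. g 1 (- x) * \<phi> x \<partial>L11)"
      using sq_integrable_mult_integrable[OF gsq(1) sq(1)] sq_integrable_mult_integrable[OF gsq(2) sq(1)]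
      by simp
    finally show ?thesis using 1 base[OF r \<phi>] by simp
  qed
  show ?thesis
  proof (rule that[of H])
    show "H i \<in> borel_funs" if "i \<le> r" for i using that he go g by (auto simp: H_def)
    show "sq_integrable (L11) (H i)" if "i \<le> r" for i using that he go g by (auto simp: H_def)
    show "(\<integral>x. H 0 x * (deriv ^^ i) \<phi> x \<partial>L11) = (-1) ^ i * (\<integral>x. H i x * \<phi> x \<partial>L11)"
      if "i \<le> r" "test_fun (-1) 1 \<phi>" for i \<phi>
      using base[OF that] base1[OF that(2)] by (cases "i = 0"; cases "i = 1") (auto simp: H_def)
    show "H 0 (- x) = H 0 x" "H 1 (- x) = - H 1 x" for x by (auto simp: H_def he_def go_def)
    have "AE x in L01. f \<bar>x\<bar> = he x" using hae by (rule AE_leb_on_subset) auto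
    then show "AE x in L01. f x = H 0 x"
      using AE_space by eventually_elim (auto simp: H_def space_leb_on)
  qed
qed


text \<open>Parity at every point is demanded of \<open>H 0\<close> and \<open>H 1\<close> alone:
  just the cutoff function and its first derivative are transferred between [0,1] and [-1,1]. The
  higher entries enter through the r-th derivative of the cutoff function, which is estimated
  directly on [-1,1].\<close>

locale even_jet =
  fixes H :: "nat \<Rightarrow> real \<Rightarrow> real" and r :: nat
  assumes r: "r \<ge> 1"
    and H_measurable: "\<And>i. i \<le> r \<Longrightarrow> H i \<in> borel_funs"
    and H_sq_integrable: "\<And>i. i \<le> r \<Longrightarrow> sq_integrable (L11) (H i)"
    and H_weak_deriv: "\<And>i \<phi>. i \<le> r \<Longrightarrow> test_fun (-1) 1 \<phi> \<Longrightarrow>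
       (\<integral>x. H 0 x * (deriv ^^ i) \<phi> x \<partial>L11) = (-1) ^ i * (\<integral>x. H i x * \<phi> x \<partial>L11)"
    and H_even: "\<And>x. H 0 (- x) = H 0 x"
    and H_odd: "\<And>x. H 1 (- x) = - H 1 x"
begin

text \<open>\<open>leibniz \<theta> n i\<close> is the \<open>n\<close>-th weak derivative of \<open>H i \<cdot> \<theta>\<close>.\<close>

fun leibniz :: "(real \<Rightarrow> real) \<Rightarrow> nat \<Rightarrow> nat \<Rightarrow> real \<Rightarrow> real" where
  "leibniz \<theta> 0 i x = \<theta> x * H i x"
| "leibniz \<theta> (Suc n) i x = leibniz \<theta> n (Suc i) x + leibniz (deriv \<theta>) n i x"

lemma smooth_mult_sq_integrable:
  assumes "smooth \<psi>" "sq_integrable (leb_on a b) u"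
  shows "sq_integrable (leb_on a b) (\<lambda>x. \<psi> x * u x)"
proof -
  have "bounded (\<psi> ` {a..b})"
    by (intro compact_imp_bounded compact_continuous_image smooth_continuous_on assms) auto
  then obtain C where "\<forall>x\<in>{a..b}. \<bar>\<psi> x\<bar> \<le> C" by (auto simp: bounded_iff)
  then show ?thesis
    using assms(2) measurable_leb_on[OF smooth_borel_measurable[OF assms(1)]]
    by (intro sq_integrable_bounded_mult) (auto simp: space_leb_on)
qed

lemma leibniz_regular:
  assumes "test_fun (-1) 1 \<theta>" "n + i \<le> r"
  shows "leibniz \<theta> n i \<in> borel_funs \<and> sq_integrable (L11) (leibniz \<theta> n i)"
  using assms
proof (induction n arbitrary: \<theta> i)
  case 0
  then show ?case
    using smooth_borel_measurable[OF test_fun_smooth[OF 0(1)]] H_measurable[of i]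
      smooth_mult_sq_integrable[OF test_fun_smooth[OF 0(1)] H_sq_integrable[of i]]
    by (simp add: leibniz.simps[abs_def] del: leibniz.simps)
next
  case (Suc n)
  have "leibniz \<theta> (Suc n) i = (\<lambda>x. leibniz \<theta> n (Suc i) x + leibniz (deriv \<theta>) n i x)"
    by (simp add: fun_eq_iff)
  then show ?case
    using Suc.IH[of \<theta> "Suc i"] Suc.IH[of "deriv \<theta>" i] Suc.prems test_fun_deriv[OF Suc.prems(1)]
    by (auto intro: sq_integrable_add)
qed

text \<open>\<psi> is merely smooth, since it will be a cosine; boundary terms disappear because
  \<theta> \<psi> is a test function.\<close>

lemma jet_parts:
  assumes i: "i < r" and \<theta>: "test_fun (-1) 1 \<theta>" and \<psi>: "smooth \<psi>"
  shows "(\<integral>x. \<theta> x * H i x * deriv \<psi> x \<partial>L11) =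
    - (\<integral>x. (\<theta> x * H (Suc i) x + deriv \<theta> x * H i x) * \<psi> x \<partial>L11)"
proof -
  have s: "smooth \<theta>" "smooth (deriv \<theta>)" "smooth (deriv \<psi>)"
    using test_fun_smooth[OF \<theta>] \<psi> smooth_deriv by auto
  define \<phi> where "\<phi> x = \<theta> x * \<psi> x" for x
  have \<phi>: "test_fun (-1) 1 \<phi>" unfolding \<phi>_def by (intro test_fun_mult \<theta> \<psi>) auto
  have d: "deriv \<phi> = (\<lambda>x. \<theta> x * deriv \<psi> x + deriv \<theta> x * \<psi> x)"
    unfolding \<phi>_def using smooth_has_deriv[OF s(1)] smooth_has_deriv[OF \<psi>]
    by (intro ext DERIV_imp_deriv) (auto intro!: derivative_eq_intros)
  \<comment> \<open>The assumptions relate each entry to \<open>H 0\<close> only. Reading the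
    derivative of order i+1 of \<phi> as the i-th derivative of \<open>deriv \<phi>\<close> links
    the entries i and i+1.\<close>
  have "(-1) ^ i * (\<integral>x. H i x * deriv \<phi> x \<partial>L11) = (\<integral>x. H 0 x * (deriv ^^ Suc i) \<phi> x \<partial>L11)"
    using H_weak_deriv[of i "deriv \<phi>"] i test_fun_deriv[OF \<phi>] by (simp add: funpow_swap1)
  also have "\<dots> = (-1) ^ Suc i * (\<integral>x. H (Suc i) x * \<phi> x \<partial>L11)"
    using i by (intro H_weak_deriv \<phi>) auto
  finally have "(-1) ^ i * (\<integral>x. H i x * deriv \<phi> x \<partial>L11) =
      (-1) ^ i * (- (\<integral>x. H (Suc i) x * \<phi> x \<partial>L11))" by simp
  then have eq: "(\<integral>x. H i x * deriv \<phi> x \<partial>L11) = - (\<integral>x. H (Suc i) x * \<phi> x \<partial>L11)"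
    by (subst (asm) mult_cancel_left) simp
  have int: "integrable (L11) (\<lambda>x. \<alpha> x * H j x * \<beta> x)" if "smooth \<alpha>" "smooth \<beta>" "j \<le> r" for \<alpha> \<beta> j
    using that by (intro sq_integrable_mult_integrable smooth_mult_sq_integrable
       H_sq_integrable continuous_sq_integrable smooth_continuous_on)
  have "(\<integral>x. H i x * deriv \<phi> x \<partial>L11) =
      (\<integral>x. \<theta> x * H i x * deriv \<psi> x + deriv \<theta> x * H i x * \<psi> x \<partial>L11)"
    unfolding d by (simp add: algebra_simps)
  also have "\<dots> = (\<integral>x. \<theta> x * H i x * deriv \<psi> x \<partial>L11) + (\<integral>x. deriv \<theta> x * H i x * \<psi> x \<partial>L11)"
    using i s \<psi> by (intro Bochner_Integration.integral_add int) auto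
  finally have 1: "(\<integral>x. \<theta> x * H i x * deriv \<psi> x \<partial>L11) + (\<integral>x. deriv \<theta> x * H i x * \<psi> x \<partial>L11)
     = - (\<integral>x. \<theta> x * H (Suc i) x * \<psi> x \<partial>L11)"
    using eq by (simp add: \<phi>_def mult_ac)
  have "(\<integral>x. (\<theta> x * H (Suc i) x + deriv \<theta> x * H i x) * \<psi> x \<partial>L11) =
    (\<integral>x. \<theta> x * H (Suc i) x * \<psi> x \<partial>L11) + (\<integral>x. deriv \<theta> x * H i x * \<psi> x \<partial>L11)"
    unfolding distrib_right using i s \<psi> by (intro Bochner_Integration.integral_add int) auto
  then show ?thesis using 1 by simp
qed

text \<open>Each integration by parts splits the product of \<theta> and \<open>H i\<close> into the
  two terms of the product rule, and the recursion of \<open>leibniz\<close> repeats exactly this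
  split, so no binomial coefficients appear.\<close>

lemma leibniz_parts:
  assumes "n + i \<le> r" "test_fun (-1) 1 \<theta>" "smooth \<psi>"
  shows "(\<integral>x. \<theta> x * H i x * (deriv ^^ n) \<psi> x \<partial>L11) =
    (-1) ^ n * (\<integral>x. leibniz \<theta> n i x * \<psi> x \<partial>L11)"
  using assms
proof (induction n arbitrary: \<theta> i)
  case 0
  then show ?case by simp
next
  case (Suc n)
  define \<psi>n where "\<psi>n = (deriv ^^ n) \<psi>"
  have s: "smooth \<psi>n" unfolding \<psi>n_def by (rule smooth_funpow_deriv[OF Suc.prems(3)])
  have \<theta>s: "smooth \<theta>" "smooth (deriv \<theta>)" using test_fun_smooth[OF Suc.prems(2)] smooth_deriv by auto
  have int: "integrable (L11) (\<lambda>x. \<alpha> x * H j x * \<psi>n x)" if "smooth \<alpha>" "j \<le> r" for \<alpha> j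
    using that s by (intro sq_integrable_mult_integrable smooth_mult_sq_integrable
       H_sq_integrable continuous_sq_integrable smooth_continuous_on)
  have li: "integrable (L11) (\<lambda>x. leibniz \<alpha> n j x * \<psi> x)" if "test_fun (-1) 1 \<alpha>" "n + j \<le> r" for \<alpha> j
    using leibniz_regular[OF that] smooth_continuous_on[OF Suc.prems(3)]
    by (blast intro: sq_integrable_mult_integrable continuous_sq_integrable)
  have "(\<integral>x. \<theta> x * H i x * (deriv ^^ Suc n) \<psi> x \<partial>L11) =
    - (\<integral>x. (\<theta> x * H (Suc i) x + deriv \<theta> x * H i x) * \<psi>n x \<partial>L11)"
    using jet_parts[of i \<theta> \<psi>n] Suc.prems s by (simp add: \<psi>n_def)
  also have "\<dots> = - ((\<integral>x. \<theta> x * H (Suc i) x * \<psi>n x \<partial>L11) + (\<integral>x. deriv \<theta> x * H i x * \<psi>n x \<partial>L11))"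
    unfolding distrib_right using Suc.prems(1) \<theta>s
    by (subst Bochner_Integration.integral_add) (auto intro: int)
  also have "\<dots> = - ((-1) ^ n * (\<integral>x. leibniz \<theta> n (Suc i) x * \<psi> x \<partial>L11)
      + (-1) ^ n * (\<integral>x. leibniz (deriv \<theta>) n i x * \<psi> x \<partial>L11))"
    using Suc.IH[of "Suc i" \<theta>] Suc.IH[of i "deriv \<theta>"] Suc.prems test_fun_deriv[OF Suc.prems(2)]
    by (simp add: \<psi>n_def)
  also have "\<dots> = (-1) ^ Suc n * (\<integral>x. leibniz \<theta> n (Suc i) x * \<psi> x + leibniz (deriv \<theta>) n i x * \<psi> x \<partial>L11)"
    by (subst Bochner_Integration.integral_add[OF li li])
       (use Suc.prems test_fun_deriv[OF Suc.prems(2)] in \<open>auto simp: algebra_simps\<close>)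
  finally show ?case by (simp add: distrib_right)
qed

text \<open>The recursion unfolds into 2^n products of a derivative of \<theta> with an entry of the
  jet. Bounding each by A times the sum of all entries is crude, but later only the power of eps
  inside A matters.\<close>

lemma leibniz_bound:
  assumes "n + i \<le> r" "\<And>j. j \<le> n \<Longrightarrow> \<bar>(deriv ^^ j) \<theta> x\<bar> \<le> A"
  shows "\<bar>leibniz \<theta> n i x\<bar> \<le> 2 ^ n * A * (\<Sum>l\<le>r. \<bar>H l x\<bar>)"
  using assms
proof (induction n arbitrary: \<theta> i)
  case 0
  have "\<bar>H i x\<bar> \<le> (\<Sum>l\<le>r. \<bar>H l x\<bar>)" using 0 by (intro member_le_sum) auto
  moreover have "\<bar>\<theta> x\<bar> \<le> A" using 0(2)[of 0] by simp
  ultimately show ?case by (auto simp: abs_mult intro: mult_mono)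
next
  case (Suc n)
  have "\<bar>leibniz \<theta> n (Suc i) x\<bar> \<le> 2 ^ n * A * (\<Sum>l\<le>r. \<bar>H l x\<bar>)"
    by (rule Suc.IH) (use Suc.prems in auto)
  moreover have "\<bar>leibniz (deriv \<theta>) n i x\<bar> \<le> 2 ^ n * A * (\<Sum>l\<le>r. \<bar>H l x\<bar>)"
  proof (rule Suc.IH)
    show "\<bar>(deriv ^^ j) (deriv \<theta>) x\<bar> \<le> A" if "j \<le> n" for j
      using Suc.prems(2)[of "Suc j"] that by (simp add: funpow_swap1)
  qed (use Suc.prems in auto)
  ultimately show ?case by (simp add: abs_triangle_ineq[THEN order_trans])
qed

end

text \<open>In the tail pi k is at least K, so 2m of the 2r powers of pi k can be traded for K^(2m).
  The choice m = r serves the function itself, m = r - 1 its derivative.\<close>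

lemma sum_power_weighted_le:
  fixes c :: "nat \<Rightarrow> real"
  assumes T: "finite T" "\<And>k. k \<in> T \<Longrightarrow> K \<le> k" and K: "K \<ge> 1" and m: "m \<le> r"
    and B: "(\<Sum>k\<in>T. (pi * real k) ^ (2 * r) * (c k)^2) \<le> B"
  shows "(\<Sum>k\<in>T. (pi * real k) ^ (2 * (r - m)) * (c k)^2) \<le> B / real K ^ (2 * m)"
proof -
  have "real K ^ (2 * m) * (\<Sum>k\<in>T. (pi * real k) ^ (2 * (r - m)) * (c k)^2) =
    (\<Sum>k\<in>T. real K ^ (2 * m) * ((pi * real k) ^ (2 * (r - m)) * (c k)^2))" by (simp add: sum_distrib_left)
  also have "\<dots> \<le> (\<Sum>k\<in>T. (pi * real k) ^ (2 * r) * (c k)^2)"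
  proof (rule sum_mono)
    fix k assume "k \<in> T"
    have "real K \<le> pi * real k"
      using T(2)[OF \<open>k \<in> T\<close>] pi_ge_two mult_mono[of 1 pi "real K" "real k"] by simp
    then have "real K ^ (2 * m) * (pi * real k) ^ (2 * (r - m)) \<le> (pi * real k) ^ (2 * m) * (pi * real k) ^ (2 * (r - m))"
      by (intro mult_right_mono power_mono) auto
    also have "\<dots> = (pi * real k) ^ (2 * r)"
      using m by (simp add: power_add[symmetric] distrib_left[symmetric] del: power_mult_distrib)
    finally show "real K ^ (2 * m) * ((pi * real k) ^ (2 * (r - m)) * (c k)^2) \<le> (pi * real k) ^ (2 * r) * (c k)^2"
      by (simp add: mult.assoc[symmetric] mult_right_mono)
  qed
  finally have "real K ^ (2 * m) * (\<Sum>k\<in>T. (pi * real k) ^ (2 * (r - m)) * (c k)^2) \<le> B"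
    using B by simp
  then show ?thesis using K by (simp add: field_simps)
qed

context even_jet
begin

text \<open>One coefficient vector must serve both norms. Integration by parts gives -pi k c k as
  the sine coefficients of the derivative, so differentiating the cosine partial sum produces the
  sine partial sum of the derivative. Both tails are controlled by the same weighted sum of squares,
  bounded by \<open>B\<close> through Bessel's inequality for the r-th derivative.\<close>

lemma cutoff_cos_approx:
  assumes \<theta>: "test_fun (-1) 1 \<theta>" and \<theta>_even: "\<And>x. \<theta> (- x) = \<theta> x" and K: "K \<ge> 1"
  defines "B \<equiv> \<integral>x. (leibniz \<theta> r 0 x)^2 \<partial>L11"
  obtains c where "c \<in> coeff_vectors K"
    "(\<integral>x. (\<theta> x * H 0 x - cos_sum K c x)^2 \<partial>L01) \<le> B / real K ^ (2 * r)"
    "(\<integral>x. (leibniz \<theta> 1 0 x - (\<Sum>k<K. - (pi * real k * c k) * sin_system k x))^2 \<partial>L01)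
       \<le> B / real K ^ (2 * (r - 1))"
proof -
  define c where "c k = (\<integral>x. (\<theta> x * H 0 x) * cos_system k x \<partial>L01)" for k
  define d where "d k = (\<integral>x. leibniz \<theta> 1 0 x * sin_system k x \<partial>L01)" for k
  have s: "smooth \<theta>" using test_fun_smooth[OF \<theta>] .
  have G0: "(\<lambda>x. \<theta> x * H 0 x) \<in> borel_funs" "sq_integrable (L11) (\<lambda>x. \<theta> x * H 0 x)"
    using leibniz_regular[OF \<theta>, of 0 0] by (auto simp: leibniz.simps[abs_def])
  have G1: "leibniz \<theta> 1 0 \<in> borel_funs" "sq_integrable (L11) (leibniz \<theta> 1 0)"
    using leibniz_regular[OF \<theta>, of 1 0] r by auto
  have Gr: "sq_integrable (L11) (leibniz \<theta> r 0)"
    using leibniz_regular[OF \<theta>, of r 0] by auto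
  have G0': "sq_integrable (L01) (\<lambda>x. \<theta> x * H 0 x)"
    and G1': "sq_integrable (L01) (leibniz \<theta> 1 0)"
    using sq_integrable_leb_on_subset[OF G0(2,1), of 0 1] sq_integrable_leb_on_subset[OF G1(2,1), of 0 1]
    by auto
  have \<theta>_odd: "deriv \<theta> (- x) = - deriv \<theta> x" for x
  proof -
    have "(\<lambda>x. \<theta> (- x)) = \<theta>" using \<theta>_even by auto
    then show ?thesis using fun_cong[OF deriv_reflect[OF s], of "- x"] by simp
  qed
  have bs: "cos_system k \<in> borel_funs" "sin_system k \<in> borel_funs" for k
    unfolding cos_system_def sin_system_def by (auto intro!: borel_measurable_continuous_onI continuous_intros)
  have sq: "sq_integrable (leb_on a b) (cos_system k)" "sq_integrable (leb_on a b) (sin_system k)" for k a b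
    unfolding cos_system_def sin_system_def
    by (cases "k = 0"; intro continuous_sq_integrable; auto intro!: continuous_intros)+
  have par: "cos_system k (- x) = cos_system k x" "sin_system k (- x) = - sin_system k x"
    "leibniz \<theta> 1 0 (- x) = - leibniz \<theta> 1 0 x" for k x
    using H_odd[of x] by (auto simp: cos_system_def sin_system_def \<theta>_even H_even \<theta>_odd)
  have c2: "c k = (1 / 2) * (\<integral>x. (\<theta> x * H 0 x) * cos_system k x \<partial>L11)" for k
    unfolding c_def using bs G0
    by (subst integral_leb_on_even) (auto intro: sq_integrable_mult_integrable sq simp: \<theta>_even H_even par)
  have d2: "d k = (1 / 2) * (\<integral>x. leibniz \<theta> 1 0 x * sin_system k x \<partial>L11)" for k
    unfolding d_def using bs G1
    by (subst integral_leb_on_even)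
       (auto intro: sq_integrable_mult_integrable sq simp: par simp del: One_nat_def leibniz.simps)
  have dc: "d k = - (pi * real k * c k)" for k
  proof (cases "k = 0")
    case True
    then show ?thesis by (simp add: d_def sin_system_def)
  next
    case False
    have sc: "sin_system k = (\<lambda>x. sqrt 2 * cos (pi * real k * x + (- pi / 2)))"
      by (simp add: sin_system_def fun_eq_iff cos_diff)
    have sm: "smooth (sin_system k)" unfolding sc by (rule smooth_cos)
    have "deriv (sin_system k) = (\<lambda>x. pi * real k * cos_system k x)"
      using False unfolding sin_system_def cos_system_def
      by (intro ext DERIV_imp_deriv) (auto intro!: derivative_eq_intros)
    then show ?thesis
      using leibniz_parts[of 1 0 \<theta> "sin_system k"] r \<theta> sm unfolding c2 d2
      by (simp add: mult_ac)
  qed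
  have coeff: "(pi * real k) ^ (2 * r) * (c k)^2 =
      (1 / 2) * (\<integral>x. leibniz \<theta> r 0 x * cos (pi * real k * x - real r * (pi / 2)) \<partial>L11)^2" if "k \<ge> 1" for k
  proof -
    \<comment> \<open>The phase -r (pi/2) is chosen so that the r-th derivative of \<psi> is (pi
      k)^r cos(pi k x), which reproduces the cosine coefficient.\<close>
    define \<psi> where "\<psi> x = cos (pi * real k * x + (- (real r * (pi / 2))))" for x
    have sm: "smooth \<psi>" unfolding \<psi>_def
      using smooth_cos[of 1 "pi * real k" "- (real r * (pi / 2))"] by (simp only: mult_1_left)
    have "(deriv ^^ r) \<psi> = (\<lambda>x. (pi * real k) ^ r * cos (pi * real k * x))"
      unfolding \<psi>_def funpow_deriv_cos by simp
    then have "(pi * real k) ^ r * (\<integral>x. \<theta> x * H 0 x * cos (pi * real k * x) \<partial>L11) =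
      (-1) ^ r * (\<integral>x. leibniz \<theta> r 0 x * \<psi> x \<partial>L11)"
      using leibniz_parts[of r 0 \<theta> \<psi>] \<theta> sm by (simp add: mult.left_commute[of _ "(pi * real k) ^ r"])
    moreover have "c k = (sqrt 2 / 2) * (\<integral>x. \<theta> x * H 0 x * cos (pi * real k * x) \<partial>L11)"
      using that unfolding c2 cos_system_def by (simp add: mult.left_commute[of _ "sqrt 2"])
    ultimately have "(pi * real k) ^ r * c k = (sqrt 2 / 2) * ((-1) ^ r * (\<integral>x. leibniz \<theta> r 0 x * \<psi> x \<partial>L11))"
      by (simp only: mult.left_commute[of "(pi * real k) ^ r" "sqrt 2 / 2"])
    then have "((pi * real k) ^ r * c k)^2 = ((sqrt 2 / 2) * ((-1) ^ r * (\<integral>x. leibniz \<theta> r 0 x * \<psi> x \<partial>L11)))^2"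
      by (simp only:)
    also have "\<dots> = (1 / 2) * (\<integral>x. leibniz \<theta> r 0 x * \<psi> x \<partial>L11)^2"
      by (simp add: power_mult_distrib power_divide power_mult[symmetric])
    also have "((pi * real k) ^ r * c k)^2 = (pi * real k) ^ (2 * r) * (c k)^2"
      by (simp add: power_mult_distrib power_mult[symmetric] mult.commute)
    finally show ?thesis by (simp add: \<psi>_def)
  qed
  have B0: "B \<ge> 0" unfolding B_def by simp
  have bes: "(\<Sum>k\<in>T. (pi * real k) ^ (2 * r) * (c k)^2) \<le> B" if T: "finite T" "\<And>k. k \<in> T \<Longrightarrow> K \<le> k" for T
  proof -
    have T1: "k \<ge> 1" if "k \<in> T" for k using T(2)[OF that] K by simp
    have "(\<Sum>k\<in>T. (pi * real k) ^ (2 * r) * (c k)^2) =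
      (1 / 2) * (\<Sum>k\<in>T. (\<integral>x. leibniz \<theta> r 0 x * cos (pi * real k * x - real r * (pi / 2)) \<partial>L11)^2)"
      unfolding sum_distrib_left by (intro sum.cong coeff T1 refl)
    also have "(\<Sum>k\<in>T. (\<integral>x. leibniz \<theta> r 0 x * cos (pi * real k * x - real r * (pi / 2)) \<partial>L11)^2) \<le> B"
      unfolding B_def using T1
      by (intro bessel T Gr shifted_cos_orthonormal continuous_sq_integrable continuous_intros) auto
    finally show ?thesis using B0 by simp
  qed
  have "(\<integral>x. (\<theta> x * H 0 x - (\<Sum>k<K. c k * cos_system k x))^2 \<partial>L01) \<le> B / real K ^ (2 * r)"
    unfolding c_def
  proof (rule fourier_remainder_le[where A = UNIV])
    show "\<exists>S a. finite S \<and> S \<subseteq> UNIV \<and> (\<integral>x. (\<theta> x * H 0 x - (\<Sum>k\<in>S. a k * cos_system k x))^2 \<partial>L01) < \<delta>"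
      if "\<delta> > 0" for \<delta> using cos_system_total[OF G0' G0(1) that] .
    fix T :: "nat set" assume T: "finite T" "T \<subseteq> UNIV - {..<K}"
    then have T2: "\<And>k. k \<in> T \<Longrightarrow> K \<le> k" by auto
    show "(\<Sum>k\<in>T. (\<integral>x. (\<theta> x * H 0 x) * cos_system k x \<partial>L01)^2) \<le> B / real K ^ (2 * r)"
      using sum_power_weighted_le[OF T(1) T2 K order_refl bes[OF T(1) T2]] unfolding c_def by simp
  qed (use G0' sq cos_system_orthonormal in auto)
  moreover have "(\<integral>x. (leibniz \<theta> 1 0 x - (\<Sum>k\<in>{1..<K}. d k * sin_system k x))^2 \<partial>L01) \<le> B / real K ^ (2 * (r - 1))"
    unfolding d_def
  proof (rule fourier_remainder_le[where A = "{1..}"])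
    show "\<exists>S a. finite S \<and> S \<subseteq> {1..} \<and> (\<integral>x. (leibniz \<theta> 1 0 x - (\<Sum>k\<in>S. a k * sin_system k x))^2 \<partial>L01) < \<delta>"
      if "\<delta> > 0" for \<delta> using sin_system_total[OF G1' G1(1) that] .
    fix T :: "nat set" assume T: "finite T" "T \<subseteq> {1..} - {1..<K}"
    then have T2: "\<And>k. k \<in> T \<Longrightarrow> K \<le> k" by auto
    \<comment> \<open>With m = r - 1 the weight left over is (pi k)^2, and (pi k c k)^2 is the
      square of \<open>d k\<close>.\<close>
    have "(\<Sum>k\<in>T. (pi * real k) ^ (2 * (r - (r - 1))) * (c k)^2) \<le> B / real K ^ (2 * (r - 1))"
      by (rule sum_power_weighted_le[OF T(1) T2 K _ bes[OF T(1) T2]]) auto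
    moreover have "r - (r - 1) = 1" using r by simp
    ultimately show "(\<Sum>k\<in>T. (\<integral>x. leibniz \<theta> 1 0 x * sin_system k x \<partial>L01)^2) \<le> B / real K ^ (2 * (r - 1))"
      unfolding d_def[symmetric] dc by (simp add: power_mult_distrib)
  qed (use G1' sq sin_system_orthonormal in \<open>auto simp del: leibniz.simps One_nat_def\<close>)
  moreover have "(\<Sum>k\<in>{1..<K}. d k * sin_system k x) = (\<Sum>k<K. - (pi * real k * c k) * sin_system k x)" for x
    unfolding dc by (intro sum.mono_neutral_left) (auto simp: Suc_le_eq)
  ultimately show ?thesis
    by (intro that[of "\<lambda>k. if k < K then c k else 0"]) (auto simp: coeff_vectors_def cos_sum_def)
qed

end


section \<open>The slicing operator\<close>

text \<open>The counterpart of \<open>slicing\<close> over the Borel measure, with the weight as a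
  parameter because differentiation in s replaces the weight w(t) by t w(t).\<close>

definition slice :: "(real \<Rightarrow> real) \<Rightarrow> (real \<Rightarrow> real) \<Rightarrow> real \<Rightarrow> real" where
  "slice w u s = (\<integral>t. u (t * s) * w t \<partial>L01)"

lemma sigma_finite_leb_on: "sigma_finite_measure (leb_on a b)"
  using finite_measure.axioms(1)[OF leb_on_finite_measure] .

lemma pair_leb_on: "pair_sigma_finite (leb_on a b) (leb_on c d)"
  unfolding pair_sigma_finite_def
  using sigma_finite_leb_on by blast

lemma measurable_leb_on_pair:
  assumes "case_prod f \<in> borel_measurable (borel \<Otimes>\<^sub>M borel)"
  shows "case_prod f \<in> borel_measurable (leb_on a b \<Otimes>\<^sub>M leb_on c d)"
proof -
  have "(\<lambda>p. (fst p, snd p)) \<in> leb_on a b \<Otimes>\<^sub>M leb_on c d \<rightarrow>\<^sub>M borel \<Otimes>\<^sub>M borel"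
    by (intro measurable_Pair measurable_compose[OF measurable_fst] measurable_compose[OF measurable_snd] measurable_leb_on) auto
  from measurable_compose[OF this assms] show ?thesis by (simp add: split_beta')
qed

lemma nn_integral_leb_on: "(\<integral>\<^sup>+x. f x \<partial>leb_on a b) = (\<integral>\<^sup>+x. f x * indicator {a..b} x \<partial>lborel)"
  by (rule nn_integral_restrict_space) auto

text \<open>The substitution x = t s maps [0,1] onto [0,t]; the inequality only discards
  (t,1].\<close>

lemma nn_integral_dilate_le:
  fixes f :: "real \<Rightarrow> ennreal"
  assumes f: "f \<in> borel_funs" and t: "0 < t" "t \<le> 1"
  shows "(\<integral>\<^sup>+s. f (t * s) \<partial>L01) \<le> ennreal (1 / t) * (\<integral>\<^sup>+x. f x \<partial>L01)"
proof -
  have "ennreal t * (\<integral>\<^sup>+s. f (t * s) \<partial>L01) =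
      ennreal \<bar>t\<bar> * (\<integral>\<^sup>+s. f (0 + t * s) * indicator {0..t} (0 + t * s) \<partial>lborel)"
    unfolding nn_integral_leb_on using t
    by (auto simp: indicator_def mult_le_cancel_left1 zero_le_mult_iff intro!: arg_cong2[where f = "(*)"] nn_integral_cong)
  also have "\<dots> = (\<integral>\<^sup>+x. f x * indicator {0..t} x \<partial>lborel)"
    using f t by (intro nn_integral_real_affine[symmetric]) auto
  also have "\<dots> \<le> (\<integral>\<^sup>+x. f x \<partial>L01)"
    unfolding nn_integral_leb_on using t by (intro nn_integral_mono) (auto simp: indicator_def)
  finally have "ennreal (1 / t) * (ennreal t * (\<integral>\<^sup>+s. f (t * s) \<partial>L01)) \<le> ennreal (1 / t) * (\<integral>\<^sup>+x. f x \<partial>L01)"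
    by (rule mult_left_mono) simp
  then show ?thesis using t by (simp add: mult.assoc[symmetric] ennreal_mult'[symmetric])
qed

lemma dilate_integrable:
  assumes u: "u \<in> borel_funs" "integrable (L01) u" and s: "0 < s" "s \<le> 1"
    and w: "w \<in> borel_funs" "\<And>t. t \<in> {0..1} \<Longrightarrow> \<bar>w t\<bar> \<le> M"
  shows "integrable (L01) (\<lambda>t. u (t * s) * w t)"
    and "(\<integral>t. \<bar>u (t * s) * w t\<bar> \<partial>L01) \<le> M / s * (\<integral>x. \<bar>u x\<bar> \<partial>L01)"
proof -
  note [measurable] = u(1) w(1)
  have M: "M \<ge> 0" using w(2)[of 0] by auto
  have "(\<integral>\<^sup>+t. ennreal \<bar>u (t * s) * w t\<bar> \<partial>L01) \<le> (\<integral>\<^sup>+t. ennreal M * ennreal \<bar>u (s * t)\<bar> \<partial>L01)"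
  proof (rule nn_integral_mono)
    fix t assume "t \<in> space (L01)"
    then have "\<bar>w t\<bar> * \<bar>u (s * t)\<bar> \<le> M * \<bar>u (s * t)\<bar>"
      by (intro mult_right_mono w(2)) (auto simp: space_leb_on)
    then have "\<bar>u (t * s) * w t\<bar> \<le> M * \<bar>u (s * t)\<bar>" by (simp add: abs_mult mult.commute)
    then show "ennreal \<bar>u (t * s) * w t\<bar> \<le> ennreal M * ennreal \<bar>u (s * t)\<bar>"
      using M by (simp add: ennreal_mult'[symmetric] ennreal_leI)
  qed
  also have "\<dots> = ennreal M * (\<integral>\<^sup>+t. ennreal \<bar>u (s * t)\<bar> \<partial>L01)"
    using u(1) by (intro nn_integral_cmult measurable_leb_on) measurable
  also have "\<dots> \<le> ennreal M * (ennreal (1 / s) * (\<integral>\<^sup>+x. ennreal \<bar>u x\<bar> \<partial>L01))"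
    using u(1) s by (intro mult_left_mono nn_integral_dilate_le) auto
  also have "(\<integral>\<^sup>+x. ennreal \<bar>u x\<bar> \<partial>L01) = ennreal (\<integral>x. \<bar>u x\<bar> \<partial>L01)"
    using u(2) by (intro nn_integral_eq_integral) auto
  finally have le: "(\<integral>\<^sup>+t. ennreal \<bar>u (t * s) * w t\<bar> \<partial>L01) \<le> ennreal (M / s * (\<integral>x. \<bar>u x\<bar> \<partial>L01))"
    using M s by (simp add: ennreal_mult'[symmetric] mult.assoc[symmetric])
  show i: "integrable (L01) (\<lambda>t. u (t * s) * w t)"
    unfolding integrable_iff_bounded
  proof
    show "(\<lambda>t. u (t * s) * w t) \<in> borel_measurable (L01)"
      using u(1) w(1) by (intro measurable_leb_on) measurable
    show "(\<integral>\<^sup>+t. ennreal (norm (u (t * s) * w t)) \<partial>L01) < \<infinity>"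
      using le by (simp add: order_le_less_trans[OF _ ennreal_less_top])
  qed
  have "ennreal (\<integral>t. \<bar>u (t * s) * w t\<bar> \<partial>L01) = (\<integral>\<^sup>+t. ennreal \<bar>u (t * s) * w t\<bar> \<partial>L01)"
    using i by (intro nn_integral_eq_integral[symmetric]) auto
  with le have "ennreal (\<integral>t. \<bar>u (t * s) * w t\<bar> \<partial>L01) \<le> ennreal (M / s * (\<integral>x. \<bar>u x\<bar> \<partial>L01))"
    by simp
  then show "(\<integral>t. \<bar>u (t * s) * w t\<bar> \<partial>L01) \<le> M / s * (\<integral>x. \<bar>u x\<bar> \<partial>L01)"
    using M s by (subst (asm) ennreal_le_iff) auto
qed

lemma slice_measurable:
  assumes "u \<in> borel_funs" "w \<in> borel_funs"
  shows "slice w u \<in> borel_funs"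
proof -
  interpret sigma_finite_measure "L01"
    by (rule sigma_finite_leb_on)
  have "(\<lambda>p. u (snd p * fst p) * w (snd p)) \<in> borel_measurable (borel \<Otimes>\<^sub>M L01)"
  proof -
    have "(\<lambda>p. (fst p, snd p)) \<in> borel \<Otimes>\<^sub>M L01 \<rightarrow>\<^sub>M borel \<Otimes>\<^sub>M (borel :: real measure)"
      by (intro measurable_Pair measurable_compose[OF measurable_fst] measurable_compose[OF measurable_snd] measurable_leb_on) auto
    moreover have "(\<lambda>p. u (snd p * fst p) * w (snd p)) \<in> borel_measurable (borel \<Otimes>\<^sub>M borel)"
      using assms by measurable
    ultimately have "(\<lambda>p. u (snd (fst p, snd p) * fst (fst p, snd p)) * w (snd (fst p, snd p)))
        \<in> borel_measurable (borel \<Otimes>\<^sub>M L01)"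
      by (rule measurable_compose)
    then show ?thesis by simp
  qed
  then show ?thesis unfolding slice_def
    by (intro borel_measurable_lebesgue_integral) (simp add: split_beta')
qed

text \<open>For eps \<le> 1/2 the interval stays away from 0 and the integrand is at most 2. For
  larger eps the integral over all of [0,1] equals 2, which is below 4 eps; this is where the 4
  comes from.\<close>

lemma nn_integral_inverse_sqrt_le:
  assumes "0 < eps" "eps \<le> 1"
  shows "(\<integral>\<^sup>+t. ennreal (indicator {1 - eps..1} t * t powr (- (1 / 2))) \<partial>L01) \<le> ennreal (4 * eps)"
proof (cases "eps \<le> 1 / 2")
  case True
  have "indicator {1 - eps..1} t * t powr (- (1 / 2)) \<le> 4 * indicator {1 - eps..1} t" for t :: real
  proof (cases "t \<in> {1 - eps..1}")
    case t: True
    then have "t powr (- (1 / 2)) \<le> (1 / 4) powr (- (1 / 2))"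
      using True by (intro powr_mono2') auto
    also have "(1 / 4 :: real) powr (- (1 / 2)) = 2"
      by (simp add: powr_minus powr_half_sqrt real_sqrt_divide)
    finally show ?thesis using t by simp
  qed auto
  then have "(\<integral>\<^sup>+t. ennreal (indicator {1 - eps..1} t * t powr (- (1 / 2))) \<partial>L01) \<le>
      (\<integral>\<^sup>+t. ennreal 4 * indicator {1 - eps..1} t \<partial>L01)"
  proof (intro nn_integral_mono)
    fix t :: real
    have "ennreal 4 * indicator {1 - eps..1} t = ennreal (4 * indicator {1 - eps..1} t)"
      by (simp add: indicator_def)
    then show "ennreal (indicator {1 - eps..1} t * t powr (- (1 / 2))) \<le> ennreal 4 * indicator {1 - eps..1} t"
      using ennreal_leI[OF \<open>\<And>t. indicator {1 - eps..1} t * t powr (- (1 / 2)) \<le> 4 * indicator {1 - eps..1} t\<close>] by metis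
  qed
  also have "\<dots> = ennreal 4 * emeasure (L01) {1 - eps..1}"
    using assms by (intro nn_integral_cmult_indicator) (auto simp: sets_restrict_space_iff)
  also have "emeasure (L01) {1 - eps..1} = ennreal eps"
    using assms by (subst emeasure_restrict_space) auto
  finally show ?thesis using assms by (simp add: ennreal_mult')
next
  case False
  have "(\<integral>\<^sup>+t. ennreal (indicator {1 - eps..1} t * t powr (- (1 / 2))) \<partial>L01) \<le>
      (\<integral>\<^sup>+t. ennreal (t powr (- (1 / 2))) * indicator {0..1} t \<partial>lborel)"
    unfolding nn_integral_leb_on by (intro nn_integral_mono) (auto simp: indicator_def)
  also have "\<dots> = ennreal (1 powr (- (1 / 2) + 1) / (- (1 / 2) + 1))"
    by (intro nn_integral_has_integral_lebesgue' has_integral_powr_from_0) auto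
  also have "\<dots> \<le> ennreal (4 * eps)" using False by (intro ennreal_leI) simp
  finally show ?thesis .
qed

text \<open>The Cauchy--Schwarz inequality with weight \<open>t\<^sup>-\<^sup>1\<^sup>/\<^sup>2\<close> compensates the norm \<open>t\<^sup>-\<^sup>1\<^sup>/\<^sup>2\<close> of the dilation
  \<open>u \<mapsto> u(t \<cdot>)\<close> on \<open>L\<^sup>2\<close>.\<close>

lemma slice_bound:
  assumes u: "u \<in> borel_funs" "sq_integrable (L01) u"
    and w: "w \<in> borel_funs" "\<And>t. t \<in> {1 - eps..1} \<Longrightarrow> \<bar>w t\<bar> \<le> M"
    and eps: "0 < eps" "eps \<le> 1" and sup: "\<And>x. 0 \<le> x \<Longrightarrow> x < 1 - eps \<Longrightarrow> u x = 0"
  shows "sq_integrable (L01) (slice w u)"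
    and "sqnorm L01 (slice w u) \<le> (4 * M * eps)^2 * sqnorm L01 u"
proof -
  interpret pair_sigma_finite "L01" "L01" by (rule pair_leb_on)
  have M: "M \<ge> 0" using w(2)[of 1] eps by auto
  \<comment> \<open>For s \<le> 1 and t < 1 - eps also t s < 1 - eps, where \<open>u\<close>
    vanishes, so the integrand of the slice lives on the t selected by \<open>a\<close>. This is why
    a bound for \<open>w\<close> near 1 is enough.\<close>
  define a :: "real \<Rightarrow> real" where "a t = indicator {1 - eps..1} t" for t
  have a: "a t \<ge> 0" "a t * a t = a t" for t by (auto simp: a_def indicator_def)
  have am [measurable]: "a \<in> borel_funs" unfolding a_def by measurable
  note [measurable] = u(1) w(1)
  define A where "A = (\<integral>\<^sup>+t. ennreal (a t * t powr (- (1 / 2))) \<partial>L01)"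
  define U where "U = (\<integral>\<^sup>+x. ennreal ((u x)^2) \<partial>L01)"
  define g where "g s t = ennreal ((u (t * s))^2 * (a t * t powr (1 / 2)))" for s t
  have pos: "AE t in L01. 0 < t \<and> t \<le> (1::real)"
    unfolding AE_leb_on using AE_lborel_singleton[of "0::real"] by eventually_elim auto
  have A: "A \<le> ennreal (4 * eps)" unfolding A_def a_def by (rule nn_integral_inverse_sqrt_le[OF eps])
  have pointwise: "ennreal ((slice w u s)^2) \<le> ennreal (M^2) * A * (\<integral>\<^sup>+t. g s t \<partial>L01)"
    if s: "s \<in> {0..1}" for s
  proof -
    \<comment> \<open>The factors t^(-1/4) and t^(1/4) cancel in the product; their squares give the
      weight t^(-1/2) of \<open>A\<close> and the t^(1/2) in \<open>g\<close>.\<close>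
    define p where "p t = ennreal (a t * t powr (- (1 / 4)))" for t
    define q where "q t = ennreal (\<bar>u (t * s)\<bar> * (a t * t powr (1 / 4)))" for t
    have pq: "p \<in> borel_measurable (L01)" "q \<in> borel_measurable (L01)"
      unfolding p_def q_def by (intro measurable_leb_on; measurable)+
    have "ennreal \<bar>slice w u s\<bar> \<le> (\<integral>\<^sup>+t. ennreal \<bar>u (t * s) * w t\<bar> \<partial>L01)"
    proof (cases "integrable (L01) (\<lambda>t. u (t * s) * w t)")
      case True
      then show ?thesis using integral_norm_bound_ennreal[OF True] by (simp add: slice_def)
    next
      \<comment> \<open>Without integrability the Bochner integral is 0 by default, and the
        inequality is trivial.\<close>
      case False
      then show ?thesis by (simp add: slice_def not_integrable_integral_eq)
    qed
    also have "\<dots> \<le> (\<integral>\<^sup>+t. ennreal M * (p t * q t) \<partial>L01)"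
    proof (rule nn_integral_mono_AE)
      show "AE t in L01. ennreal \<bar>u (t * s) * w t\<bar> \<le> ennreal M * (p t * q t)"
        using pos
      proof eventually_elim
        case (elim t)
        show ?case
        proof (cases "t \<in> {1 - eps..1}")
          case True
          have "p t * q t = ennreal \<bar>u (t * s)\<bar>"
            using True elim
            by (simp add: p_def q_def a_def ennreal_mult'[symmetric] powr_add[symmetric] mult.left_commute)
          moreover have "\<bar>u (t * s) * w t\<bar> \<le> M * \<bar>u (t * s)\<bar>"
            using mult_right_mono[OF w(2)[OF True] abs_ge_zero, of "u (t * s)"] by (simp add: abs_mult mult.commute)
          ultimately show ?thesis using M by (simp add: ennreal_mult'[symmetric] ennreal_leI)
        next
          case False
          then have "t < 1 - eps" using elim by auto
          moreover have "t * s \<le> t" using elim s by (intro mult_left_le) auto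
          ultimately have "t * s < 1 - eps" by linarith
          moreover have "0 \<le> t * s" using elim s by simp
          ultimately show ?thesis using sup by simp
        qed
      qed
    qed
    also have "\<dots> = ennreal M * (\<integral>\<^sup>+t. p t * q t \<partial>L01)"
      using pq by (intro nn_integral_cmult) auto
    finally have "(ennreal \<bar>slice w u s\<bar>)^2 \<le> (ennreal M * (\<integral>\<^sup>+t. p t * q t \<partial>L01))^2"
      by (intro power_mono) auto
    also have "\<dots> = ennreal (M^2) * (\<integral>\<^sup>+t. p t * q t \<partial>L01)^2"
      using M by (simp add: power_mult_distrib ennreal_power)
    also have "\<dots> \<le> ennreal (M^2) * ((\<integral>\<^sup>+t. (p t)^2 \<partial>L01) * (\<integral>\<^sup>+t. (q t)^2 \<partial>L01))"
      by (intro mult_left_mono Cauchy_Schwarz_nn_integral pq) auto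
    also have "(\<integral>\<^sup>+t. (p t)^2 \<partial>L01) = A"
      unfolding A_def
    proof (rule nn_integral_cong)
      show "(p t)^2 = ennreal (a t * t powr (- (1 / 2)))" for t
      proof -
        have "(a t * t powr (- (1 / 4)))^2 = (a t * a t) * (t powr (- (1 / 4)) * t powr (- (1 / 4)))"
          by (simp add: power2_eq_square mult_ac)
        also have "\<dots> = a t * t powr (- (1 / 2))"
          unfolding a(2) powr_add[symmetric] by simp
        finally show ?thesis using a(1)[of t] by (simp add: p_def ennreal_power)
      qed
    qed
    also have "(\<integral>\<^sup>+t. (q t)^2 \<partial>L01) = (\<integral>\<^sup>+t. g s t \<partial>L01)"
    proof (rule nn_integral_cong)
      show "(q t)^2 = g s t" for t
      proof -
        have "(\<bar>u (t * s)\<bar> * (a t * t powr (1 / 4)))^2 = (u (t * s))^2 * ((a t * a t) * (t powr (1 / 4) * t powr (1 / 4)))"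
          by (simp add: power2_eq_square mult_ac)
        also have "\<dots> = (u (t * s))^2 * (a t * t powr (1 / 2))"
          unfolding a(2) powr_add[symmetric] by simp
        finally show ?thesis using a(1)[of t] by (simp add: q_def g_def ennreal_power)
      qed
    qed
    finally show ?thesis using M by (simp add: ennreal_power mult.assoc)
  qed
  have gm: "case_prod g \<in> borel_measurable (L01 \<Otimes>\<^sub>M L01)"
    unfolding g_def by (rule measurable_leb_on_pair) measurable
  have gms: "(\<lambda>s. g s t) \<in> borel_funs" for t unfolding g_def by measurable
  have "(\<integral>\<^sup>+s. (\<integral>\<^sup>+t. g s t \<partial>L01) \<partial>L01) = (\<integral>\<^sup>+t. (\<integral>\<^sup>+s. g s t \<partial>L01) \<partial>L01)"
    using Fubini'[OF gm] by simp
  \<comment> \<open>Dilation by t costs 1/t, which turns t^(1/2) into t^(-1/2). Integration over t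
    then produces a second factor \<open>A\<close>, hence eps squared in the result.\<close>
  also have "\<dots> \<le> (\<integral>\<^sup>+t. ennreal (a t * t powr (- (1 / 2))) * U \<partial>L01)"
  proof (rule nn_integral_mono_AE)
    show "AE t in L01. (\<integral>\<^sup>+s. g s t \<partial>L01) \<le> ennreal (a t * t powr (- (1 / 2))) * U"
      using pos
    proof eventually_elim
      case (elim t)
      have "(\<integral>\<^sup>+s. g s t \<partial>L01) = (\<integral>\<^sup>+s. ennreal (a t * t powr (1 / 2)) * ennreal ((u (t * s))^2) \<partial>L01)"
        unfolding g_def using a(1)[of t] by (simp add: ennreal_mult'[symmetric] mult.commute)
      also have "\<dots> = ennreal (a t * t powr (1 / 2)) * (\<integral>\<^sup>+s. ennreal ((u (t * s))^2) \<partial>L01)"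
        by (intro nn_integral_cmult measurable_leb_on) measurable
      also have "\<dots> \<le> ennreal (a t * t powr (1 / 2)) * (ennreal (1 / t) * U)"
        unfolding U_def using elim by (intro mult_left_mono nn_integral_dilate_le) auto
      also have "\<dots> = ennreal (a t * t powr (- (1 / 2))) * U"
      proof -
        have "t powr (1 / 2) * (1 / t) = t powr (- (1 / 2))"
          using elim powr_diff[of t "1 / 2" 1] by simp
        then have "ennreal (a t * t powr (- (1 / 2))) = ennreal ((a t * t powr (1 / 2)) * (1 / t))"
          by (simp only: mult.assoc)
        also have "\<dots> = ennreal (a t * t powr (1 / 2)) * ennreal (1 / t)"
          using a(1)[of t] by (intro ennreal_mult') simp
        finally show ?thesis by (simp only: mult.assoc)
      qed
      finally show ?case .
    qed
  qed
  also have "\<dots> = A * U" unfolding A_def by (intro nn_integral_multc measurable_leb_on) measurable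
  finally have I: "(\<integral>\<^sup>+s. (\<integral>\<^sup>+t. g s t \<partial>L01) \<partial>L01) \<le> A * U" .
  have Ui: "U = ennreal (sqnorm L01 u)"
    unfolding U_def using sq_integrableD(2)[OF u(2)] by (intro nn_integral_eq_integral) auto
  have "(\<integral>\<^sup>+s. ennreal ((slice w u s)^2) \<partial>L01) \<le> (\<integral>\<^sup>+s. ennreal (M^2) * A * (\<integral>\<^sup>+t. g s t \<partial>L01) \<partial>L01)"
    by (intro nn_integral_mono pointwise) (simp add: space_leb_on)
  also have "\<dots> = ennreal (M^2) * A * (\<integral>\<^sup>+s. (\<integral>\<^sup>+t. g s t \<partial>L01) \<partial>L01)"
    using gm by (intro nn_integral_cmult sigma_finite_measure.borel_measurable_nn_integral[OF sigma_finite_leb_on]) simp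
  also have "\<dots> \<le> ennreal (M^2) * A * (A * U)" by (intro mult_left_mono I) simp
  also have "\<dots> \<le> ennreal (M^2) * ennreal (4 * eps) * (ennreal (4 * eps) * U)"
    by (intro mult_mono A) auto
  also have "\<dots> = ennreal ((4 * M * eps)^2 * sqnorm L01 u)"
  proof -
    have e1: "ennreal (x * y * (y * z)) = ennreal x * ennreal y * (ennreal y * ennreal z)"
      if "0 \<le> x" "0 \<le> y" for x y z :: real using that by (simp add: ennreal_mult')
    have e2: "(4 * M * eps)^2 * z = M^2 * (4 * eps) * ((4 * eps) * z)" for z
      by (simp add: power2_eq_square mult_ac)
    show ?thesis unfolding Ui e2 by (rule e1[symmetric]) (use eps in auto)
  qed
  finally have le: "(\<integral>\<^sup>+s. ennreal ((slice w u s)^2) \<partial>L01) \<le> ennreal ((4 * M * eps)^2 * sqnorm L01 u)" .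
  have i: "integrable (L01) (\<lambda>s. (slice w u s)^2)"
    unfolding integrable_iff_bounded
    using le measurable_leb_on[OF slice_measurable[OF u(1) w(1)]]
    by (auto intro: order_le_less_trans[OF _ ennreal_less_top])
  then show "sq_integrable (L01) (slice w u)"
    unfolding sq_integrable_def using measurable_leb_on[OF slice_measurable[OF u(1) w(1)]] by simp
  have "ennreal (sqnorm L01 (slice w u)) = (\<integral>\<^sup>+s. ennreal ((slice w u s)^2) \<partial>L01)"
    using i by (intro nn_integral_eq_integral[symmetric]) auto
  with le have "ennreal (sqnorm L01 (slice w u)) \<le> ennreal ((4 * M * eps)^2 * sqnorm L01 u)"
    by simp
  then show "sqnorm L01 (slice w u) \<le> (4 * M * eps)^2 * sqnorm L01 u"
    by (subst (asm) ennreal_le_iff) auto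
qed

text \<open>As \<eta> vanishes off (0,1), the restriction of t s to [0,1] may be replaced by that of
  s.\<close>

lemma integral_dilate:
  fixes g \<eta> :: "real \<Rightarrow> real"
  assumes t: "0 < t" "t \<le> 1" and \<eta>: "\<And>x. x \<notin> {0<..<1} \<Longrightarrow> \<eta> x = 0"
  shows "(\<integral>y. g y * \<eta> (y / t) \<partial>L01) = t * (\<integral>s. g (t * s) * \<eta> s \<partial>L01)"
proof -
  have "(\<integral>y. g y * \<eta> (y / t) \<partial>L01) = (\<integral>y. indicator {0..1} y *\<^sub>R (g y * \<eta> (y / t)) \<partial>lborel)"
    unfolding integral_leb_on set_lebesgue_integral_def ..
  also have "\<dots> = \<bar>t\<bar> *\<^sub>R (\<integral>s. indicator {0..1} (0 + t * s) *\<^sub>R (g (0 + t * s) * \<eta> ((0 + t * s) / t)) \<partial>lborel)"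
    using t by (intro lborel_integral_real_affine) auto
  also have "(\<lambda>s. indicator {0..1} (0 + t * s) *\<^sub>R (g (0 + t * s) * \<eta> ((0 + t * s) / t))) =
      (\<lambda>s. indicator {0..1} s *\<^sub>R (g (t * s) * \<eta> s))"
  proof
    fix s
    show "indicator {0..1} (0 + t * s) *\<^sub>R (g (0 + t * s) * \<eta> ((0 + t * s) / t)) =
      indicator {0..1} s *\<^sub>R (g (t * s) * \<eta> s)"
    proof (cases "s \<in> {0<..<1}")
      case True
      then have "t * s \<in> {0..1}" using t mult_le_one[of t s] by auto
      then show ?thesis using True t by (auto simp: indicator_def)
    next
      case False
      then show ?thesis using \<eta>[of s] t by simp
    qed
  qed
  finally show ?thesis using t unfolding integral_leb_on set_lebesgue_integral_def by simp
qed

text \<open>The bound M/s for the inner integral is not uniform near s = 0. The test function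
  rescues integrability on the square: it vanishes for s below some c > 0, so M/c takes
  over.\<close>

lemma slice_fubini:
  assumes u: "u \<in> borel_funs" "integrable (L01) u"
    and w: "w \<in> borel_funs" "\<And>t. t \<in> {0..1} \<Longrightarrow> \<bar>w t\<bar> \<le> M"
    and \<eta>: "test_fun 0 1 \<eta>"
  shows "(\<integral>s. slice w u s * \<eta> s \<partial>L01) = (\<integral>t. w t * (\<integral>s. u (t * s) * \<eta> s \<partial>L01) \<partial>L01)"
proof -
  interpret pair_sigma_finite "L01" "L01" by (rule pair_leb_on)
  have sm: "smooth \<eta>" using test_fun_smooth[OF \<eta>] .
  obtain c e where *: "0 < c" "e < 1" "\<And>x. x \<notin> {c..e} \<Longrightarrow> \<eta> x = 0"
    using \<eta> by (subst (asm) test_fun_iff) auto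
  have "bounded (\<eta> ` {0..1})"
    by (intro compact_imp_bounded compact_continuous_image smooth_continuous_on sm) auto
  then obtain C where C: "\<forall>x\<in>{0..1}. \<bar>\<eta> x\<bar> \<le> C" by (auto simp: bounded_iff)
  have M: "M \<ge> 0" using w(2)[of 0] by auto
  have C0: "C \<ge> 0" using bspec[OF C, of 0] by auto
  note [measurable] = u(1) w(1) smooth_borel_measurable[OF sm]
  define f where "f s t = u (t * s) * w t * \<eta> s" for s t
  have fm: "case_prod f \<in> borel_measurable (L01 \<Otimes>\<^sub>M L01)"
    unfolding f_def by (rule measurable_leb_on_pair) measurable
  have fi: "integrable (L01) (f s)" if s: "s \<in> {0..1}" for s
  proof (cases "s \<in> {c..e}")
    case True
    then show ?thesis unfolding f_def using dilate_integrable(1)[OF u _ _ w, of s] * s by simp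
  next
    case False
    then show ?thesis unfolding f_def using * by simp
  qed
  have fb: "(\<integral>t. \<bar>f s t\<bar> \<partial>L01) \<le> M / c * (\<integral>x. \<bar>u x\<bar> \<partial>L01) * C" if s: "s \<in> {0..1}" for s
  proof (cases "s \<in> {c..e}")
    case True
    have "(\<integral>t. \<bar>f s t\<bar> \<partial>L01) = (\<integral>t. \<bar>u (t * s) * w t\<bar> \<partial>L01) * \<bar>\<eta> s\<bar>"
      unfolding f_def by (simp add: abs_mult)
    also have "\<dots> \<le> (M / s * (\<integral>x. \<bar>u x\<bar> \<partial>L01)) * C"
      using dilate_integrable(2)[OF u _ _ w, of s] True * C s M by (intro mult_mono) auto
    also have "\<dots> \<le> (M / c * (\<integral>x. \<bar>u x\<bar> \<partial>L01)) * C"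
      using True * C0 M by (intro mult_right_mono divide_left_mono) auto
    finally show ?thesis .
  next
    case False
    have "0 \<le> M / c * (\<integral>x. \<bar>u x\<bar> \<partial>L01) * C" using C0 M * by (intro mult_nonneg_nonneg) auto
    then show ?thesis using False * by (simp add: f_def)
  qed
  have "integrable (L01 \<Otimes>\<^sub>M L01) (case_prod f)"
  proof (rule Fubini_integrable[OF fm])
    interpret F: finite_measure "L01" by (rule leb_on_finite_measure)
    have "(\<lambda>s. \<integral>t. norm (case_prod f (s, t)) \<partial>L01) \<in> borel_measurable (L01)"
      using fm by (intro sigma_finite_measure.borel_measurable_lebesgue_integral[OF sigma_finite_leb_on]) simp
    then show "integrable (L01) (\<lambda>s. \<integral>t. norm (case_prod f (s, t)) \<partial>L01)"
      using fb by (intro F.integrable_const_bound[of _ "M / c * (\<integral>x. \<bar>u x\<bar> \<partial>L01) * C"] AE_I2)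
         (auto simp: space_leb_on)
    show "AE s in L01. integrable (L01) (\<lambda>t. case_prod f (s, t))"
      using fi by (intro AE_I2) (simp add: space_leb_on)
  qed
  from Fubini_integral[OF this]
  have "(\<integral>t. \<integral>s. f s t \<partial>L01 \<partial>L01) = (\<integral>s. \<integral>t. f s t \<partial>L01 \<partial>L01)" .
  moreover have "(\<integral>t. f s t \<partial>L01) = slice w u s * \<eta> s" for s
    unfolding f_def slice_def by simp
  moreover have "(\<integral>s. f s t \<partial>L01) = w t * (\<integral>s. u (t * s) * \<eta> s \<partial>L01)" for t
  proof -
    have "f s t = w t * (u (t * s) * \<eta> s)" for s by (simp add: f_def)
    then show ?thesis by simp
  qed
  ultimately show ?thesis by simp
qed

text \<open>Formally the derivative of u(t s) in s is t u'(t s). Weakly, Fubini exposes the inner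
  integral for fixed t, the dilated test function moves the derivative from \<phi> to
  \<open>u\<close>, and Fubini leads back.\<close>

lemma slice_borel_weak_deriv:
  assumes uv: "borel_weak_deriv 0 1 u v"
    and w: "w \<in> borel_funs" "\<And>t. t \<in> {0..1} \<Longrightarrow> \<bar>w t\<bar> \<le> M"
  shows "borel_weak_deriv 0 1 (slice w u) (slice (\<lambda>t. t * w t) v)"
proof -
  have u: "u \<in> borel_funs" "sq_integrable (L01) u"
    and v: "v \<in> borel_funs" "sq_integrable (L01) v"
    and d: "\<And>\<phi>. test_fun 0 1 \<phi> \<Longrightarrow> (\<integral>x. u x * deriv \<phi> x \<partial>L01) = - (\<integral>x. v x * \<phi> x \<partial>L01)"
    using uv unfolding borel_weak_deriv_def by auto
  have tw: "(\<lambda>t. t * w t) \<in> borel_funs" "\<And>t. t \<in> {0..1} \<Longrightarrow> \<bar>t * w t\<bar> \<le> M"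
  proof -
    show "(\<lambda>t. t * w t) \<in> borel_funs" using w(1) by measurable
    show "\<bar>t * w t\<bar> \<le> M" if "t \<in> {0..1}" for t
      using w(2)[OF that] that mult_left_le_one_le[of "\<bar>w t\<bar>" t] by (auto simp: abs_mult)
  qed
  have "(\<integral>s. slice w u s * deriv \<phi> s \<partial>L01) = - (\<integral>s. slice (\<lambda>t. t * w t) v s * \<phi> s \<partial>L01)"
    if \<phi>: "test_fun 0 1 \<phi>" for \<phi>
  proof -
    have \<phi>': "test_fun 0 1 (deriv \<phi>)" by (rule test_fun_deriv[OF \<phi>]) simp
    have sm: "smooth \<phi>" by (rule test_fun_smooth[OF \<phi>])
    have "w t * (\<integral>s. u (t * s) * deriv \<phi> s \<partial>L01) = - (t * w t * (\<integral>s. v (t * s) * \<phi> s \<partial>L01))"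
      if t: "0 < t" "t \<le> 1" for t
    proof -
      have dt: "deriv (\<lambda>y. \<phi> (y / t)) = (\<lambda>y. (1 / t) * deriv \<phi> (y / t))"
        using funpow_deriv_affine[OF sm, of 1 "1 / t" 0] by simp
      have "(\<integral>s. u (t * s) * deriv \<phi> s \<partial>L01) = (1 / t) * (\<integral>y. u y * deriv \<phi> (y / t) \<partial>L01)"
        using t integral_dilate[where g = u and \<eta> = "deriv \<phi>", OF t test_fun_outside[OF \<phi>']] by simp
      also have "\<dots> = (\<integral>y. u y * deriv (\<lambda>y. \<phi> (y / t)) y \<partial>L01)"
        unfolding dt by (simp add: mult.left_commute[of _ "1 / t"])
      also have "\<dots> = - (\<integral>y. v y * \<phi> (y / t) \<partial>L01)"
        by (rule d[OF test_fun_scale[OF \<phi> t]])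
      also have "\<dots> = - (t * (\<integral>s. v (t * s) * \<phi> s \<partial>L01))"
        using integral_dilate[where g = v and \<eta> = \<phi>, OF t test_fun_outside[OF \<phi>]] by simp
      finally show ?thesis by simp
    qed
    then have "AE t in L01. w t * (\<integral>s. u (t * s) * deriv \<phi> s \<partial>L01) =
        - (t * w t * (\<integral>s. v (t * s) * \<phi> s \<partial>L01))"
      unfolding AE_leb_on using AE_lborel_singleton[of "0::real"] by (auto elim!: eventually_mono)
    moreover have m: "(\<lambda>t. w t * (\<integral>s. g (t * s) * \<eta> s \<partial>L01)) \<in> borel_measurable (L01)"
      if "g \<in> borel_funs" "\<eta> \<in> borel_funs" "w \<in> borel_funs" for g \<eta> w :: "real \<Rightarrow> real"
      using slice_measurable[OF that(1,2)] that(3) unfolding slice_def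
      by (intro measurable_leb_on borel_measurable_times) (auto simp: mult.commute)
    ultimately have "(\<integral>t. w t * (\<integral>s. u (t * s) * deriv \<phi> s \<partial>L01) \<partial>L01) =
       (\<integral>t. - (t * w t * (\<integral>s. v (t * s) * \<phi> s \<partial>L01)) \<partial>L01)"
      using smooth_borel_measurable[OF sm] smooth_borel_measurable[OF smooth_deriv[OF sm]] u(1) v(1) w(1) tw(1)
      by (intro integral_cong_AE borel_measurable_uminus m)
    also have "\<dots> = - (\<integral>t. t * w t * (\<integral>s. v (t * s) * \<phi> s \<partial>L01) \<partial>L01)" by simp
    also have "(\<integral>t. t * w t * (\<integral>s. v (t * s) * \<phi> s \<partial>L01) \<partial>L01) =
        (\<integral>s. slice (\<lambda>t. t * w t) v s * \<phi> s \<partial>L01)"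
      by (rule slice_fubini[OF v(1) sq_integrable_imp_integrable[OF v(2)] tw \<phi>, symmetric])
    finally show ?thesis
      using slice_fubini[OF u(1) sq_integrable_imp_integrable[OF u(2)] w \<phi>'] by metis
  qed
  \<comment> \<open>Square integrability is the slice bound with eps = 1, where the support
    condition is void.\<close>
  then show ?thesis
    unfolding borel_weak_deriv_def
    using slice_measurable[OF u(1) w(1)] slice_measurable[OF v(1) tw(1)]
      slice_bound(1)[OF u w(1), of 1 M] slice_bound(1)[OF v tw(1), of 1 M] w(2) tw(2) by auto
qed


section \<open>Error estimates\<close>

lemma slice_add_AE:
  assumes u1: "u1 \<in> borel_funs" "integrable (L01) u1"
    and u2: "u2 \<in> borel_funs" "integrable (L01) u2"
    and w: "w \<in> borel_funs" "\<And>t. t \<in> {0..1} \<Longrightarrow> \<bar>w t\<bar> \<le> M"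
  shows "AE s in L01. slice w (\<lambda>x. u1 x + u2 x) s = slice w u1 s + slice w u2 s"
  unfolding AE_leb_on using AE_lborel_singleton[of "0::real"]
proof eventually_elim
  case (elim s)
  show ?case
  proof
    assume "s \<in> {0..1}"
    then have s: "0 < s" "s \<le> 1" using elim by auto
    show "slice w (\<lambda>x. u1 x + u2 x) s = slice w u1 s + slice w u2 s"
      unfolding slice_def distrib_right
      by (intro Bochner_Integration.integral_add dilate_integrable(1)[OF u1 s w] dilate_integrable(1)[OF u2 s w])
  qed
qed

text \<open>\<open>u1\<close> is the boundary layer, which meets the weight only near 1 and gains
  the width eps. \<open>u2\<close> carries the cosine truncation error and is treated with the
  global weight bound, that is with eps = 1.\<close>

lemma slice_add_bound:
  assumes u1: "u1 \<in> borel_funs" "sq_integrable (L01) u1"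
    and u2: "u2 \<in> borel_funs" "sq_integrable (L01) u2"
    and w: "w \<in> borel_funs" "\<And>t. t \<in> {0..1} \<Longrightarrow> \<bar>w t\<bar> \<le> M"
    and m: "\<And>t. t \<in> {1 - eps..1} \<Longrightarrow> \<bar>w t\<bar> \<le> m" and eps: "0 < eps" "eps \<le> 1"
    and sup: "\<And>x. 0 \<le> x \<Longrightarrow> x < 1 - eps \<Longrightarrow> u1 x = 0"
  shows "sqnorm L01 (slice w (\<lambda>x. u1 x + u2 x)) \<le>
    2 * ((4 * m * eps)^2 * sqnorm L01 u1) + 2 * ((4 * M)^2 * sqnorm L01 u2)"
proof -
  note b1 = slice_bound[OF u1 w(1) m eps sup]
  have b2: "sq_integrable (L01) (slice w u2)"
    "sqnorm L01 (slice w u2) \<le> (4 * M * 1)^2 * sqnorm L01 u2"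
    using slice_bound[OF u2 w(1), of 1 M] w(2) by auto
  have "(\<lambda>x. u1 x + u2 x) \<in> borel_funs" using u1(1) u2(1) by simp
  note meas = measurable_leb_on[OF slice_measurable[OF this w(1)]]
    measurable_leb_on[OF slice_measurable[OF u1(1) w(1)]] measurable_leb_on[OF slice_measurable[OF u2(1) w(1)]]
  have "sqnorm L01 (slice w (\<lambda>x. u1 x + u2 x)) = (\<integral>s. (slice w u1 s + slice w u2 s)^2 \<partial>L01)"
  proof (rule integral_cong_AE)
    show "AE s in L01. (slice w (\<lambda>x. u1 x + u2 x) s)^2 = (slice w u1 s + slice w u2 s)^2"
    proof -
      have "AE s in L01. slice w (\<lambda>x. u1 x + u2 x) s = slice w u1 s + slice w u2 s"
        by (rule slice_add_AE[where M = M]) (use u1 u2 w sq_integrable_imp_integrable in auto)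
      then show ?thesis by eventually_elim simp
    qed
  qed (use meas in auto)
  also have "\<dots> \<le> 2 * sqnorm L01 (slice w u1) + 2 * sqnorm L01 (slice w u2)"
    by (intro integral_square_add_le b1 b2)
  finally show ?thesis using b1(2) b2(2) by simp
qed

lemma slicing_density_measurable: "slicing_density d \<in> borel_funs"
  unfolding slicing_density_def by measurable

text \<open>On [1 - eps, 1] one has 1 - t^2 \<le> 2 eps, and the exponent (d-3)/2 is nonnegative.
  The case eps = 1 doubles as a global bound by M.\<close>

lemma slicing_density_bound:
  assumes d: "d \<ge> 3"
  obtains M where "M > 0"
    "\<And>eps t. 0 < eps \<Longrightarrow> eps \<le> 1 \<Longrightarrow> t \<in> {1 - eps..1} \<Longrightarrow> \<bar>slicing_density d t\<bar> \<le> M * eps powr ((real d - 3) / 2)"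
proof -
  define e where "e = (real d - 3) / 2"
  define c where "c = 2 * Gamma (real d / 2) / (sqrt pi * Gamma ((real d - 1) / 2))"
  have e: "e \<ge> 0" using d by (simp add: e_def)
  have "Gamma (real d / 2) > 0" "Gamma ((real d - 1) / 2) > 0"
    using d by (auto intro!: Gamma_real_pos)
  then have c: "c > 0" unfolding c_def by (intro divide_pos_pos mult_pos_pos) auto
  show ?thesis
  proof (rule that[of "c * 2 powr e"])
    show "c * 2 powr e > 0" using c by simp
    fix eps t :: real assume eps: "0 < eps" "eps \<le> 1" and t: "t \<in> {1 - eps..1}"
    have "t^2 \<ge> (1 - eps)^2" using t eps by (intro power_mono) auto
    moreover have "(1 - eps)^2 = 1 - 2 * eps + eps^2" by (simp add: power2_eq_square algebra_simps)
    ultimately have "1 - t^2 \<le> 2 * eps" using zero_le_power2[of eps] by linarith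
    moreover have "0 \<le> 1 - t^2" using t eps by (simp add: power_le_one)
    ultimately have "(1 - t^2) powr e \<le> (2 * eps) powr e" using e by (intro powr_mono2) auto
    also have "\<dots> = 2 powr e * eps powr e" using eps by (simp add: powr_mult)
    finally have "c * (1 - t^2) powr e \<le> c * (2 powr e * eps powr e)" using c by (intro mult_left_mono) auto
    then show "\<bar>slicing_density d t\<bar> \<le> c * 2 powr e * eps powr ((real d - 3) / 2)"
      using c unfolding slicing_density_def c_def[symmetric] e_def[symmetric] by (simp add: mult.assoc)
  qed
qed

section \<open>Weak derivatives of cosine sums and of differences\<close>

definition cos_sum_deriv :: "nat \<Rightarrow> (nat \<Rightarrow> real) \<Rightarrow> real \<Rightarrow> real" where
  "cos_sum_deriv K b x = (\<Sum>k<K. - (pi * real k * b k) * sin_system k x)"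

lemma smooth_cos_sum: "smooth (cos_sum K b)"
proof -
  have "cos_system k = (\<lambda>x. (if k = 0 then 1 else sqrt 2) * cos (pi * real k * x + 0))" for k
    by (auto simp: cos_system_def fun_eq_iff)
  then have "smooth (cos_system k)" for k using smooth_cos by metis
  then show ?thesis unfolding cos_sum_def by (intro smooth_sum smooth_cmult)
qed

lemma deriv_cos_sum: "deriv (cos_sum K b) = cos_sum_deriv K b"
proof (intro ext DERIV_imp_deriv)
  fix x
  have "(cos_system k has_field_derivative - (pi * real k) * sin_system k x) (at x)" for k
    by (cases "k = 0") (auto simp: cos_system_def[abs_def] sin_system_def intro!: derivative_eq_intros)
  then show "(cos_sum K b has_field_derivative cos_sum_deriv K b x) (at x)"
    unfolding cos_sum_def cos_sum_deriv_def
    by (auto intro!: derivative_eq_intros sum.cong)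
qed

lemma smooth_borel_weak_deriv:
  assumes "smooth P" shows "borel_weak_deriv 0 1 P (deriv P)"
  unfolding borel_weak_deriv_def
proof (intro conjI allI impI smooth_borel_measurable continuous_sq_integrable smooth_continuous_on smooth_deriv assms)
  fix \<phi> assume \<phi>: "test_fun 0 1 \<phi>"
  have s: "smooth \<phi>" "smooth (deriv \<phi>)" "smooth (deriv P)" using test_fun_smooth[OF \<phi>] assms smooth_deriv by auto
  have "((\<lambda>x. P x * \<phi> x) has_field_derivative P x * deriv \<phi> x + deriv P x * \<phi> x) (at x)" for x
    using DERIV_mult[OF smooth_has_deriv[OF assms] smooth_has_deriv[OF s(1)], of x] by (simp add: algebra_simps)
  then have "(\<integral>x. P x * deriv \<phi> x + deriv P x * \<phi> x \<partial>L01) = P 1 * \<phi> 1 - P 0 * \<phi> 0"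
    by (intro integral_FTC_leb_on continuous_on_add continuous_on_mult smooth_continuous_on s assms) auto
  also have "\<dots> = 0" using test_fun_outside[OF \<phi>, of 0] test_fun_outside[OF \<phi>, of 1] by simp
  finally have "(\<integral>x. P x * deriv \<phi> x \<partial>L01) + (\<integral>x. deriv P x * \<phi> x \<partial>L01) = 0"
    by (subst (asm) Bochner_Integration.integral_add)
       (intro continuous_integrable_leb_on continuous_on_mult smooth_continuous_on s assms | assumption)+
  then show "(\<integral>x. P x * deriv \<phi> x \<partial>L01) = - (\<integral>x. deriv P x * \<phi> x \<partial>L01)" by simp
qed

lemma borel_weak_deriv_diff:
  assumes "borel_weak_deriv 0 1 u v" "borel_weak_deriv 0 1 u' v'"
  shows "borel_weak_deriv 0 1 (\<lambda>x. u x - u' x) (\<lambda>x. v x - v' x)"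
  unfolding borel_weak_deriv_def
proof (intro conjI allI impI)
  fix \<phi> assume \<phi>: "test_fun 0 1 \<phi>"
  have c: "sq_integrable (L01) \<phi>" "sq_integrable (L01) (deriv \<phi>)"
    using test_fun_smooth[OF \<phi>] by (auto intro!: continuous_sq_integrable smooth_continuous_on smooth_deriv)
  have "integrable (L01) (\<lambda>x. g x * \<psi> x)" if "g \<in> {u, v, u', v'}" "\<psi> \<in> {\<phi>, deriv \<phi>}" for g \<psi>
    using that assms c unfolding borel_weak_deriv_def by (auto intro: sq_integrable_mult_integrable)
  then show "(\<integral>x. (u x - u' x) * deriv \<phi> x \<partial>L01) = - (\<integral>x. (v x - v' x) * \<phi> x \<partial>L01)"
    using assms \<phi> unfolding borel_weak_deriv_def by (simp add: left_diff_distrib)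
qed (use assms in \<open>auto simp: borel_weak_deriv_def intro: sq_integrable_diff\<close>)

text \<open>\<open>is_best_fit\<close> minimises the norm of the sliced sum minus \<open>F\<close>,
  whereas the error bounds concern \<open>F\<close> minus the sliced sum; the sign has to pass
  through the weak derivative.\<close>

lemma borel_weak_deriv_uminus:
  assumes "borel_weak_deriv 0 1 u v"
  shows "borel_weak_deriv 0 1 (\<lambda>x. - u x) (\<lambda>x. - v x)"
proof -
  have "borel_weak_deriv 0 1 (\<lambda>x. 0) (\<lambda>x. 0)"
    unfolding borel_weak_deriv_def by (auto intro: sq_integrable_zero)
  from borel_weak_deriv_diff[OF this assms] show ?thesis by simp
qed

lemma integral_leb_on_superset:
  fixes g :: "real \<Rightarrow> real"
  assumes "\<And>x. x \<notin> {0..1} \<Longrightarrow> g x = 0"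
  shows "(\<integral>x. g x \<partial>L11) = (\<integral>x. g x \<partial>L01)"
  unfolding integral_leb_on set_lebesgue_integral_def
  by (rule Bochner_Integration.integral_cong) (use assms in \<open>auto simp: indicator_def\<close>)

lemma integral_square_le:
  assumes S: "sq_integrable (L11) S" "S \<in> borel_funs"
    and g: "sq_integrable (L01) g" "\<And>x. x \<in> {0..1} \<Longrightarrow> \<bar>g x\<bar> \<le> c * S x"
  shows "sqnorm L01 g \<le> c^2 * sqnorm L11 S"
proof -
  have S': "sq_integrable (L01) S"
    by (rule sq_integrable_leb_on_subset[OF S]) auto
  have "sqnorm L01 g \<le> (\<integral>x. c^2 * (S x)^2 \<partial>L01)"
  proof (rule integral_mono)
    fix x assume "x \<in> space (L01)"
    then have "\<bar>g x\<bar>^2 \<le> (c * S x)^2" using g(2)[of x] by (intro power_mono) (auto simp: space_leb_on)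
    then show "(g x)^2 \<le> c^2 * (S x)^2" by (simp add: power_mult_distrib)
  qed (use sq_integrableD(2)[OF g(1)] sq_integrableD(2)[OF S'] in auto)
  also have "\<dots> = c^2 * sqnorm L01 S" by simp
  also have "sqnorm L01 S \<le> sqnorm L11 S"
    unfolding integral_leb_on set_lebesgue_integral_def
    using sq_integrableD(2)[OF S(1)] sq_integrableD(2)[OF S']
    unfolding integrable_leb_on set_integrable_def
    by (intro integral_mono) (auto simp: indicator_def)
  finally show ?thesis by (simp add: mult_left_mono)
qed

text \<open>A test function on (0,1) is also one on (-1,1), and the integrals over the larger
  interval see only its support.\<close>

lemma (in even_jet) jet_borel_weak_deriv: "borel_weak_deriv 0 1 (H 0) (H 1)"
  unfolding borel_weak_deriv_def
proof (intro conjI allI impI)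
  fix \<phi> assume \<phi>: "test_fun 0 1 \<phi>"
  have \<phi>1: "test_fun (-1) 1 \<phi>" using \<phi> by (rule test_fun_widen) auto
  have \<phi>': "test_fun 0 1 (deriv \<phi>)" by (rule test_fun_deriv[OF \<phi>]) simp
  have "(\<integral>x. H 0 x * deriv \<phi> x \<partial>L01) = (\<integral>x. H 0 x * deriv \<phi> x \<partial>L11)"
    using test_fun_outside[OF \<phi>'] by (intro integral_leb_on_superset[symmetric]) auto
  also have "\<dots> = - (\<integral>x. H 1 x * \<phi> x \<partial>L11)" using H_weak_deriv[OF r \<phi>1] by simp
  also have "(\<integral>x. H 1 x * \<phi> x \<partial>L11) = (\<integral>x. H 1 x * \<phi> x \<partial>L01)"
    using test_fun_outside[OF \<phi>] by (intro integral_leb_on_superset) auto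
  finally show "(\<integral>x. H 0 x * deriv \<phi> x \<partial>L01) = - (\<integral>x. H 1 x * \<phi> x \<partial>L01)" .
qed (use r in \<open>auto intro: H_measurable sq_integrable_leb_on_subset[OF H_sq_integrable H_measurable]\<close>)


context even_jet
begin

definition jet_sum :: "real \<Rightarrow> real" where "jet_sum x = (\<Sum>l\<le>r. \<bar>H l x\<bar>)"

lemma jet_sum_regular: "jet_sum \<in> borel_funs" "sq_integrable (L11) jet_sum"
proof -
  show "jet_sum \<in> borel_funs"
    unfolding jet_sum_def using H_measurable by (intro borel_measurable_sum borel_measurable_abs) auto
  have "sq_integrable (L11) (\<lambda>x. \<bar>H l x\<bar>)" if "l \<le> r" for l
    using H_sq_integrable[OF that] measurable_leb_on[OF H_measurable[OF that]]
    unfolding sq_integrable_def by auto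
  then show "sq_integrable (L11) jet_sum"
    unfolding jet_sum_def by (intro sq_integrable_sum) auto
qed

lemma jet_le_jet_sum: "i \<le> r \<Longrightarrow> \<bar>H i x\<bar> \<le> jet_sum x"
  unfolding jet_sum_def by (intro member_le_sum) auto

lemma jet_sum_nonneg: "jet_sum x \<ge> 0"
  unfolding jet_sum_def by (intro sum_nonneg) auto

text \<open>Borel versions of the error and of its weak derivative; the factor t comes from
  differentiating in s.\<close>

abbreviation "err d K b \<equiv> slice (slicing_density d) (\<lambda>x. H 0 x - cos_sum K b x)"
abbreviation "err_deriv d K b \<equiv>
  slice (\<lambda>t. t * slicing_density d t) (\<lambda>x. H 1 x - cos_sum_deriv K b x)"

text \<open>K and eps stay independent, so the two norms can choose different scales, and the same
  \<open>b\<close> satisfies both bounds, as the H1 norm requires. In each bound the first summand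
  stems from the boundary layer, the second from the cosine truncation.\<close>

lemma slicing_approx:
  assumes d: "d \<ge> 3"
  shows "\<exists>C>0. \<forall>K eps. K \<ge> 1 \<longrightarrow> 0 < eps \<longrightarrow> eps \<le> 1 \<longrightarrow> (\<exists>b \<in> coeff_vectors K.
      sqnorm L01 (err d K b)
        \<le> C * ((eps powr ((real d - 3) / 2))^2 * eps^2 + 1 / (real K ^ (2 * r) * eps ^ (2 * r))) \<and>
      sqnorm L01 (err_deriv d K b)
        \<le> C * ((eps powr ((real d - 3) / 2))^2 + 1 / (real K ^ (2 * (r - 1)) * eps ^ (2 * r))))"
    (is "\<exists>C>0. \<forall>K eps. _ \<longrightarrow> _ \<longrightarrow> _ \<longrightarrow> ?P C K eps")
proof (rule ex_cutoffs)
  fix \<theta> :: "real \<Rightarrow> real \<Rightarrow> real"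
  assume \<theta>:
    "\<And>eps. 0 < eps \<Longrightarrow> eps \<le> 1 \<Longrightarrow> test_fun (-1) 1 (\<theta> eps)"
    "\<And>eps x. \<theta> eps (- x) = \<theta> eps x"
    "\<And>eps x. 0 < eps \<Longrightarrow> \<bar>x\<bar> \<le> 1 - eps \<Longrightarrow> \<theta> eps x = 1"
    "\<And>eps x. 0 < eps \<Longrightarrow> eps \<le> 1 \<Longrightarrow> 0 \<le> \<theta> eps x \<and> \<theta> eps x \<le> 1"
    "\<And>j. \<exists>C. \<forall>eps x. 0 < eps \<longrightarrow> eps \<le> 1 \<longrightarrow> \<bar>(deriv ^^ j) (\<theta> eps) x\<bar> \<le> C * (1 / eps) ^ j"
  obtain c where c: "\<And>j eps x. 0 < eps \<Longrightarrow> eps \<le> 1 \<Longrightarrow> \<bar>(deriv ^^ j) (\<theta> eps) x\<bar> \<le> c j * (1 / eps) ^ j"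
    using \<theta>(5) by metis
  define D where "D = (\<Sum>j\<le>r. \<bar>c j\<bar>)"
  have D: "D \<ge> 0" unfolding D_def by (intro sum_nonneg) auto
  have cD: "\<bar>(deriv ^^ j) (\<theta> eps) x\<bar> \<le> D * (1 / eps) ^ j" if "0 < eps" "eps \<le> 1" "j \<le> r" for eps x j
  proof -
    have "c j \<le> D" using member_le_sum[of j "{..r}" "\<lambda>j. \<bar>c j\<bar>"] that unfolding D_def by auto
    then have "c j * (1 / eps) ^ j \<le> D * (1 / eps) ^ j" using that by (intro mult_right_mono) auto
    then show ?thesis by (rule order_trans[OF c[OF that(1,2)]])
  qed
  obtain M where M: "M > 0"
    "\<And>eps t. 0 < eps \<Longrightarrow> eps \<le> 1 \<Longrightarrow> t \<in> {1 - eps..1} \<Longrightarrow> \<bar>slicing_density d t\<bar> \<le> M * eps powr ((real d - 3) / 2)"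
    using slicing_density_bound[OF d] by metis
  define N where "N = sqnorm L11 jet_sum"
  have N: "N \<ge> 0" unfolding N_def by simp
  \<comment> \<open>The outer 2 comes from splitting the error into two parts and 4 M from the slice
    bound. Up to powers of eps, 1 + D bounds the boundary layer relative to the jet, and 2^r D the
    r-th derivative of the cutoff function.\<close>
  define C1 where "C1 = 2 * ((4 * M)^2 * ((1 + D)^2 * N))"
  define C2 where "C2 = 2 * ((4 * M)^2 * ((2 ^ r * D)^2 * N))"
  have C12: "C1 \<ge> 0" "C2 \<ge> 0" unfolding C1_def C2_def using N by auto
  show ?thesis
  \<comment> \<open>Adding 1 makes the constant positive even if \<open>N\<close> is 0.\<close>
  proof (intro exI[of _ "C1 + C2 + 1"] conjI allI impI)
    show "C1 + C2 + 1 > 0" using C12 by simp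
    fix K :: nat and eps :: real assume K: "K \<ge> 1" and eps: "0 < eps" "eps \<le> 1"
    define \<kappa> where "\<kappa> = eps powr ((real d - 3) / 2)"
    define B where "B = sqnorm L11 (leibniz (\<theta> eps) r 0)"
    note tf = \<theta>(1)[OF eps]
    have \<theta>m: "\<theta> eps \<in> borel_funs" by (rule smooth_borel_measurable[OF test_fun_smooth[OF tf]])
    have le_inv: "(1 / eps) ^ j \<le> (1 / eps) ^ r" if "j \<le> r" for j
      using that eps by (intro power_increasing) auto
    have B: "B \<le> (2 ^ r * D)^2 * N / eps ^ (2 * r)"
    proof -
      have lb: "\<bar>leibniz (\<theta> eps) r 0 x\<bar> \<le> 2 ^ r * (D * (1 / eps) ^ r) * jet_sum x" for x
        unfolding jet_sum_def
      proof (rule leibniz_bound)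
        show "\<bar>(deriv ^^ j) (\<theta> eps) x\<bar> \<le> D * (1 / eps) ^ r" if "j \<le> r" for j
          using cD[OF eps that, of x] mult_left_mono[OF le_inv[OF that] D] by linarith
      qed simp
      have "B \<le> (\<integral>x. (2 ^ r * (D * (1 / eps) ^ r))^2 * (jet_sum x)^2 \<partial>L11)"
        unfolding B_def
      proof (rule integral_mono)
        show "integrable (L11) (\<lambda>x. (leibniz (\<theta> eps) r 0 x)^2)"
          using leibniz_regular[OF tf, of r 0] sq_integrableD(2) by auto
        show "integrable (L11) (\<lambda>x. (2 ^ r * (D * (1 / eps) ^ r))^2 * (jet_sum x)^2)"
          using sq_integrableD(2)[OF jet_sum_regular(2)] by auto
        show "(leibniz (\<theta> eps) r 0 x)^2 \<le> (2 ^ r * (D * (1 / eps) ^ r))^2 * (jet_sum x)^2" for x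
          using power_mono[OF lb[of x], of 2] by (simp add: power_mult_distrib)
      qed
      also have "\<dots> = (2 ^ r * (D * (1 / eps) ^ r))^2 * N" by (simp add: N_def)
      also have "\<dots> = (2 ^ r * D)^2 * N / eps ^ (2 * r)"
        by (simp add: power_mult_distrib power_divide power_mult[symmetric] mult.commute)
      finally show ?thesis .
    qed
    have "\<exists>b\<in>coeff_vectors K.
      (\<integral>x. (\<theta> eps x * H 0 x - cos_sum K b x)^2 \<partial>L01) \<le> B / real K ^ (2 * r) \<and>
      (\<integral>x. (leibniz (\<theta> eps) 1 0 x - cos_sum_deriv K b x)^2 \<partial>L01) \<le> B / real K ^ (2 * (r - 1))"
      unfolding cos_sum_deriv_def B_def
      by (rule cutoff_cos_approx[OF tf \<theta>(2) K]) (rule bexI, rule conjI, assumption+)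
    then obtain b where b: "b \<in> coeff_vectors K"
      "(\<integral>x. (\<theta> eps x * H 0 x - cos_sum K b x)^2 \<partial>L01) \<le> B / real K ^ (2 * r)"
      "(\<integral>x. (leibniz (\<theta> eps) 1 0 x - cos_sum_deriv K b x)^2 \<partial>L01) \<le> B / real K ^ (2 * (r - 1))"
      by blast
    have smc: "cos_sum K b \<in> borel_funs" "cos_sum_deriv K b \<in> borel_funs"
        "sq_integrable (L01) (cos_sum K b)" "sq_integrable (L01) (cos_sum_deriv K b)"
      using smooth_cos_sum[of K b] smooth_deriv[OF smooth_cos_sum[of K b]] unfolding deriv_cos_sum
      by (auto intro: smooth_borel_measurable continuous_sq_integrable smooth_continuous_on)
    have hreg: "H i \<in> borel_funs" "sq_integrable (L01) (H i)" if "i \<le> 1" for i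
      using that r by (auto intro: H_measurable sq_integrable_leb_on_subset[OF H_sq_integrable H_measurable])
    have lreg: "leibniz (\<theta> eps) n 0 \<in> borel_funs" "sq_integrable (L01) (leibniz (\<theta> eps) n 0)"
      if "n \<le> 1" for n
    proof -
      have "leibniz (\<theta> eps) n 0 \<in> borel_funs \<and> sq_integrable (L11) (leibniz (\<theta> eps) n 0)"
        using that r by (intro leibniz_regular tf) auto
      then show "leibniz (\<theta> eps) n 0 \<in> borel_funs" "sq_integrable (L01) (leibniz (\<theta> eps) n 0)"
        by (auto intro: sq_integrable_leb_on_subset)
    qed
    have diff_reg: "(\<lambda>x. f x - g x) \<in> borel_funs \<and> sq_integrable (L01) (\<lambda>x. f x - g x)"
      if "f \<in> borel_funs" "sq_integrable (L01) f"
        "g \<in> borel_funs" "sq_integrable (L01) g" for f g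
      using that by (auto intro: sq_integrable_diff)
    have l0: "leibniz (\<theta> eps) 0 0 = (\<lambda>x. \<theta> eps x * H 0 x)" by (simp add: fun_eq_iff)
    have w: "slicing_density d \<in> borel_funs" "(\<lambda>t. t * slicing_density d t) \<in> borel_funs"
      using slicing_density_measurable[of d] by auto
    have wM: "\<bar>slicing_density d t\<bar> \<le> M" "\<bar>t * slicing_density d t\<bar> \<le> M" if "t \<in> {0..1}" for t
      using M(2)[of 1 t] that mult_left_le_one_le[of "\<bar>slicing_density d t\<bar>" t] by (auto simp: abs_mult)
    have wm: "\<bar>slicing_density d t\<bar> \<le> M * \<kappa>" "\<bar>t * slicing_density d t\<bar> \<le> M * \<kappa>" if "t \<in> {1 - eps..1}" for t
      using M(2)[OF eps that] that eps mult_left_le_one_le[of "\<bar>slicing_density d t\<bar>" t] by (auto simp: abs_mult \<kappa>_def)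
    have t2: "2 * ((4 * M)^2 * z) \<le> C2 * (1 / (real K ^ m * eps ^ (2 * r)))" if "z \<le> B / real K ^ m" for z m
    proof -
      have "z \<le> ((2 ^ r * D)^2 * N / eps ^ (2 * r)) / real K ^ m"
        using that divide_right_mono[OF B, of "real K ^ m"] by simp
      then have "2 * ((4 * M)^2 * z) \<le> 2 * ((4 * M)^2 * (((2 ^ r * D)^2 * N / eps ^ (2 * r)) / real K ^ m))"
        by (intro mult_left_mono) auto
      also have "\<dots> = C2 * (1 / (real K ^ m * eps ^ (2 * r)))" unfolding C2_def by (simp add: mult_ac)
      finally show ?thesis .
    qed
    show "?P (C1 + C2 + 1) K eps"
    proof (intro bexI[OF _ b(1)] conjI)
      define u1 where "u1 x = H 0 x - leibniz (\<theta> eps) 0 0 x" for x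
      define u2 where "u2 x = leibniz (\<theta> eps) 0 0 x - cos_sum K b x" for x
      have u1: "u1 \<in> borel_funs" "sq_integrable (L01) u1"
        and u2: "u2 \<in> borel_funs" "sq_integrable (L01) u2"
        unfolding u1_def u2_def using diff_reg hreg[of 0] lreg[of 0] smc by (auto simp del: leibniz.simps)
      have "sqnorm L01 (slice (slicing_density d) (\<lambda>x. u1 x + u2 x)) \<le>
        2 * ((4 * (M * \<kappa>) * eps)^2 * sqnorm L01 u1) + 2 * ((4 * M)^2 * sqnorm L01 u2)"
      proof (rule slice_add_bound[OF u1 u2 w(1) wM(1) wm(1) eps])
        show "u1 x = 0" if "0 \<le> x" "x < 1 - eps" for x using that \<theta>(3)[OF eps(1), of x] by (simp add: u1_def)
      qed
      moreover have "2 * ((4 * (M * \<kappa>) * eps)^2 * sqnorm L01 u1) \<le> C1 * (\<kappa>^2 * eps^2)"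
      proof -
        have "sqnorm L01 u1 \<le> (1 + D)^2 * N"
          unfolding N_def
        proof (rule integral_square_le[OF jet_sum_regular(2,1) u1(2)])
          fix x
          have "\<bar>u1 x\<bar> = \<bar>1 - \<theta> eps x\<bar> * \<bar>H 0 x\<bar>" by (simp add: u1_def abs_mult[symmetric] left_diff_distrib)
          also have "\<dots> \<le> (1 + D) * jet_sum x"
            using \<theta>(4)[OF eps, of x] D jet_le_jet_sum[of 0 x] jet_sum_nonneg by (intro mult_mono) auto
          finally show "\<bar>u1 x\<bar> \<le> (1 + D) * jet_sum x" .
        qed
        then have "2 * ((4 * (M * \<kappa>) * eps)^2 * sqnorm L01 u1) \<le> 2 * ((4 * (M * \<kappa>) * eps)^2 * ((1 + D)^2 * N))"
          by (intro mult_left_mono) auto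
        also have "\<dots> = C1 * (\<kappa>^2 * eps^2)" unfolding C1_def by (simp add: power_mult_distrib mult_ac)
        finally show ?thesis .
      qed
      moreover have "2 * ((4 * M)^2 * sqnorm L01 u2) \<le> C2 * (1 / (real K ^ (2 * r) * eps ^ (2 * r)))"
        using b(2) by (intro t2) (simp add: u2_def)
      moreover have "(\<lambda>x. u1 x + u2 x) = (\<lambda>x. H 0 x - cos_sum K b x)" by (simp add: u1_def u2_def fun_eq_iff)
      ultimately have "sqnorm L01 (err d K b)
        \<le> C1 * (\<kappa>^2 * eps^2) + C2 * (1 / (real K ^ (2 * r) * eps ^ (2 * r)))" by simp
      also have "\<dots> \<le> (C1 + C2 + 1) * (\<kappa>^2 * eps^2) + (C1 + C2 + 1) * (1 / (real K ^ (2 * r) * eps ^ (2 * r)))"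
        using C12 eps by (intro add_mono mult_right_mono) auto
      finally show "sqnorm L01 (err d K b)
        \<le> (C1 + C2 + 1) * ((eps powr ((real d - 3) / 2))^2 * eps^2 + 1 / (real K ^ (2 * r) * eps ^ (2 * r)))"
        unfolding \<kappa>_def distrib_left .
    next
      define v1 where "v1 x = H 1 x - leibniz (\<theta> eps) 1 0 x" for x
      define v2 where "v2 x = leibniz (\<theta> eps) 1 0 x - cos_sum_deriv K b x" for x
      have v1: "v1 \<in> borel_funs" "sq_integrable (L01) v1"
        and v2: "v2 \<in> borel_funs" "sq_integrable (L01) v2"
        unfolding v1_def v2_def using diff_reg hreg[of 1] lreg[of 1] smc by (auto simp del: leibniz.simps One_nat_def)
      have v1e: "v1 x = (1 - \<theta> eps x) * H 1 x - deriv (\<theta> eps) x * H 0 x" for x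
        by (simp add: v1_def left_diff_distrib)
      have "sqnorm L01 (slice (\<lambda>t. t * slicing_density d t) (\<lambda>x. v1 x + v2 x)) \<le>
        2 * ((4 * (M * \<kappa>) * eps)^2 * sqnorm L01 v1) + 2 * ((4 * M)^2 * sqnorm L01 v2)"
      proof (rule slice_add_bound[OF v1 v2 w(2) wM(2) wm(2) eps])
        fix x :: real assume x: "0 \<le> x" "x < 1 - eps"
        \<comment> \<open>\<open>v1\<close> contains the derivative of \<theta>, so the value 1 at x
          alone is not enough: as x < 1 - eps is strict, \<theta> is 1 on a whole
          neighbourhood.\<close>
        have "((\<lambda>x. 1) has_field_derivative 0) (at x)" by simp
        moreover have "eventually (\<lambda>y. \<theta> eps y = 1) (nhds x)"
          by (rule eventually_mono[OF eventually_nhds_in_open[of "{- (1 - eps)<..<1 - eps}" x]])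
            (use x eps in \<open>auto intro!: \<theta>(3)\<close>)
        ultimately have "(\<theta> eps has_field_derivative 0) (at x)"
          by (subst DERIV_cong_ev[OF refl _ refl, of _ "\<lambda>x. 1"]) auto
        then have "deriv (\<theta> eps) x = 0" by (rule DERIV_imp_deriv)
        moreover have "\<theta> eps x = 1" using x by (intro \<theta>(3) eps) auto
        ultimately show "v1 x = 0" by (simp add: v1e)
      qed
      \<comment> \<open>The derivative of \<theta> makes \<open>v1\<close> of size 1/eps. This uses
        up the factor eps gained from the width of the layer, and only \<kappa> remains.\<close>
      moreover have "2 * ((4 * (M * \<kappa>) * eps)^2 * sqnorm L01 v1) \<le> C1 * \<kappa>^2"
      proof -
        have "sqnorm L01 v1 \<le> ((1 + D) / eps)^2 * N"
          unfolding N_def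
        proof (rule integral_square_le[OF jet_sum_regular(2,1) v1(2)])
          fix x
          have "\<bar>v1 x\<bar> \<le> \<bar>1 - \<theta> eps x\<bar> * \<bar>H 1 x\<bar> + \<bar>deriv (\<theta> eps) x\<bar> * \<bar>H 0 x\<bar>"
            unfolding v1e abs_mult[symmetric] by (rule abs_triangle_ineq4)
          also have "\<dots> \<le> (1 / eps) * jet_sum x + (D / eps) * jet_sum x"
          proof (intro add_mono mult_mono)
            have "1 \<le> 1 / eps" using eps by simp
            then show "\<bar>1 - \<theta> eps x\<bar> \<le> 1 / eps" using \<theta>(4)[OF eps, of x] by linarith
            show "\<bar>deriv (\<theta> eps) x\<bar> \<le> D / eps" using cD[OF eps r, of x] by simp
          qed (use jet_le_jet_sum r D eps in auto)
          also have "\<dots> = (1 + D) / eps * jet_sum x" by (simp add: add_divide_distrib distrib_right)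
          finally show "\<bar>v1 x\<bar> \<le> (1 + D) / eps * jet_sum x" .
        qed
        then have "2 * ((4 * (M * \<kappa>) * eps)^2 * sqnorm L01 v1) \<le> 2 * ((4 * (M * \<kappa>) * eps)^2 * (((1 + D) / eps)^2 * N))"
          by (intro mult_left_mono) auto
        also have "\<dots> = C1 * \<kappa>^2" unfolding C1_def using eps by (simp add: power_mult_distrib power_divide mult_ac)
        finally show ?thesis .
      qed
      moreover have "2 * ((4 * M)^2 * sqnorm L01 v2) \<le> C2 * (1 / (real K ^ (2 * (r - 1)) * eps ^ (2 * r)))"
        using b(3) by (intro t2) (simp add: v2_def)
      moreover have "(\<lambda>x. v1 x + v2 x) = (\<lambda>x. H 1 x - cos_sum_deriv K b x)" by (simp add: v1_def v2_def fun_eq_iff)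
      ultimately have "sqnorm L01 (err_deriv d K b)
        \<le> C1 * \<kappa>^2 + C2 * (1 / (real K ^ (2 * (r - 1)) * eps ^ (2 * r)))" by simp
      also have "\<dots> \<le> (C1 + C2 + 1) * \<kappa>^2 + (C1 + C2 + 1) * (1 / (real K ^ (2 * (r - 1)) * eps ^ (2 * r)))"
        using C12 eps by (intro add_mono mult_right_mono) auto
      finally show "sqnorm L01 (err_deriv d K b)
        \<le> (C1 + C2 + 1) * ((eps powr ((real d - 3) / 2))^2 + 1 / (real K ^ (2 * (r - 1)) * eps ^ (2 * r)))"
        unfolding \<kappa>_def distrib_left .
    qed
  qed
qed

text \<open>For s > 0 the map t \<mapsto> t s pulls null sets back to null sets, so replacing
  \<open>f\<close> by \<open>H 0\<close> does not change the slice. At s = 0 the slice sees the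
  single value f(0), which a representative does not control, so equality is claimed almost
  everywhere.\<close>

lemma slicing_error:
  assumes d: "d \<ge> 3" and f: "AE x in L01. f x = H 0 x"
    and F: "\<And>s. s \<in> {0..1} \<Longrightarrow> F s = slicing d f s"
  shows "AE s in L01. F s - slicing d (cos_sum K b) s =
      err d K b s" (is ?A)
    and "borel_weak_deriv 0 1 (err d K b)
      (err_deriv d K b)" (is ?B)
proof -
  obtain M where M: "\<And>eps t. 0 < eps \<Longrightarrow> eps \<le> 1 \<Longrightarrow> t \<in> {1 - eps..1} \<Longrightarrow> \<bar>slicing_density d t\<bar> \<le> M * eps powr ((real d - 3) / 2)"
    using slicing_density_bound[OF d] by metis
  have wM: "\<bar>slicing_density d t\<bar> \<le> M" if "t \<in> {0..1}" for t using M[of 1 t] that by simp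
  note w = slicing_density_measurable[of d]
  have P: "cos_sum K b \<in> borel_funs" "integrable (L01) (cos_sum K b)"
    by (auto intro: smooth_borel_measurable continuous_integrable_leb_on smooth_continuous_on smooth_cos_sum)
  have h0: "H 0 \<in> borel_funs" "integrable (L01) (H 0)"
    using jet_borel_weak_deriv sq_integrable_imp_integrable unfolding borel_weak_deriv_def by auto
  note [measurable] = w P(1) h0(1)
  show ?B
    using borel_weak_deriv_diff[OF jet_borel_weak_deriv smooth_borel_weak_deriv[OF smooth_cos_sum]]
    unfolding deriv_cos_sum by (rule slice_borel_weak_deriv[OF _ w wM])
  show ?A
    unfolding AE_leb_on using AE_lborel_singleton[of "0::real"]
  proof eventually_elim
    case (elim s)
    show ?case
    proof
      assume "s \<in> {0..1}"
      then have s: "0 < s" "s \<le> 1" using elim by auto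
      have "AE t in L01. f (t * s) * slicing_density d t = H 0 (t * s) * slicing_density d t"
      proof -
        have "AE t in lborel. 0 + s * t \<in> {0..1} \<longrightarrow> f (0 + s * t) = H 0 (0 + s * t)"
          using f s unfolding AE_leb_on by (intro AE_lborel_affine) auto
        then show ?thesis unfolding AE_leb_on
        proof eventually_elim
          case (elim t)
          then show ?case using s mult_le_one[of s t] by (auto simp: mult.commute)
        qed
      qed
      then have 1: "slicing d f s = slice (slicing_density d) (H 0) s"
        unfolding slicing_def slice_def by (intro set_integral_representative) measurable
      have 2: "slicing d (cos_sum K b) s = slice (slicing_density d) (cos_sum K b) s"
        unfolding slicing_def slice_def by (intro set_integral_representative) auto
      show "F s - slicing d (cos_sum K b) s = err d K b s"
        using F[of s] s dilate_integrable(1)[OF h0 s w wM] dilate_integrable(1)[OF P s w wM]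
        unfolding 1 2 slice_def by (simp add: left_diff_distrib 1[unfolded slice_def])
    qed
  qed
qed

end


section \<open>Choice of the scale eps and comparison with the best fit\<close>

lemma cutoff_scale_rate:
  fixes x e :: real
  assumes K: "K \<ge> (1::nat)" and eps: "eps = real K powr (- x)"
  shows "(eps powr e)^2 = real K powr (- (2 * x * e))" "eps^2 = real K powr (- (2 * x))"
    "1 / (real K ^ m * eps ^ n) = real K powr (x * real n - real m)"
proof -
  have K0: "real K > 0" using K by simp
  show "(eps powr e)^2 = real K powr (- (2 * x * e))"
    unfolding eps using K0 by (simp add: powr_powr power2_eq_square powr_add[symmetric] mult_ac)
  show "eps^2 = real K powr (- (2 * x))"
    unfolding eps using K0 by (simp add: power2_eq_square powr_add[symmetric])
  have "eps ^ n = real K powr (- x * real n)"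
    unfolding eps using K0 by (simp add: powr_realpow[symmetric] powr_powr)
  then have "real K ^ m * eps ^ n = real K powr (real m - x * real n)"
    using K0 by (simp add: powr_realpow[symmetric] powr_add[symmetric])
  then show "1 / (real K ^ m * eps ^ n) = real K powr (x * real n - real m)"
    using powr_minus_divide[of "real K" "real m - x * real n"] by simp
qed

lemma sqrt_rate:
  assumes "K \<ge> (1::nat)" "C \<ge> 0" "z \<le> C * (real K powr (- (2 * p)))"
  shows "sqrt z \<le> sqrt C * real K powr (- p)"
proof -
  have "real K powr (- (2 * p)) = (real K powr (- p))^2"
    using assms(1) by (simp add: power2_eq_square powr_add[symmetric])
  then have "sqrt z \<le> sqrt (C * (real K powr (- p))^2)" using assms(3) by simp
  then show ?thesis using assms(1) by (simp add: real_sqrt_mult)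
qed

text \<open>Minimality is about squares, which nonnegativity removes. Symmetry and nonnegativity are
  hypotheses because \<open>nrm\<close> is an arbitrary functional.\<close>

lemma best_fit_le:
  assumes a: "is_best_fit nrm d F K a" and b: "b \<in> coeff_vectors K"
    and minus: "\<And>c. nrm (\<lambda>s. slicing d (cos_sum K c) s - F s) = nrm (\<lambda>s. F s - slicing d (cos_sum K c) s)"
    and nonneg: "\<And>u. nrm u \<ge> 0"
  shows "nrm (\<lambda>s. F s - slicing d (cos_sum K a) s) \<le> nrm (\<lambda>s. F s - slicing d (cos_sum K b) s)"
proof -
  have "(nrm (\<lambda>s. slicing d (cos_sum K a) s - F s))^2 \<le> (nrm (\<lambda>s. slicing d (cos_sum K b) s - F s))^2"
    using a b unfolding is_best_fit_def is_arg_min_def by (meson not_le)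
  then show ?thesis unfolding minus using nonneg power2_le_imp_le by blast
qed

theorem proposition13:
  fixes d r :: nat and f F :: "real \<Rightarrow> real"
  assumes "d \<ge> 3" and "r \<ge> 1"
    and "(\<lambda>x. f \<bar>x\<bar>) \<in> sobolev_space r (-1) 1"
    and "\<And>s. s \<in> {0..1} \<Longrightarrow> F s = slicing d f s"
  shows "(\<exists>C>0. \<forall>K\<ge>1. \<forall>a. is_best_fit (L2_norm 0 1) d F K a \<longrightarrow>
            (\<lambda>s. F s - slicing d (cos_sum K a) s) \<in> L2_space 0 1 \<and>
            L2_norm 0 1 (\<lambda>s. F s - slicing d (cos_sum K a) s)
              \<le> C * real K powr (- (real r / (1 + 2 * real r / (real d - 1))))) \<and>
         (\<exists>C>0. \<forall>K\<ge>1. \<forall>a. is_best_fit (H1_norm 0 1) d F K a \<longrightarrow>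
            (\<lambda>s. F s - slicing d (cos_sum K a) s) \<in> sobolev_space 1 0 1 \<and>
            H1_norm 0 1 (\<lambda>s. F s - slicing d (cos_sum K a) s)
              \<le> C * real K powr
                    (- ((real r - 1) * (real d - 3) / (real d - 3 + 2 * real r))))"
proof -
  obtain H :: "nat \<Rightarrow> real \<Rightarrow> real" where H:
    "even_jet H r" and f: "AE x in L01. f x = H 0 x"
  proof (rule even_sobolev_jet[OF assms(3,2)])
    fix H :: "nat \<Rightarrow> real \<Rightarrow> real"
    assume "\<And>i. i \<le> r \<Longrightarrow> H i \<in> borel_funs"
      "\<And>i. i \<le> r \<Longrightarrow> sq_integrable (L11) (H i)"
      "\<And>i \<phi>. i \<le> r \<Longrightarrow> test_fun (-1) 1 \<phi> \<Longrightarrow>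
         (\<integral>x. H 0 x * (deriv ^^ i) \<phi> x \<partial>L11) = (-1) ^ i * (\<integral>x. H i x * \<phi> x \<partial>L11)"
      "\<And>x. H 0 (- x) = H 0 x" "\<And>x. H 1 (- x) = - H 1 x" and f: "AE x in L01. f x = H 0 x"
    then have "even_jet H r" using assms(2) by unfold_locales
    then show thesis using f that by blast
  qed
  interpret even_jet H r by (rule H)
  define E where "E K b s = F s - slicing d (cos_sum K b) s" for K b s
  define U where "U K b = err d K b" for K b
  define V where "V K b = err_deriv d K b" for K b
  have EU: "AE s in L01. E K b s = U K b s" for K b
    unfolding E_def U_def by (rule slicing_error(1)[OF assms(1) f]) (rule assms(4))
  have UV: "borel_weak_deriv 0 1 (U K b) (V K b)" for K b
    unfolding U_def V_def by (rule slicing_error(2)[OF assms(1) f]) (rule assms(4))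
  have U: "U K b \<in> borel_funs" "sq_integrable (L01) (U K b)" for K b
    using UV unfolding borel_weak_deriv_def by auto
  have EU': "AE s in L01. slicing d (cos_sum K b) s - F s = - U K b s" for K b
    using EU[of K b] by eventually_elim (simp add: E_def)
  have L2E: "E K b \<in> L2_space 0 1" "L2_norm 0 1 (E K b) = sqrt (sqnorm L01 (U K b))" for K b
    using L2_space_iff_representative[OF U(1) EU] U(2) L2_norm_representative[OF U(1) EU] by auto
  have H1E: "E K b \<in> sobolev_space 1 0 1"
    "H1_norm 0 1 (E K b) = sqrt (sqnorm L01 (U K b) + sqnorm L01 (V K b))" for K b
    using sobolev_space_1I[OF UV EU] H1_norm_representative[OF UV EU] by auto
  have L2minus: "L2_norm 0 1 (\<lambda>s. slicing d (cos_sum K b) s - F s) = L2_norm 0 1 (\<lambda>s. F s - slicing d (cos_sum K b) s)" for K b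
    using L2_norm_representative[OF _ EU'] L2E(2)[of K b] U(1) unfolding E_def by simp
  have H1minus: "H1_norm 0 1 (\<lambda>s. slicing d (cos_sum K b) s - F s) = H1_norm 0 1 (\<lambda>s. F s - slicing d (cos_sum K b) s)" for K b
    using H1_norm_representative[OF borel_weak_deriv_uminus[OF UV] EU'] H1E(2)[of K b] unfolding E_def by simp
  have nonneg: "L2_norm 0 1 u \<ge> 0" "H1_norm 0 1 u \<ge> 0" for u
    unfolding L2_norm_def H1_norm_def set_lebesgue_integral_def by (auto intro!: Bochner_Integration.integral_nonneg)
  obtain C where C: "C > 0" and approx:
    "\<forall>K eps. K \<ge> 1 \<longrightarrow> 0 < eps \<longrightarrow> eps \<le> 1 \<longrightarrow> (\<exists>b \<in> coeff_vectors K.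
      sqnorm L01 (U K b)
        \<le> C * ((eps powr ((real d - 3) / 2))^2 * eps^2 + 1 / (real K ^ (2 * r) * eps ^ (2 * r))) \<and>
      sqnorm L01 (V K b)
        \<le> C * ((eps powr ((real d - 3) / 2))^2 + 1 / (real K ^ (2 * (r - 1)) * eps ^ (2 * r))))"
    using slicing_approx[OF assms(1)] unfolding U_def V_def by (elim exE conjE)
  have rr: "real r \<ge> 1" "real d \<ge> 3" "real (2 * (r - 1)) = 2 * (real r - 1)" using assms(1,2) by auto
  have scale: "0 < real K powr (- x)" "real K powr (- x) \<le> 1" if "K \<ge> 1" "x \<ge> 0" for K :: nat and x :: real
    using that by (auto simp: powr_minus_divide ge_one_powr_ge_zero divide_le_eq_1)
  let "?L2 \<and> ?H1" = ?thesis
  show ?thesis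
  proof (intro conjI)
    define p where "p = real r / (1 + 2 * real r / (real d - 1))"
    \<comment> \<open>With eps = K^(-x) the two error terms balance when x (d-1)/2 = r (1 - x);
      solving gives this x, and \<open>p\<close> is the common value.\<close>
    define x where "x = 2 * real r / (real d - 1 + 2 * real r)"
    have pos: "real d - 1 + 2 * real r > 0" "real d - 1 > 0" using rr by auto
    have p: "p = real r * (real d - 1) / (real d - 1 + 2 * real r)"
      using pos unfolding p_def by (simp add: field_simps)
    have x: "x \<ge> 0" "x * (real d - 1) = 2 * p" "x * (2 * real r) - 2 * real r = - (2 * p)"
      using pos rr unfolding x_def p by (auto simp: field_simps)
    have "L2_norm 0 1 (E K a) \<le> sqrt (2 * C) * real K powr (- p)"
      if K: "K \<ge> 1" and a: "is_best_fit (L2_norm 0 1) d F K a" for K a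
    proof -
      define eps where "eps = real K powr (- x)"
      note sc = scale[OF K x(1), folded eps_def]
      note rate = cutoff_scale_rate[OF K eps_def]
      obtain b where b: "b \<in> coeff_vectors K" "sqnorm L01 (U K b)
        \<le> C * ((eps powr ((real d - 3) / 2))^2 * eps^2 + 1 / (real K ^ (2 * r) * eps ^ (2 * r)))"
        using approx[rule_format, OF K sc] by blast
      have "(eps powr ((real d - 3) / 2))^2 * eps^2 = real K powr (- (2 * x * ((real d - 3) / 2)) + - (2 * x))"
        unfolding rate(1,2) by (rule powr_add[symmetric])
      also have "- (2 * x * ((real d - 3) / 2)) + - (2 * x) = - (2 * p)"
        using x(2) by (simp add: algebra_simps)
      finally have 1: "(eps powr ((real d - 3) / 2))^2 * eps^2 = real K powr (- (2 * p))" .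
      have 2: "1 / (real K ^ (2 * r) * eps ^ (2 * r)) = real K powr (- (2 * p))"
        unfolding rate(3) using x(3) by simp
      have "sqnorm L01 (U K b) \<le> (2 * C) * real K powr (- (2 * p))"
        using b(2) unfolding 1 2 by simp
      then have "L2_norm 0 1 (E K b) \<le> sqrt (2 * C) * real K powr (- p)"
        unfolding L2E(2) using C by (intro sqrt_rate K) auto
      moreover have "L2_norm 0 1 (E K a) \<le> L2_norm 0 1 (E K b)"
        unfolding E_def by (rule best_fit_le[OF a b(1) L2minus nonneg(1)])
      ultimately show ?thesis by simp
    qed
    then show ?L2
      using C L2E(1) unfolding E_def p_def by (intro exI[of _ "sqrt (2 * C)"]) auto
  next
    define q where "q = (real r - 1) * (real d - 3) / (real d - 3 + 2 * real r)"
    \<comment> \<open>Here the balance is x (d-3)/2 = r - 1 - r x, with common value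
      \<open>q\<close>. For r = 1 it gives x = 0, that is eps = 1, and q = 0; for d = 3 also q =
      0.\<close>
    define x where "x = 2 * (real r - 1) / (real d - 3 + 2 * real r)"
    have pos: "real d - 3 + 2 * real r > 0" using rr by auto
    have x: "x \<ge> 0" "x * (real d - 3) = 2 * q" "x * (2 * real r) - 2 * (real r - 1) = - (2 * q)"
      using pos rr unfolding x_def q_def by (auto simp: field_simps)
    have "H1_norm 0 1 (E K a) \<le> sqrt (4 * C) * real K powr (- q)"
      if K: "K \<ge> 1" and a: "is_best_fit (H1_norm 0 1) d F K a" for K a
    proof -
      define eps where "eps = real K powr (- x)"
      note sc = scale[OF K x(1), folded eps_def]
      note rate = cutoff_scale_rate[OF K eps_def]
      obtain b where b: "b \<in> coeff_vectors K" "sqnorm L01 (U K b)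
        \<le> C * ((eps powr ((real d - 3) / 2))^2 * eps^2 + 1 / (real K ^ (2 * r) * eps ^ (2 * r)))"
        "sqnorm L01 (V K b)
        \<le> C * ((eps powr ((real d - 3) / 2))^2 + 1 / (real K ^ (2 * (r - 1)) * eps ^ (2 * r)))"
        using approx[rule_format, OF K sc] by blast
      have 1: "(eps powr ((real d - 3) / 2))^2 = real K powr (- (2 * q))"
        unfolding rate(1) using x(2) by simp
      have 2: "1 / (real K ^ (2 * (r - 1)) * eps ^ (2 * r)) = real K powr (- (2 * q))"
        unfolding rate(3) rr(3) using x(3) by simp
      \<comment> \<open>The bound for the L2 part is dominated by that for the derivative: its first
        term carries the extra factor eps^2, its second two more powers of K in the
        denominator.\<close>
      have "eps^2 \<le> 1" using sc by (intro power_le_one) auto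
      then have 3: "(eps powr ((real d - 3) / 2))^2 * eps^2 \<le> real K powr (- (2 * q))"
        unfolding 1 by (intro mult_left_le) auto
      have "real K ^ (2 * (r - 1)) \<le> real K ^ (2 * r)" using K by (intro power_increasing) auto
      then have "1 / (real K ^ (2 * r) * eps ^ (2 * r)) \<le> 1 / (real K ^ (2 * (r - 1)) * eps ^ (2 * r))"
        using K sc by (intro divide_left_mono mult_right_mono mult_pos_pos zero_less_power) auto
      then have 4: "1 / (real K ^ (2 * r) * eps ^ (2 * r)) \<le> real K powr (- (2 * q))" unfolding 2 .
      have "sqnorm L01 (U K b) \<le> C * (real K powr (- (2 * q)) + real K powr (- (2 * q)))"
        by (rule order_trans[OF b(2)]) (use C 3 4 in \<open>intro mult_left_mono add_mono; simp\<close>)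
      moreover have "sqnorm L01 (V K b) \<le> C * (real K powr (- (2 * q)) + real K powr (- (2 * q)))"
        using b(3) unfolding 1 2 .
      \<comment> \<open>Two squared norms with two terms of the same size each account for the
        4.\<close>
      ultimately have "sqnorm L01 (U K b) + sqnorm L01 (V K b) \<le> (4 * C) * real K powr (- (2 * q))"
        by simp
      then have "H1_norm 0 1 (E K b) \<le> sqrt (4 * C) * real K powr (- q)"
        unfolding H1E(2) using C by (intro sqrt_rate K) auto
      moreover have "H1_norm 0 1 (E K a) \<le> H1_norm 0 1 (E K b)"
        unfolding E_def by (rule best_fit_le[OF a b(1) H1minus nonneg(2)])
      ultimately show ?thesis by simp
    qed
    then show ?H1
      using C H1E(1) unfolding E_def q_def by (intro exI[of _ "sqrt (4 * C)"]) auto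
  qed
qed

end
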